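(* Let $r=r_1+r_2\ge 2$ with integers $r_1,r_2\ge 0$, and let $\mu$ be a Borel probability measure on $\mathbb{Z}^{r_1}\times\mathbb{R}^{r_2}$ with one-dimensional marginals $\mu_1,\dots,\mu_r$. Suppose that $\mu_i((0,\infty))>0$ for every $i$, that for $i\le r_1$ one has $\operatorname{supp}(\mu_i)\subset\mathbb{Z}$ and $\gcd\operatorname{supp}(\mu_i)=1$, and that for $i>r_1$ the marginal $\mu_i$ is non-lattice. Suppose that for each $i\in\{1,\dots,r\}$ the one-dimensional reflected random walk induced by $\mu_i$ is positive recurrent on the set $\mathcal{L}_i$ defined in the context. Then each class $\mathcal{X}^{(j)}$ (defined in the context) of the state space $\mathcal{X}=\mathbb{N}_0^{r_1}\times\mathbb{R}_+^{r_2}$ carries a unique invariant probability measure $\nu^{(j)}$ for the $r$-dimensional reflected random walk $(X_n^x)$ induced by $\mu$. Moreover, reflected random walk started at any point of $\mathcal{X}^{(j)}$ is almost surely absorbed by $\mathcal{L}^{(j)}=\operatorname{supp}(\nu^{(j)})$, and it is positive recurrent on $\mathcal{L}^{(j)}$.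
   Context: Reflected random walk. Let $(Y_n)_{n\ge1}$ be i.i.d. random vectors in $\mathbb{R}^r$ with law $\mu$. For $x\in\mathbb{R}^r$ write $|x|=(|x_1|,\dots,|x_r|)$. The reflected random walk induced by $\mu$ and started at $x$ is $X_0^x=x$, $X_n^x=|X_{n-1}^x-Y_n|$. Here it lives on $\mathcal{X}=\mathbb{N}_0^{r_1}\times\mathbb{R}_+^{r_2}$ with $\mathbb{N}_0=\{0,1,2,\dots\}$, $\mathbb{R}_+=[0,\infty)$, and the Euclidean metric. Its $i$-th coordinate is the one-dimensional reflected random walk induced by $\mu_i$ (same definition with $r=1$), on $\mathcal{X}_i=\mathbb{N}_0$ for $i\le r_1$ and on $\mathcal{X}_i=\mathbb{R}_+$ for $i>r_1$. A probability measure on $\mathbb{R}$ is non-lattice if there is no $\kappa>0$ such that its support is contained in $\kappa\mathbb{Z}$. The sets $\mathcal{L}_i$. Put $N_i=\sup\operatorname{supp}(\mu_i)$ if $\operatorname{supp}(\mu_i)\subset\mathbb{R}_+$ and $N_i=\infty$ otherwise. Then $\mathcal{L}_i=[0,N_i]\cap\mathcal{X}_i$ if $N_i<\infty$, and $\mathcal{L}_i=\mathcal{X}_i$ if $N_i=\infty$. The classes $\mathcal{X}^{(j)}$. If $r_1=0$ there is a single class, $\mathcal{X}^{(1)}=\mathcal{X}$. If $r_1\ge1$, let $\boldsymbol{\pi}:\mathbb{Z}^{r_1}\times\mathbb{R}^{r_2}\to\{0,1\}^{r_1}=(\mathbb{Z}/2\mathbb{Z})^{r_1}$ be the map reducing each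 of the first $r_1$ coordinates mod 2. The process $(\boldsymbol{\pi}(X_n^x))_{n\ge0}$ is a random walk on the group $(\mathbb{Z}/2\mathbb{Z})^{r_1}$ driven by the image measure of $\mu$ under $\boldsymbol{\pi}$. Let $\Gamma$ be the subgroup generated by the support of this image measure (the elements reachable from $0$), and let $\Gamma^{(j)}$ be the cosets of $\Gamma$ in $(\mathbb{Z}/2\mathbb{Z})^{r_1}$. Then $\mathcal{X}^{(j)}=\{x\in\mathcal{X}:\boldsymbol{\pi}(x)\in\Gamma^{(j)}\}$. The process started in $\mathcal{X}^{(j)}$ never leaves $\mathcal{X}^{(j)}$. An invariant probability measure on a class is a Borel probability measure $\nu$ on it such that $\int \Pr[X_1^x\in B]\,d\nu(x)=\nu(B)$ for all Borel sets $B$. "Absorbed by $\mathcal{L}$" means that the distance from $X_n^x$ to $\mathcal{L}$ tends to $0$ almost surely. "Positive recurrent on a closed set $\mathcal{L}$" means: for every open set $U$ with $U\cap\mathcal{L}\neq\emptyset$, the return time $\inf\{n\ge1: X_n^x\in U\}$ to $U$ has finite expectation for every starting point $x\in U\cap\mathcal{L}$. *)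

theory Defs
  imports "HOL-Probability.Probability" "HOL-Algebra.Product_Groups"
begin

text \<open>
  The state space sits in \<open>real ^ 'n\<close> with \<open>r = CARD('n)\<close>.  The set \<open>D\<close> of integer-valued coordinates
  replaces the index range \<open>1, ..., r\<^sub>1\<close>, so that \<open>r\<^sub>1 = card D\<close>, and both \<open>D = {}\<close> and
  \<open>D = UNIV\<close> are allowed.
\<close>

definition supp :: "'a::topological_space measure \<Rightarrow> 'a set" where
  "supp \<mu> = {x. \<forall>U. open U \<longrightarrow> x \<in> U \<longrightarrow> emeasure \<mu> U > 0}"

definition marginal :: "(real ^ 'n) measure \<Rightarrow> 'n \<Rightarrow> real measure" where
  "marginal \<mu> i = distr \<mu> borel (\<lambda>y. y $ i)"

definition non_lattice :: "real measure \<Rightarrow> bool" where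
  "non_lattice \<mu> \<longleftrightarrow> \<not> (\<exists>\<kappa>>0. supp \<mu> \<subseteq> range (\<lambda>k::int. \<kappa> * of_int k))"

text \<open>
  The absolute value is that of an ordered Euclidean space: the usual one on \<^typ>\<open>real\<close>, and
  componentwise on vectors.  The sequence of increments starts at index 1; \<open>y 0\<close> is not used.
\<close>

primrec refl_walk :: "(nat \<Rightarrow> 'a::ordered_euclidean_space) \<Rightarrow> 'a \<Rightarrow> nat \<Rightarrow> 'a" where
  "refl_walk y x 0 = x"
| "refl_walk y x (Suc n) = \<bar>refl_walk y x n - y (Suc n)\<bar>"

lemma refl_walk_nth: "refl_walk y x n $ i = refl_walk (\<lambda>k. y k $ i) (x $ i) n"
  for y :: "nat \<Rightarrow> real ^ 'n"
  by (induction n) (simp_all add: abs_vec_def)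

definition iid_with_law :: "'w measure \<Rightarrow> (nat \<Rightarrow> 'w \<Rightarrow> 'a::topological_space) \<Rightarrow> 'a measure \<Rightarrow> bool" where
  "iid_with_law M Y \<mu> \<longleftrightarrow>
     prob_space M \<and> prob_space.indep_vars M (\<lambda>_. borel) Y {1..} \<and> (\<forall>n\<ge>1. distr M borel (Y n) = \<mu>)"

text \<open>The infimum is taken in \<^typ>\<open>ennreal\<close>, so it is \<open>\<infinity>\<close> if there is no return.\<close>

definition return_time :: "(nat \<Rightarrow> 'a) \<Rightarrow> 'a set \<Rightarrow> ennreal" where
  "return_time X U = (INF n\<in>{n. 1 \<le> n \<and> X n \<in> U}. of_nat n)"

text \<open>
  Open sets are taken in the ambient space; the relatively open subsets of the state space are
  their traces, and a walk started in the state space stays there almost surely.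
\<close>

definition positive_recurrent_on ::
    "'w measure \<Rightarrow> (nat \<Rightarrow> 'w \<Rightarrow> 'a::ordered_euclidean_space) \<Rightarrow> 'a set \<Rightarrow> bool" where
  "positive_recurrent_on M Y L \<longleftrightarrow>
     (\<forall>U. open U \<longrightarrow> U \<inter> L \<noteq> {} \<longrightarrow>
        (\<forall>x \<in> U \<inter> L. (\<integral>\<^sup>+ \<omega>. return_time (refl_walk (\<lambda>n. Y n \<omega>) x) U \<partial>M) < \<infinity>))"

definition absorbed_by ::
    "'w measure \<Rightarrow> (nat \<Rightarrow> 'w \<Rightarrow> 'a::ordered_euclidean_space) \<Rightarrow> 'a \<Rightarrow> 'a set \<Rightarrow> bool" where
  "absorbed_by M Y x L \<longleftrightarrow>
     (AE \<omega> in M. (\<lambda>n. infdist (refl_walk (\<lambda>k. Y k \<omega>) x n) L) \<longlonglongrightarrow> 0)"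

text \<open>
  A probability measure on the Borel set \<open>K\<close> is represented as a Borel probability measure on the
  ambient space that gives \<open>K\<close> full mass.
\<close>

definition invariant_prob_on ::
    "'w measure \<Rightarrow> (nat \<Rightarrow> 'w \<Rightarrow> 'a::ordered_euclidean_space) \<Rightarrow> 'a set \<Rightarrow> 'a measure \<Rightarrow> bool" where
  "invariant_prob_on M Y K \<nu> \<longleftrightarrow>
     prob_space \<nu> \<and> sets \<nu> = sets borel \<and> emeasure \<nu> K = 1 \<and>
     (\<forall>B \<in> sets borel.
        (\<integral>\<^sup>+ x. emeasure M {\<omega> \<in> space M. refl_walk (\<lambda>n. Y n \<omega>) x 1 \<in> B} \<partial>\<nu>) = emeasure \<nu> B)"

definition coord_space :: "'n set \<Rightarrow> 'n \<Rightarrow> real set" where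
  "coord_space D i = (if i \<in> D then \<nat> else {0..})"

definition state_space :: "'n set \<Rightarrow> (real ^ 'n) set" where
  "state_space D = {x. \<forall>i. x $ i \<in> coord_space D i}"

definition upper_end :: "real measure \<Rightarrow> ereal" where
  "upper_end \<mu> = (if supp \<mu> \<subseteq> {0..} then (SUP y \<in> supp \<mu>. ereal y) else \<infinity>)"

definition ess_set :: "(real ^ 'n) measure \<Rightarrow> 'n set \<Rightarrow> 'n \<Rightarrow> real set" where
  "ess_set \<mu> D i = {x \<in> coord_space D i. 0 \<le> x \<and> ereal x \<le> upper_end (marginal \<mu> i)}"

definition parity_group :: "'n set \<Rightarrow> ('n \<Rightarrow> int) monoid" where
  "parity_group D = product_group D (\<lambda>_. integer_mod_group 2)"

text \<open>
  The floor only makes the reduction mod 2 total: it is the identity on the integer coordinates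
  in \<open>D\<close> that matter here.
\<close>

definition parity :: "'n set \<Rightarrow> real ^ 'n \<Rightarrow> ('n \<Rightarrow> int)" where
  "parity D x = (\<lambda>i\<in>D. \<lfloor>x $ i\<rfloor> mod 2)"

text \<open>In the finite discrete group, the support consists of the points of positive mass.\<close>

definition parity_supp :: "(real ^ 'n) measure \<Rightarrow> 'n set \<Rightarrow> ('n \<Rightarrow> int) set" where
  "parity_supp \<mu> D =
     {g \<in> carrier (parity_group D).
        emeasure (distr \<mu> (count_space (carrier (parity_group D))) (parity D)) {g} > 0}"

definition parity_subgroup :: "(real ^ 'n) measure \<Rightarrow> 'n set \<Rightarrow> ('n \<Rightarrow> int) set" where
  "parity_subgroup \<mu> D = generate (parity_group D) (parity_supp \<mu> D)"

text \<open>For \<open>D = {}\<close> the parity group is trivial and the whole state space is the only class.\<close>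

definition state_classes :: "(real ^ 'n) measure \<Rightarrow> 'n set \<Rightarrow> (real ^ 'n) set set" where
  "state_classes \<mu> D =
     (\<lambda>C. {x \<in> state_space D. parity D x \<in> C}) ` (rcosets\<^bsub>parity_group D\<^esub> (parity_subgroup \<mu> D))"

text \<open>
  The emeasure in \<open>parity_supp\<close> is not the junk value of \<^const>\<open>distr\<close>: the parity map is
  measurable.
\<close>

lemma parity_measurable:
  fixes \<mu> :: "(real ^ 'n) measure"
  assumes "sets \<mu> = sets borel"
  shows "parity D \<in> measurable \<mu> (count_space (carrier (parity_group D)))"
proof -
  have fin: "finite (carrier (parity_group D))"
    by (auto simp: parity_group_def integer_mod_group_def intro!: finite_PiE)
  have nth: "(\<lambda>x::real ^ 'n. x $ i) \<in> borel_measurable borel" for i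
    by (intro borel_measurable_continuous_onI continuous_intros)
  have fl: "(\<lambda>x::real ^ 'n. \<lfloor>x $ i\<rfloor> mod 2) \<in> measurable borel (count_space UNIV)" for i
    using nth[of i] by measurable
  have "parity D \<in> measurable borel (count_space (carrier (parity_group D)))"
  proof (rule measurable_count_space_eq2[THEN iffD2, OF fin], intro conjI ballI)
    show "parity D \<in> space borel \<rightarrow> carrier (parity_group D)"
      by (auto simp: parity_def parity_group_def integer_mod_group_def)
    fix g assume g: "g \<in> carrier (parity_group D)"
    have "parity D -` {g} \<inter> space borel = {x. \<forall>i\<in>D. \<lfloor>x $ i\<rfloor> mod 2 = g i}"
      using g by (auto simp: parity_def parity_group_def PiE_def extensional_def fun_eq_iff)
    also have "\<dots> = (if D = {} then UNIV else (\<Inter>i\<in>D. (\<lambda>x. \<lfloor>x $ i\<rfloor> mod 2) -` {g i} \<inter> space borel))"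
      by auto
    also have "\<dots> \<in> sets borel"
      using measurable_sets[OF fl] by (auto intro!: sets.finite_INT)
    finally show "parity D -` {g} \<inter> space borel \<in> sets borel" .
  qed
  then show ?thesis
    using assms by (simp cong: measurable_cong_sets)
qed

end

theory Submission
  imports Defs "HOL-Real_Asymp.Real_Asymp"
begin

text \<open>
  One coordinate \<open>x\<close> is compared with a copy \<open>z\<close>, driven by the same increments, that is reset to 0
  whenever it enters a short interval \<open>[0, a)\<close>.  Positive recurrence at 0 makes the cycles of \<open>z\<close>
  integrable.  Over a cycle \<open>\<bar>x - z\<bar>\<close> grows by at most \<open>a\<close>, while with positive probability the first
  step brings a distant \<open>x\<close> closer by more than that, so an exponential moment of \<open>\<bar>x - z\<bar>\<close> stays
  bounded and the walk is tight.

  The distance between two walks with the same increments never increases.  If it cannot decrease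
  at all from some pair of distinct points, the increments generate a subgroup of the reals
  without small positive elements; this is excluded for non-lattice coordinates, and for integer
  ones as soon as the distance is at least 2.  With tightness, any two walks that start with the
  same parities get arbitrarily close to each other.

  Contraction gives existence (the backward iteration, started so that its endpoint has a
  prescribed parity, converges in probability; averaging the limit laws over the coset yields an
  invariant measure), uniqueness (the parity of an invariant measure is uniform on the coset) and
  absorption.  Positive recurrence follows from Kac's formula: a ball around a point of the support
  contains points with finite mean return time to that ball, and the walk is nonexpansive.
\<close>

section \<open>Walks driven by streams of increments\<close>

text \<open>Positive recurrence of each coordinate says nothing directly about the vector walk: the
  coordinates are coupled through \<open>\<mu>\<close> in an arbitrary way and need not be near 0
  together. Tightness does pass from coordinates to vectors, by a union bound, and is therefore the
  first goal. The copy \<open>z\<close> is reset on an interval because a non-lattice walk need not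
  return to 0 exactly. Each reset may cost up to \<open>a\<close> in distance, so \<open>a\<close>
  has to be small against the gain of the first step and depends on its probability. Of the cycle
  lengths only the first moment is available. This suffices because the distance does not grow
  between resets: a moment bound is needed at reset times only, and the first moment then controls
  the age of the current cycle. Forward positions keep fluctuating; reversing the order of the
  increments produces positions that can converge along a fixed stream. Reversal preserves the law
  at each single time only, so it yields convergence in probability, and almost sure limits exist
  along a rapid subsequence.\<close>

primrec flow :: "('s \<Rightarrow> 'a \<Rightarrow> 's) \<Rightarrow> nat \<Rightarrow> 's \<Rightarrow> 'a stream \<Rightarrow> 's" where
  "flow \<phi> 0 s ys = s"
| "flow \<phi> (Suc n) s ys = flow \<phi> n (\<phi> s (shd ys)) (stl ys)"

text \<open>The first increment acts last, so a longer horizon changes only the innermost argument: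
  along a fixed stream these positions can converge, which cannot be expected of the forward
  ones.\<close>

primrec back_flow :: "('s \<Rightarrow> 'a \<Rightarrow> 's) \<Rightarrow> nat \<Rightarrow> 's \<Rightarrow> 'a stream \<Rightarrow> 's" where
  "back_flow \<phi> 0 s ys = s"
| "back_flow \<phi> (Suc n) s ys = \<phi> (back_flow \<phi> n s (stl ys)) (shd ys)"

lemma flow_Suc_right: "flow \<phi> (Suc n) s ys = \<phi> (flow \<phi> n s ys) (ys !! n)"
  by (induction n arbitrary: s ys) simp_all

lemma back_flow_add: "back_flow \<phi> (m + n) s ys = back_flow \<phi> m (back_flow \<phi> n s (sdrop m ys)) ys"
  by (induction m arbitrary: ys) simp_all

lemma flow_eq_fun:
  assumes "\<And>n. X (Suc n) = \<phi> (X n) (ys !! n)"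
  shows "X n = flow \<phi> n (X 0) ys"
proof (induction n)
  case (Suc n)
  then show ?case using flow_Suc_right[of \<phi> n "X 0" ys] assms by simp
qed simp

lemma refl_walk_eq_flow:
  "refl_walk Y x n = flow (\<lambda>x y. \<bar>x - y\<bar>) n x (to_stream (\<lambda>n. Y (Suc n)))"
  using flow_eq_fun[of "refl_walk Y x" "\<lambda>x y. \<bar>x - y\<bar>" "to_stream (\<lambda>n. Y (Suc n))" n]
  by (simp add: to_stream_def)

lemma refl_walk_coord_eq_flow:
  fixes Y :: "nat \<Rightarrow> real ^ 'n"
  shows "refl_walk (\<lambda>n. Y n $ i) x n = flow (\<lambda>x y. \<bar>x - y $ i\<bar>) n x (to_stream (\<lambda>n. Y (Suc n)))"
  using flow_eq_fun[of "refl_walk (\<lambda>n. Y n $ i) x" "\<lambda>x y. \<bar>x - y $ i\<bar>" "to_stream (\<lambda>n. Y (Suc n))" n]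
  by (simp add: to_stream_def)

lemma flow_coord:
  fixes x :: "real ^ 'n"
  shows "flow (\<lambda>x y. \<bar>x - y\<bar>) n x ys $ i = flow (\<lambda>x y. \<bar>x - y $ i\<bar>) n (x $ i) ys"
  by (induction n arbitrary: x ys) (simp_all add: abs_vec_def)

lemma flow_prod:
  "flow (\<lambda>p y. (\<phi> (fst p) y, \<psi> (snd p) y)) n p ys = (flow \<phi> n (fst p) ys, flow \<psi> n (snd p) ys)"
  by (induction n arbitrary: p ys) simp_all

lemma back_flow_prod:
  "back_flow (\<lambda>p y. (\<phi> (fst p) y, \<psi> (snd p) y)) n p ys =
     (back_flow \<phi> n (fst p) ys, back_flow \<psi> n (snd p) ys)"
  by (induction n arbitrary: ys) simp_all

text \<open>Tail-sum formula: a positive integer time is the number of \<open>k\<close> that it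
  exceeds. In \<open>ennreal\<close> it covers the case of no return, and it turns mean return times
  into series of survival probabilities.\<close>

lemma return_time_eq_suminf:
  "return_time X U = (\<Sum>k. if \<forall>j\<in>{1..k}. X j \<notin> U then 1 else 0)"
proof (cases "\<exists>n\<ge>1. X n \<in> U")
  case False
  then have "{n. 1 \<le> n \<and> X n \<in> U} = {}" by auto
  then have "return_time X U = (\<infinity>::ennreal)" unfolding return_time_def by simp
  moreover have "(\<lambda>k. if \<forall>j\<in>{1..k}. X j \<notin> U then 1 else 0) = (\<lambda>k. 1::ennreal)"
    using False by (auto simp: fun_eq_iff)
  moreover have "(\<Sum>k. 1::ennreal) = \<infinity>"
    using nn_integral_count_space_nat[of "\<lambda>_. 1::ennreal"] by simp
  ultimately show ?thesis by simp
next
  case True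
  define m where "m = (LEAST n. 1 \<le> n \<and> X n \<in> U)"
  have m: "1 \<le> m" "X m \<in> U" and least: "\<And>n. 1 \<le> n \<Longrightarrow> X n \<in> U \<Longrightarrow> m \<le> n"
    unfolding m_def using True by (auto intro: LeastI2_ex Least_le)
  have "return_time X U = of_nat m"
    unfolding return_time_def by (rule antisym) (use m least in \<open>auto intro!: INF_lower INF_greatest\<close>)
  moreover have "(\<forall>j\<in>{1..k}. X j \<notin> U) \<longleftrightarrow> k \<in> {..<m}" for k
    using m least[of ] by (metis atLeastAtMost_iff leD lessThan_iff less_le_trans linorder_not_less)
  then have "(\<lambda>k. if \<forall>j\<in>{1..k}. X j \<notin> U then 1 else 0 :: ennreal) = indicator {..<m}"
    by (auto simp: fun_eq_iff indicator_def)
  moreover have "(\<Sum>k. indicator {..<m} k) = (\<Sum>k<m. 1::ennreal)"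
    by (subst suminf_finite[of "{..<m}"]) auto
  ultimately show ?thesis by simp
qed

lemma all_Suc_shift: "(\<forall>j\<in>{1..Suc n}. P j) \<longleftrightarrow> P (Suc 0) \<and> (\<forall>j\<in>{1..n}. P (Suc j))"
proof -
  have "{1..Suc n} = insert (Suc 0) (Suc ` {1..n})"
    by (simp add: image_Suc_atLeastAtMost atLeastAtMost_insertL)
  then show ?thesis by (simp only: ball_simps) blast
qed

section \<open>Integration over streams of independent increments\<close>

locale noise = prob_space \<mu> for \<mu> :: "'a::topological_space measure" +
  assumes sets_noise [measurable_cong, simp]: "sets \<mu> = sets borel"
begin

abbreviation S :: "'a stream measure" where "S \<equiv> stream_space \<mu>"

lemma space_noise [simp]: "space \<mu> = UNIV"
  using sets_eq_imp_space_eq[OF sets_noise] by simp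

lemma space_S [simp]: "space S = UNIV"
  by (simp add: space_stream_space)

sublocale S: prob_space S
  by (rule prob_space_stream_space)

lemma emeasure_UNIV [simp]: "emeasure \<mu> UNIV = 1" "emeasure S UNIV = 1"
  using emeasure_space_1 S.emeasure_space_1 by simp_all

lemma sets_Collect_S: "Measurable.pred S P \<Longrightarrow> {ys. P ys} \<in> sets S"
  by (simp add: pred_def)

lemma measurable_flow [measurable (raw)]:
  fixes \<phi> :: "'s::topological_space \<Rightarrow> 'a \<Rightarrow> 's"
  assumes \<phi>: "case_prod \<phi> \<in> measurable (borel \<Otimes>\<^sub>M borel) borel"
    and f: "f \<in> measurable N borel" and g: "g \<in> measurable N S"
  shows "(\<lambda>x. flow \<phi> n (f x) (g x)) \<in> measurable N borel"
  using f g
proof (induction n arbitrary: f g)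
  case (Suc n)
  have [measurable]: "f \<in> measurable N borel" "(\<lambda>x. shd (g x)) \<in> measurable N borel"
    using Suc.prems measurable_compose[OF Suc.prems(2) measurable_shd]
    by (simp_all add: measurable_cong_sets[OF refl sets_noise])
  have "(\<lambda>x. (f x, shd (g x))) \<in> measurable N (borel \<Otimes>\<^sub>M borel)" by measurable
  from measurable_compose[OF this \<phi>] have "(\<lambda>x. \<phi> (f x) (shd (g x))) \<in> measurable N borel" by simp
  moreover have "(\<lambda>x. stl (g x)) \<in> measurable N S"
    by (rule measurable_compose[OF \<open>g \<in> _\<close> measurable_stl])
  ultimately show ?case unfolding flow.simps by (rule Suc.IH)
qed simp

lemma measurable_back_flow [measurable (raw)]:
  fixes \<phi> :: "'s::topological_space \<Rightarrow> 'a \<Rightarrow> 's"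
  assumes \<phi>: "case_prod \<phi> \<in> measurable (borel \<Otimes>\<^sub>M borel) borel"
    and f: "f \<in> measurable N borel" and g: "g \<in> measurable N S"
  shows "(\<lambda>x. back_flow \<phi> n (f x) (g x)) \<in> measurable N borel"
  using f g
proof (induction n arbitrary: g)
  case (Suc n)
  have [measurable]: "f \<in> measurable N borel" "(\<lambda>x. shd (g x)) \<in> measurable N borel"
    using Suc.prems measurable_compose[OF Suc.prems(2) measurable_shd]
    by (simp_all add: measurable_cong_sets[OF refl sets_noise])
  have "(\<lambda>x. stl (g x)) \<in> measurable N S"
    by (rule measurable_compose[OF \<open>g \<in> _\<close> measurable_stl])
  then have [measurable]: "(\<lambda>x. back_flow \<phi> n (f x) (stl (g x))) \<in> measurable N borel"
    using Suc.IH \<open>f \<in> _\<close> by blast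
  have "(\<lambda>x. (back_flow \<phi> n (f x) (stl (g x)), shd (g x))) \<in> measurable N (borel \<Otimes>\<^sub>M borel)"
    by measurable
  from measurable_compose[OF this \<phi>] show ?case by simp
qed simp

lemma nn_integral_sdrop:
  assumes [measurable]: "F \<in> borel_measurable S"
  shows "(\<integral>\<^sup>+ys. F (sdrop n ys) \<partial>S) = (\<integral>\<^sup>+ys. F ys \<partial>S)"
proof (induction n)
  case (Suc n)
  have "(\<integral>\<^sup>+ys. F (sdrop (Suc n) ys) \<partial>S) = (\<integral>\<^sup>+y. \<integral>\<^sup>+ys. F (sdrop n ys) \<partial>S \<partial>\<mu>)"
    by (subst nn_integral_stream_space) simp_all
  then show ?case using Suc by simp
qed simp

text \<open>\<open>P\<close> is not assumed measurable, so Fubini is applied to a measurable null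
  set that contains the exceptional streams.\<close>

lemma AE_Stream:
  assumes "AE ys in S. P ys"
  shows "AE y in \<mu>. AE ys in S. P (y ## ys)"
proof -
  from AE_E[OF assms] obtain N where N: "{ys \<in> space S. \<not> P ys} \<subseteq> N" "emeasure S N = 0" "N \<in> sets S" .
  have "AE ys in S. ys \<notin> N" using N by (intro AE_not_in) (auto simp: null_sets_def)
  then have "AE y in \<mu>. AE ys in S. y ## ys \<notin> N"
    by (subst (asm) AE_stream_space) (use N(3) in simp_all)
  then show ?thesis
  proof eventually_elim
    case (elim y)
    then show ?case by eventually_elim (use N(1) in auto)
  qed
qed

lemma distr_Stream: "distr (\<mu> \<Otimes>\<^sub>M S) S (\<lambda>p. fst p ## snd p) = S"
proof (rule measure_eqI)
  fix A assume "A \<in> sets (distr (\<mu> \<Otimes>\<^sub>M S) S (\<lambda>p. fst p ## snd p))"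
  then have [measurable]: "A \<in> sets S" by simp
  have m: "(\<lambda>p. fst p ## snd p) \<in> measurable (\<mu> \<Otimes>\<^sub>M S) S" by (rule measurable_Stream) simp_all
  have mi: "(\<lambda>p. indicator A (fst p ## snd p) :: ennreal) \<in> borel_measurable (\<mu> \<Otimes>\<^sub>M S)"
    by (rule measurable_compose[OF m]) simp
  have "emeasure (distr (\<mu> \<Otimes>\<^sub>M S) S (\<lambda>p. fst p ## snd p)) A = (\<integral>\<^sup>+p. indicator A (fst p ## snd p) \<partial>(\<mu> \<Otimes>\<^sub>M S))"
    by (subst nn_integral_indicator[symmetric]) (simp_all add: nn_integral_distr[OF m] del: nn_integral_indicator)
  also have "\<dots> = (\<integral>\<^sup>+y. \<integral>\<^sup>+ys. indicator A (y ## ys) \<partial>S \<partial>\<mu>)"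
    using S.nn_integral_fst[OF mi] by simp
  also have "\<dots> = emeasure S A" by (subst nn_integral_stream_space[symmetric]) simp_all
  finally show "emeasure (distr (\<mu> \<Otimes>\<^sub>M S) S (\<lambda>p. fst p ## snd p)) A = emeasure S A" .
qed simp

lemma integral_Stream:
  fixes f :: "'a stream \<Rightarrow> real"
  assumes f [measurable]: "f \<in> borel_measurable S" and B: "\<And>ys. \<bar>f ys\<bar> \<le> B"
  shows "(\<integral>ys. f ys \<partial>S) = (\<integral>y. \<integral>ys. f (y ## ys) \<partial>S \<partial>\<mu>)"
proof -
  interpret P: pair_prob_space \<mu> S ..
  have m: "(\<lambda>p. fst p ## snd p) \<in> measurable (\<mu> \<Otimes>\<^sub>M S) S" by (rule measurable_Stream) simp_all
  have "(\<integral>ys. f ys \<partial>S) = (\<integral>p. f (fst p ## snd p) \<partial>(\<mu> \<Otimes>\<^sub>M S))"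
    by (subst distr_Stream[symmetric], subst integral_distr[OF m f]) simp
  also have "\<dots> = (\<integral>y. \<integral>ys. f (y ## ys) \<partial>S \<partial>\<mu>)"
  proof (subst P.integral_fst'[symmetric])
    show "integrable (\<mu> \<Otimes>\<^sub>M S) (\<lambda>p. f (fst p ## snd p))"
      using B measurable_compose[OF m f] by (intro P.integrable_const_bound[of _ B]) auto
  qed simp
  finally show ?thesis .
qed

text \<open>Both sides are the \<open>n\<close>-th power of one transition operator. The head of the
  stream is integrated separately in both cases: it is the increment that the forward walk applies
  first and the backward walk last.\<close>

lemma nn_integral_back_flow:
  fixes \<phi> :: "'s::second_countable_topology \<Rightarrow> 'a \<Rightarrow> 's"
  assumes \<phi>: "case_prod \<phi> \<in> measurable (borel \<Otimes>\<^sub>M borel) borel"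
    and F: "F \<in> borel_measurable borel"
  shows "(\<integral>\<^sup>+ys. F (back_flow \<phi> n s ys) \<partial>S) = (\<integral>\<^sup>+ys. F (flow \<phi> n s ys) \<partial>S)"
proof -
  define T where "T F = (\<lambda>s. \<integral>\<^sup>+y. F (\<phi> s y) \<partial>\<mu>)" for F :: "'s \<Rightarrow> ennreal"
  have \<phi>': "(\<lambda>x. \<phi> (f x) (g x)) \<in> measurable N borel"
    if "f \<in> measurable N borel" "g \<in> measurable N borel" for N :: "'z measure" and f g
    using measurable_compose[OF measurable_Pair[OF that] \<phi>] by simp
  have T: "T F \<in> borel_measurable borel" if F: "F \<in> borel_measurable borel" for F
  proof -
    have "(\<lambda>p. \<phi> (fst p) (snd p)) \<in> borel_measurable (borel \<Otimes>\<^sub>M \<mu>)"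
      by (rule \<phi>') (simp_all cong: measurable_cong_sets)
    from measurable_compose[OF this F]
    have "(\<lambda>p. F (\<phi> (fst p) (snd p))) \<in> borel_measurable (borel \<Otimes>\<^sub>M \<mu>)" .
    then show ?thesis unfolding T_def
      by (intro borel_measurable_nn_integral) (simp add: case_prod_beta')
  qed
  have flow: "(\<integral>\<^sup>+ys. F (flow \<phi> n s ys) \<partial>S) = (T ^^ n) F s"
    if F: "F \<in> borel_measurable borel" for F n s
    using F
  proof (induction n arbitrary: s)
    case 0
    then show ?case by simp
  next
    case (Suc n)
    note [measurable] = measurable_flow[OF \<phi>] \<open>F \<in> _\<close>
    have "(\<integral>\<^sup>+ys. F (flow \<phi> (Suc n) s ys) \<partial>S) = (\<integral>\<^sup>+y. \<integral>\<^sup>+ys. F (flow \<phi> n (\<phi> s y) ys) \<partial>S \<partial>\<mu>)"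
      by (subst nn_integral_stream_space) (simp_all del: flow.simps, simp)
    also have "\<dots> = (\<integral>\<^sup>+y. (T ^^ n) F (\<phi> s y) \<partial>\<mu>)" using Suc by simp
    also have "\<dots> = T ((T ^^ n) F) s" by (simp add: T_def)
    finally show ?case by simp
  qed
  show ?thesis using F
  proof (induction n arbitrary: F)
    case (Suc n)
    note [measurable] = measurable_back_flow[OF \<phi>] \<open>F \<in> _\<close>
    have m: "(\<lambda>(y, ys). F (\<phi> (back_flow \<phi> n s ys) y)) \<in> borel_measurable (\<mu> \<Otimes>\<^sub>M S)"
    proof -
      have "(\<lambda>p. \<phi> (back_flow \<phi> n s (snd p)) (fst p)) \<in> measurable (\<mu> \<Otimes>\<^sub>M S) borel"
        by (rule \<phi>') (simp_all cong: measurable_cong_sets)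
      from measurable_compose[OF this Suc.prems] show ?thesis by (simp add: case_prod_beta')
    qed
    have "(\<integral>\<^sup>+ys. F (back_flow \<phi> (Suc n) s ys) \<partial>S) = (\<integral>\<^sup>+y. \<integral>\<^sup>+ys. F (\<phi> (back_flow \<phi> n s ys) y) \<partial>S \<partial>\<mu>)"
      by (subst nn_integral_stream_space) (simp_all del: back_flow.simps, simp)
    also have "\<dots> = (\<integral>\<^sup>+ys. T F (back_flow \<phi> n s ys) \<partial>S)"
    proof -
      interpret P: pair_sigma_finite \<mu> S ..
      show ?thesis unfolding T_def
        using P.Fubini'[OF m] by simp
    qed
    also have "\<dots> = (T ^^ n) (T F) s" using Suc.IH[OF T[OF Suc.prems]] flow[OF T[OF Suc.prems]] by simp
    also have "\<dots> = (T ^^ Suc n) F s" by (simp add: funpow_swap1)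
    finally show ?case using flow[OF Suc.prems, of "Suc n"] by (simp del: flow.simps funpow.simps)
  qed simp
qed

lemma measure_back_flow:
  fixes \<phi> :: "'s::second_countable_topology \<Rightarrow> 'a \<Rightarrow> 's"
  assumes \<phi>: "case_prod \<phi> \<in> measurable (borel \<Otimes>\<^sub>M borel) borel" and A: "A \<in> sets borel"
  shows "measure S {ys. back_flow \<phi> n s ys \<in> A} = measure S {ys. flow \<phi> n s ys \<in> A}"
proof -
  have I: "(indicator A :: _ \<Rightarrow> ennreal) \<in> borel_measurable borel" by (rule borel_measurable_indicator[OF A])
  have eq: "emeasure S {ys. f ys \<in> A} = (\<integral>\<^sup>+ys. indicator A (f ys) \<partial>S)" if f: "f \<in> borel_measurable S" for f
  proof -
    have "{ys. f ys \<in> A} \<in> sets S" using measurable_sets[OF f A] by (simp add: vimage_def)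
    then have "emeasure S {ys. f ys \<in> A} = (\<integral>\<^sup>+ys. indicator {ys. f ys \<in> A} ys \<partial>S)" by simp
    then show ?thesis by (simp add: indicator_def)
  qed
  have "(\<lambda>ys. back_flow \<phi> n s ys) \<in> borel_measurable S" "(\<lambda>ys. flow \<phi> n s ys) \<in> borel_measurable S"
    by (rule measurable_back_flow[OF \<phi>] measurable_flow[OF \<phi>]; simp)+
  then show ?thesis using nn_integral_back_flow[OF \<phi> I] by (simp add: measure_def eq)
qed

end

text \<open>The walk depends on its increments only through their joint law, so the canonical stream
  space can replace \<open>M\<close>. Independence turns that law into a product over
  \<open>{1..}\<close>, and reindexing by \<open>Suc\<close> discards \<open>Y 0\<close>.\<close>

lemma iid_stream:
  fixes Y :: "nat \<Rightarrow> 'w \<Rightarrow> 'a::second_countable_topology"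
  assumes iid: "iid_with_law M Y \<mu>"
  shows "(\<lambda>\<omega>. to_stream (\<lambda>n. Y (Suc n) \<omega>)) \<in> measurable M (stream_space \<mu>)"
    and "distr M (stream_space \<mu>) (\<lambda>\<omega>. to_stream (\<lambda>n. Y (Suc n) \<omega>)) = stream_space \<mu>"
proof -
  interpret prob_space M using iid by (simp add: iid_with_law_def)
  have ind: "indep_vars (\<lambda>_. borel) Y {1..}" and law: "\<And>n. n \<ge> 1 \<Longrightarrow> distr M borel (Y n) = \<mu>"
    using iid by (auto simp: iid_with_law_def)
  have [measurable]: "Y (Suc n) \<in> measurable M borel" for n
    using ind by (auto simp: indep_vars_def2)
  have \<mu>: "sets \<mu> = sets borel" using law[of 1] by auto
  note [measurable_cong] = \<mu>
  have "distr M (\<Pi>\<^sub>M i\<in>{1..}. borel) (\<lambda>x. \<lambda>i\<in>{1..}. Y i x) = (\<Pi>\<^sub>M i\<in>{1..}. distr M borel (Y i))"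
    using ind by (subst indep_vars_iff_distr_eq_PiM'[symmetric]) (auto simp: indep_vars_def2)
  also have "\<dots> = (\<Pi>\<^sub>M i\<in>{1..}. \<mu>)"
    by (intro PiM_cong) (auto simp: law)
  finally have eq: "distr M (\<Pi>\<^sub>M i\<in>{1..}. borel) (\<lambda>x. \<lambda>i\<in>{1..}. Y i x) = (\<Pi>\<^sub>M i\<in>{1..}. \<mu>)" .
  have "prob_space \<mu>" using law[of 1] by (metis \<open>\<And>n. Y (Suc n) \<in> borel_measurable M\<close> One_nat_def order_refl prob_space_distr)
  then have "(\<Pi>\<^sub>M i\<in>(UNIV::nat set). \<mu>) = distr (\<Pi>\<^sub>M i\<in>{1..}. \<mu>) (\<Pi>\<^sub>M i\<in>UNIV. \<mu>) (\<lambda>\<omega>. \<lambda>n\<in>UNIV. \<omega> (Suc n))"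
    by (subst distr_PiM_reindex[where M="\<lambda>_. \<mu>"]) auto
  also have "\<dots> = distr M (\<Pi>\<^sub>M i\<in>UNIV. \<mu>) (\<lambda>x i. Y (Suc i) x)"
    unfolding eq[symmetric]
    by (subst distr_distr)
       (use sets_eq_imp_space_eq[OF \<mu>] ind in
         \<open>auto simp: indep_vars_def2 comp_def restrict_UNIV intro!: measurable_PiM_single' measurable_restrict
           measurable_component_singleton cong: measurable_cong_sets\<close>)
  finally have eq: "(\<Pi>\<^sub>M i\<in>(UNIV::nat set). \<mu>) = distr M (\<Pi>\<^sub>M i\<in>UNIV. \<mu>) (\<lambda>x i. Y (Suc i) x)" .
  show m: "(\<lambda>\<omega>. to_stream (\<lambda>n. Y (Suc n) \<omega>)) \<in> measurable M (stream_space \<mu>)"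
    by (rule measurable_stream_space2) (simp add: to_stream_def)
  have "stream_space \<mu> = distr (distr M (\<Pi>\<^sub>M i\<in>UNIV. \<mu>) (\<lambda>x i. Y (Suc i) x)) (stream_space \<mu>) to_stream"
    unfolding eq[symmetric] by (rule stream_space_eq_distr)
  also have "\<dots> = distr M (stream_space \<mu>) (\<lambda>\<omega>. to_stream (\<lambda>n. Y (Suc n) \<omega>))"
  proof (subst distr_distr)
    show "(\<lambda>x i. Y (Suc i) x) \<in> M \<rightarrow>\<^sub>M Pi\<^sub>M UNIV (\<lambda>i. \<mu>)"
      using sets_eq_imp_space_eq[OF \<mu>] by (intro measurable_PiM_single') auto
  qed (simp_all add: comp_def)
  finally show "distr M (stream_space \<mu>) (\<lambda>\<omega>. to_stream (\<lambda>n. Y (Suc n) \<omega>)) = stream_space \<mu>" ..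
qed

section \<open>Tightness in one dimension\<close>

text \<open>The real increment is a function \<open>c\<close> of an abstract one rather than the
  increment itself: the coordinates of a vector walk then all run on the same streams, with their
  dependence intact.\<close>

locale coord_noise = noise \<mu> for \<mu> :: "'a::topological_space measure" +
  fixes c :: "'a \<Rightarrow> real"
  assumes c_meas [measurable]: "c \<in> borel_measurable borel"
begin

abbreviation rw :: "nat \<Rightarrow> real \<Rightarrow> 'a stream \<Rightarrow> real" where
  "rw \<equiv> flow (\<lambda>x y. \<bar>x - c y\<bar>)"

lemma c_meas' [measurable]: "c \<in> borel_measurable \<mu>"
  using c_meas by (simp add: measurable_cong_sets[OF sets_noise refl])

lemma step_meas [measurable]: "case_prod (\<lambda>x y. \<bar>x - c y\<bar>) \<in> measurable (borel \<Otimes>\<^sub>M borel) borel"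
  by (simp add: case_prod_beta')

lemma rw_meas [measurable (raw)]:
  "f \<in> measurable N borel \<Longrightarrow> g \<in> measurable N S \<Longrightarrow> (\<lambda>x. rw n (f x) (g x)) \<in> borel_measurable N"
  by (rule measurable_flow[OF step_meas])

lemma rw_nonneg: "0 \<le> x \<Longrightarrow> 0 \<le> rw n x ys"
  by (induction n arbitrary: x ys) simp_all

lemma rw_lipschitz: "\<bar>rw n x ys - rw n y ys\<bar> \<le> \<bar>x - y\<bar>"
proof (induction n arbitrary: x y ys)
  case (Suc n)
  have "\<bar>rw (Suc n) x ys - rw (Suc n) y ys\<bar> \<le> \<bar>\<bar>x - c (shd ys)\<bar> - \<bar>y - c (shd ys)\<bar>\<bar>"
    using Suc by simp
  also have "\<dots> \<le> \<bar>x - y\<bar>" by linarith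
  finally show ?case .
qed simp

end

text \<open>
  The auxiliary chain carries a pair: \<open>x\<close> is the walk itself, and \<open>z\<close> is a copy driven by the same
  increments which is reset to 0 whenever it enters \<open>[0, a)\<close>.  The operators \<open>T0\<close> and
  \<open>T1\<close> are the parts of the transition operator with and without a reset.
\<close>

locale reset_chain = coord_noise \<mu> c for \<mu> :: "'a::topological_space measure" and c +
  fixes a :: real
  assumes a_pos: "0 < a"
begin

definition T0 :: "(real \<Rightarrow> real \<Rightarrow> ennreal) \<Rightarrow> real \<Rightarrow> real \<Rightarrow> ennreal" where
  "T0 F z x = (\<integral>\<^sup>+y. (if \<bar>z - c y\<bar> < a then F 0 \<bar>x - c y\<bar> else 0) \<partial>\<mu>)"

definition T1 :: "(real \<Rightarrow> real \<Rightarrow> ennreal) \<Rightarrow> real \<Rightarrow> real \<Rightarrow> ennreal" where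
  "T1 F z x = (\<integral>\<^sup>+y. (if \<bar>z - c y\<bar> < a then 0 else F \<bar>z - c y\<bar> \<bar>x - c y\<bar>) \<partial>\<mu>)"

definition T :: "(real \<Rightarrow> real \<Rightarrow> ennreal) \<Rightarrow> real \<Rightarrow> real \<Rightarrow> ennreal" where
  "T F z x = T0 F z x + T1 F z x"

text \<open>After at least one step the condition \<open>z = 0\<close> recognises a reset, because
  without one the copy is at or above \<open>a > 0\<close>.\<close>

definition at_reset :: "(real \<Rightarrow> real \<Rightarrow> ennreal) \<Rightarrow> real \<Rightarrow> real \<Rightarrow> ennreal" where
  "at_reset F z x = (if z = 0 then F z x else 0)"

abbreviation meas2 :: "(real \<Rightarrow> real \<Rightarrow> ennreal) \<Rightarrow> bool" where
  "meas2 F \<equiv> (\<lambda>p. F (fst p) (snd p)) \<in> borel_measurable (borel \<Otimes>\<^sub>M borel)"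

lemma meas2_compose:
  assumes "meas2 F" "f \<in> borel_measurable N" "g \<in> borel_measurable N"
  shows "(\<lambda>x. F (f x) (g x)) \<in> borel_measurable N"
  using measurable_compose[OF measurable_Pair[OF assms(2,3)] assms(1)] by simp

lemma meas2_T0: assumes F: "meas2 F" shows "meas2 (T0 F)"
proof -
  note [measurable (raw)] = meas2_compose[OF F]
  show ?thesis unfolding T0_def by (rule borel_measurable_nn_integral) measurable
qed

lemma meas2_T1: assumes F: "meas2 F" shows "meas2 (T1 F)"
proof -
  note [measurable (raw)] = meas2_compose[OF F]
  show ?thesis unfolding T1_def by (rule borel_measurable_nn_integral) measurable
qed

lemma meas2_T: "meas2 F \<Longrightarrow> meas2 (T F)"
  unfolding T_def using meas2_T0 meas2_T1 by simp

lemma meas2_T1_pow: "meas2 F \<Longrightarrow> meas2 ((T1 ^^ n) F)"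
  by (induction n) (simp_all add: meas2_T1)

lemma meas2_T_pow: "meas2 F \<Longrightarrow> meas2 ((T ^^ n) F)"
  by (induction n) (simp_all add: meas2_T)

lemma meas2_at_reset: "meas2 F \<Longrightarrow> meas2 (at_reset F)"
  unfolding at_reset_def by simp

lemma meas2_cmult: "meas2 F \<Longrightarrow> meas2 (\<lambda>z x. k * F z x)" for k :: ennreal
  by simp

lemma T0_add:
  assumes "meas2 F" "meas2 G"
  shows "T0 (\<lambda>z x. F z x + G z x) = (\<lambda>z x. T0 F z x + T0 G z x)"
proof (intro ext)
  fix z x
  note [measurable (raw)] = meas2_compose[OF assms(1)] meas2_compose[OF assms(2)]
  show "T0 (\<lambda>z x. F z x + G z x) z x = T0 F z x + T0 G z x"
    unfolding T0_def by (subst nn_integral_add[symmetric]) (auto intro!: nn_integral_cong)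
qed

lemma T1_add:
  assumes "meas2 F" "meas2 G"
  shows "T1 (\<lambda>z x. F z x + G z x) = (\<lambda>z x. T1 F z x + T1 G z x)"
proof (intro ext)
  fix z x
  note [measurable (raw)] = meas2_compose[OF assms(1)] meas2_compose[OF assms(2)]
  show "T1 (\<lambda>z x. F z x + G z x) z x = T1 F z x + T1 G z x"
    unfolding T1_def by (subst nn_integral_add[symmetric]) (auto intro!: nn_integral_cong)
qed

lemma T0_cmult:
  assumes "meas2 F"
  shows "T0 (\<lambda>z x. k * F z x) = (\<lambda>z x. k * T0 F z x)"
proof (intro ext)
  fix z x
  note [measurable (raw)] = meas2_compose[OF assms(1)]
  show "T0 (\<lambda>z x. k * F z x) z x = k * T0 F z x"
    unfolding T0_def by (subst nn_integral_cmult[symmetric]) (auto intro!: nn_integral_cong)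
qed

lemma T1_cmult:
  assumes "meas2 F"
  shows "T1 (\<lambda>z x. k * F z x) = (\<lambda>z x. k * T1 F z x)"
proof (intro ext)
  fix z x
  note [measurable (raw)] = meas2_compose[OF assms(1)]
  show "T1 (\<lambda>z x. k * F z x) z x = k * T1 F z x"
    unfolding T1_def by (subst nn_integral_cmult[symmetric]) (auto intro!: nn_integral_cong)
qed

lemma T_pow_add:
  assumes "meas2 F" "meas2 G"
  shows "(T ^^ n) (\<lambda>z x. F z x + G z x) = (\<lambda>z x. (T ^^ n) F z x + (T ^^ n) G z x)"
proof (induction n)
  case (Suc n)
  then show ?case
    using T0_add[OF meas2_T_pow meas2_T_pow, OF assms, of n n] T1_add[OF meas2_T_pow meas2_T_pow, OF assms, of n n]
    by (simp add: T_def[abs_def] add_ac)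
qed simp

lemma T1_pow_add:
  assumes "meas2 F" "meas2 G"
  shows "(T1 ^^ n) (\<lambda>z x. F z x + G z x) = (\<lambda>z x. (T1 ^^ n) F z x + (T1 ^^ n) G z x)"
proof (induction n)
  case (Suc n)
  then show ?case using T1_add[OF meas2_T1_pow meas2_T1_pow, OF assms, of n n] by simp
qed simp

lemma T_pow_cmult:
  assumes "meas2 F"
  shows "(T ^^ n) (\<lambda>z x. k * F z x) = (\<lambda>z x. k * (T ^^ n) F z x)"
proof (induction n)
  case (Suc n)
  then show ?case
    using T0_cmult[OF meas2_T_pow, OF assms, of k n] T1_cmult[OF meas2_T_pow, OF assms, of k n]
    by (simp add: T_def[abs_def] distrib_left)
qed simp

lemma T0_mono:
  assumes "\<And>z x. 0 \<le> z \<Longrightarrow> 0 \<le> x \<Longrightarrow> F z x \<le> G z x"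
  shows "T0 F z x \<le> T0 G z x"
  unfolding T0_def using assms by (intro nn_integral_mono) auto

lemma T1_mono:
  assumes "\<And>z x. 0 \<le> z \<Longrightarrow> 0 \<le> x \<Longrightarrow> F z x \<le> G z x"
  shows "T1 F z x \<le> T1 G z x"
  unfolding T1_def using assms by (intro nn_integral_mono) auto

lemma T_pow_mono:
  assumes "\<And>z x. 0 \<le> z \<Longrightarrow> 0 \<le> x \<Longrightarrow> F z x \<le> G z x" "0 \<le> z" "0 \<le> x"
  shows "(T ^^ n) F z x \<le> (T ^^ n) G z x"
  using assms
proof (induction n arbitrary: z x)
  case (Suc n)
  then show ?case unfolding funpow.simps comp_def T_def
    by (intro add_mono T0_mono T1_mono) auto
qed auto

lemma T_at_reset: "T (at_reset F) = T0 F"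
proof (intro ext)
  fix z x
  have "(\<lambda>y. if \<bar>z - c y\<bar> < a then 0 else at_reset F \<bar>z - c y\<bar> \<bar>x - c y\<bar>) = (\<lambda>_. 0)"
    using a_pos by (auto simp: fun_eq_iff at_reset_def)
  then have "T1 (at_reset F) z x = 0" by (simp add: T1_def)
  then show "T (at_reset F) z x = T0 F z x" by (simp add: T_def T0_def at_reset_def cong: if_cong)
qed

text \<open>The state at time \<open>n\<close> is sorted by the age \<open>k\<close> of the current
  cycle: a reset at time \<open>n - k\<close>, then \<open>k\<close> steps without one. Starting
  from \<open>z = 0\<close> counts as a reset, which supplies the summand
  \<open>k = n\<close>.\<close>

lemma last_reset:
  assumes F: "meas2 F"
  shows "(T ^^ n) F 0 x = (\<Sum>k\<le>n. (T ^^ (n - k)) (at_reset ((T1 ^^ k) F)) 0 x)"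
proof -
  \<comment> \<open>For general \<open>z\<close> the paths without any reset form a separate term.
    The induction splits the last step, the innermost application of \<open>T\<close>, so
    \<open>F\<close> has to vary.\<close>
  have "(T ^^ n) F z x = (T1 ^^ n) F z x + (\<Sum>k<n. (T ^^ (n - k)) (at_reset ((T1 ^^ k) F)) z x)" for z x
    using F
  proof (induction n arbitrary: F)
    case (Suc n)
    have "T F = (\<lambda>z x. T0 F z x + T1 F z x)" by (simp add: fun_eq_iff T_def)
    then have "(T ^^ Suc n) F z x = (T ^^ n) (\<lambda>z x. T0 F z x + T1 F z x) z x"
      by (simp add: funpow_swap1)
    also have "\<dots> = (T ^^ n) (T0 F) z x + (T ^^ n) (T1 F) z x"
      by (simp add: T_pow_add[OF meas2_T0 meas2_T1, OF Suc.prems Suc.prems])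
    also have "(T ^^ n) (T1 F) z x = (T1 ^^ n) (T1 F) z x + (\<Sum>k<n. (T ^^ (n - k)) (at_reset ((T1 ^^ k) (T1 F))) z x)"
      by (rule Suc.IH[OF meas2_T1[OF Suc.prems]])
    also have "(T1 ^^ n) (T1 F) z x = (T1 ^^ Suc n) F z x"
      by (simp add: funpow_swap1)
    also have "(\<Sum>k<n. (T ^^ (n - k)) (at_reset ((T1 ^^ k) (T1 F))) z x) =
        (\<Sum>k<n. (T ^^ (Suc n - Suc k)) (at_reset ((T1 ^^ Suc k) F)) z x)"
      by (simp add: funpow_swap1)
    also have "(T ^^ n) (T0 F) z x = (T ^^ (Suc n - 0)) (at_reset ((T1 ^^ 0) F)) z x"
      by (simp add: funpow_swap1 T_at_reset)
    finally show ?case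
      unfolding sum.lessThan_Suc_shift by (simp only: add_ac)
  qed simp
  from this[of 0 x] show ?thesis
    by (simp add: lessThan_Suc_atMost[symmetric] at_reset_def add_ac)
qed

lemma T_pow_eq_flow:
  assumes h: "h \<in> borel_measurable borel"
  shows "(T ^^ n) (\<lambda>z x. h x) z x = (\<integral>\<^sup>+ys. h (rw n x ys) \<partial>S)"
proof (induction n arbitrary: z x)
  case 0
  then show ?case by simp
next
  case (Suc n)
  note [measurable] = h
  have "(T ^^ n) (\<lambda>z x. h x) = (\<lambda>z x. \<integral>\<^sup>+ys. h (rw n x ys) \<partial>S)"
    using Suc by (intro ext)
  then have "(T ^^ Suc n) (\<lambda>z x. h x) z x = T (\<lambda>z x. \<integral>\<^sup>+ys. h (rw n x ys) \<partial>S) z x"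
    by simp
  also have "\<dots> = (\<integral>\<^sup>+y. \<integral>\<^sup>+ys. h (rw n \<bar>x - c y\<bar> ys) \<partial>S \<partial>\<mu>)"
    unfolding T_def T0_def T1_def
    by (subst nn_integral_add[symmetric]) (auto intro!: nn_integral_cong)
  also have "\<dots> = (\<integral>\<^sup>+ys. h (rw (Suc n) x ys) \<partial>S)"
    by (subst nn_integral_stream_space) (simp_all del: flow.simps, simp)
  finally show ?case .
qed

section \<open>The walk up to its first entry into [0, a)\<close>

abbreviation no_hit :: "real \<Rightarrow> nat \<Rightarrow> 'a stream \<Rightarrow> bool" where
  "no_hit z k ys \<equiv> \<forall>j\<in>{1..k}. a \<le> rw j z ys"

text \<open>Until a reset occurs the copy is the walk itself, so powers of \<open>T1\<close> on
  functions of \<open>z\<close> describe the walk killed on entering \<open>[0, a)\<close>.\<close>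

lemma T1_pow_eq_flow:
  assumes h: "h \<in> borel_measurable borel"
  shows "(T1 ^^ n) (\<lambda>z x. h z) z x =
     (\<integral>\<^sup>+ys. (if no_hit z n ys then h (rw n z ys) else 0) \<partial>S)"
proof (induction n arbitrary: z x)
  case 0
  then show ?case by simp
next
  case (Suc n)
  note [measurable] = h
  have "(T1 ^^ n) (\<lambda>z x. h z) = (\<lambda>z x. \<integral>\<^sup>+ys. (if no_hit z n ys then h (rw n z ys) else 0) \<partial>S)"
    using Suc by (intro ext)
  then have "(T1 ^^ Suc n) (\<lambda>z x. h z) z x = T1 (\<lambda>z x. \<integral>\<^sup>+ys. (if no_hit z n ys then h (rw n z ys) else 0) \<partial>S) z x"
    by simp
  also have "\<dots> = (\<integral>\<^sup>+y. \<integral>\<^sup>+ys. (if no_hit z (Suc n) (y ## ys) then h (rw (Suc n) z (y ## ys)) else 0) \<partial>S \<partial>\<mu>)"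
    unfolding T1_def all_Suc_shift by (auto intro!: nn_integral_cong)
  also have "\<dots> = (\<integral>\<^sup>+ys. (if no_hit z (Suc n) ys then h (rw (Suc n) z ys) else 0) \<partial>S)"
    by (subst nn_integral_stream_space) (simp_all del: flow.simps)
  finally show ?case .
qed

lemma T_pow_const: "(T ^^ n) (\<lambda>z x. k) z x = k"
  by (subst T_pow_eq_flow) simp_all

abbreviation hit_time :: "'a stream \<Rightarrow> ennreal" where
  "hit_time ys \<equiv> \<Sum>k. if no_hit 0 k ys then 1 else 0"

text \<open>The occupation measure of one cycle of \<open>z\<close> from 0, integrated against
  \<open>h\<close>; its total mass is the mean cycle length \<open>mean_hit\<close>.\<close>

abbreviation visits :: "(real \<Rightarrow> ennreal) \<Rightarrow> ennreal" where
  "visits h \<equiv> \<Sum>k. \<integral>\<^sup>+ys. (if no_hit 0 k ys then h (rw k 0 ys) else 0) \<partial>S"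

abbreviation mean_hit :: ennreal where
  "mean_hit \<equiv> \<integral>\<^sup>+ys. hit_time ys \<partial>S"

text \<open>Almost every cycle is finite, hence bounded, and spends no time above a large
  \<open>m\<close>; its length is the integrable bound for dominated convergence.\<close>

lemma tail_hit_time:
  assumes fin: "mean_hit < \<infinity>"
  shows "(\<lambda>m. visits (indicator {real m<..}))
     \<longlonglongrightarrow> 0"
proof -
  define g where "g m ys = (\<Sum>k. if no_hit 0 k ys then indicator {real m<..} (rw k 0 ys) else 0 :: ennreal)" for m ys
  have [measurable]: "hit_time \<in> borel_measurable S" by measurable
  have g_meas [measurable]: "g m \<in> borel_measurable S" for m unfolding g_def by measurable
  have "(\<lambda>m. \<integral>\<^sup>+ys. g m ys \<partial>S) \<longlonglongrightarrow> (\<integral>\<^sup>+ys. 0 \<partial>S)"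
  proof (rule nn_integral_dominated_convergence[where w=hit_time])
    show "AE ys in S. g m ys \<le> hit_time ys" for m
      unfolding g_def by (intro AE_I2 suminf_le) (auto split: split_indicator)
    have "AE ys in S. hit_time ys \<noteq> \<infinity>"
      using fin by (intro nn_integral_noteq_infinite) auto
    then show "AE ys in S. (\<lambda>m. g m ys) \<longlonglongrightarrow> 0"
    proof eventually_elim
      case (elim ys)
      have "\<exists>N. \<exists>j\<in>{1..N}. rw j 0 ys < a"
      proof (rule ccontr)
        assume "\<not> ?thesis"
        then have "(\<lambda>k. if no_hit 0 k ys then 1 else 0) = (\<lambda>k. 1::ennreal)"
          by (auto simp: fun_eq_iff not_less)
        then have "hit_time ys = (\<Sum>k. 1)" by simp
        also have "\<dots> = \<infinity>" using nn_integral_count_space_nat[of "\<lambda>_. 1::ennreal"] by simp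
        finally show False using elim by simp
      qed
      then obtain N j where Nj: "j \<in> {1..N}" "rw j 0 ys < a" by auto
      obtain m0 :: nat where m0: "\<And>k. k < N \<Longrightarrow> rw k 0 ys \<le> real m0"
      proof -
        obtain m0 :: nat where "(MAX k\<in>{..N}. rw k 0 ys) \<le> real m0" using real_arch_simple by blast
        then show ?thesis by (intro that[of m0]) simp
      qed
      have "g m ys = 0" if "m0 \<le> m" for m
      proof -
        have "(if no_hit 0 k ys then indicator {real m<..} (rw k 0 ys) else 0) = (0::ennreal)" for k
        proof (cases "k < N")
          case True
          then show ?thesis using m0[of k] that by auto
        next
          case False
          then have "j \<in> {1..k}" using Nj by auto
          then show ?thesis using Nj(2) by (meson not_le)
        qed
        then show ?thesis unfolding g_def by simp
      qed
      then show ?case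
        by (intro tendsto_eventually) (auto simp: eventually_sequentially)
    qed
  qed (use fin in simp_all)
  moreover have "(\<integral>\<^sup>+ys. g m ys \<partial>S) = visits (indicator {real m<..})" for m
    unfolding g_def by (rule nn_integral_suminf) measurable
  ultimately show ?thesis by simp
qed

end

text \<open>
  A cycle of \<open>z\<close> raises \<open>\<bar>x - z\<bar>\<close> by at most \<open>a\<close>; if \<open>x \<ge> b + \<delta>\<close> at its start, then with probability
  \<open>p\<close> the first step also lowers it by \<open>2 * \<delta>\<close>.  The choices \<open>a = \<delta> * p\<close> and \<open>\<theta> = 1 / (4 * \<delta>)\<close> make the
  resulting factor \<open>\<rho>\<close> of \<open>exp (\<theta> * \<bar>x - z\<bar>)\<close> smaller than 1.
\<close>

locale drift_chain = reset_chain \<mu> c a for \<mu> :: "'a::topological_space measure" and c a +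
  fixes \<delta> b \<theta> p :: real
  assumes \<delta>: "0 < \<delta>" and \<delta>b: "\<delta> \<le> b" and p: "p = measure \<mu> {y. \<delta> < c y \<and> c y \<le> b}" "0 < p"
    and a_eq: "a = \<delta> * p" and \<theta>_eq: "\<theta> = 1 / (4 * \<delta>)"
begin

section \<open>Exponential moments at the resets\<close>

abbreviation \<gamma> :: ennreal where
  "\<gamma> \<equiv> ennreal (exp (p / 4))"

definition dist_exp :: "real \<Rightarrow> real \<Rightarrow> ennreal" where
  "dist_exp z x = ennreal (exp (\<theta> * \<bar>x - z\<bar>))"

text \<open>Bound for the factor that the first step of a cycle with distant \<open>x\<close>
  applies to \<open>dist_exp\<close>: lowering the distance by \<open>2 * \<delta>\<close> lowers
  the exponent by \<open>2 * \<delta> * \<theta> = 1 / 2\<close>.\<close>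

definition gain :: "'a \<Rightarrow> ennreal" where
  "gain y = (if \<delta> < c y \<and> c y \<le> b then ennreal (exp (- 1 / 2)) else 1)"

text \<open>The mean of \<open>gain\<close> times the cost of a reset,
  \<open>\<gamma> = exp (\<theta> * a)\<close> with \<open>\<theta> * a = p / 4\<close>.\<close>

definition \<rho> :: real where
  "\<rho> = exp (p / 4) * (1 - p * (1 - exp (- 1 / 2)))"

text \<open>The value of \<open>dist_exp 0 x\<close> at the threshold
  \<open>x = b + \<delta>\<close>, times the cost of one reset; it serves for the cycles that begin
  with \<open>x\<close> below the threshold.\<close>

definition C :: real where
  "C = exp (p / 4) * exp (\<theta> * (b + \<delta>))"

lemma \<theta>_pos: "0 < \<theta>" using \<delta> by (simp add: \<theta>_eq)

lemma \<theta>a: "\<theta> * a = p / 4" using \<delta> by (simp add: \<theta>_eq a_eq)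

lemma gain_meas [measurable]: "gain \<in> borel_measurable \<mu>"
  unfolding gain_def[abs_def] by measurable

lemma meas2_dist_exp: "meas2 dist_exp"
  unfolding dist_exp_def by measurable

lemma p_le_1: "p \<le> 1" using p by simp

text \<open>The reset contributes \<open>p / 4\<close> to the exponent, while
  \<open>exp (- 1 / 2) \<le> 2 / 3\<close> makes the first step worth at least \<open>p / 3\<close>;
  hence \<open>\<rho> \<le> exp (- p / 12)\<close>.\<close>

lemma \<rho>_bounds: "0 \<le> \<rho>" "\<rho> < 1"
proof -
  let ?e = "exp (- 1 / 2 :: real)"
  have "?e * (1 + 1 / 2) \<le> ?e * exp (1 / 2)" using exp_ge_add_one_self[of "1/2"] by (intro mult_left_mono) auto
  then have e: "?e \<le> 2 / 3" by (simp add: exp_minus)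
  have "0 \<le> 1 - p * (1 - ?e)"
  proof -
    have "p * (1 - ?e) \<le> 1 * 1" using p_le_1 p(2) e by (intro mult_mono) auto
    then show ?thesis by simp
  qed
  then show "0 \<le> \<rho>" by (simp add: \<rho>_def)
  have "1 - p * (1 - ?e) \<le> 1 - p / 3" using e p(2) by (simp add: field_simps)
  also have "\<dots> \<le> exp (- (p / 3))" using exp_ge_add_one_self[of "-(p/3)"] by simp
  finally have "\<rho> \<le> exp (p / 4) * exp (- (p / 3))" unfolding \<rho>_def by (intro mult_left_mono) auto
  also have "\<dots> = exp (- p / 12)" by (simp add: exp_add[symmetric])
  also have "\<dots> < 1" using p(2) by simp
  finally show "\<rho> < 1" .
qed

lemma integral_gain: "\<gamma> * (\<integral>\<^sup>+y. gain y \<partial>\<mu>) = ennreal \<rho>"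
proof -
  let ?A = "{y. \<delta> < c y \<and> c y \<le> b}"
  have [measurable]: "?A \<in> sets \<mu>" by measurable
  have A: "emeasure \<mu> ?A = ennreal p" using p by (simp add: emeasure_eq_measure)
  have A': "emeasure \<mu> (- ?A) = ennreal (1 - p)"
    using prob_compl[of ?A] p by (simp add: emeasure_eq_measure Compl_eq_Diff_UNIV)
  have "(\<integral>\<^sup>+y. gain y \<partial>\<mu>) = (\<integral>\<^sup>+y. ennreal (exp (- 1 / 2)) * indicator ?A y + indicator (- ?A) y \<partial>\<mu>)"
    by (intro nn_integral_cong) (auto simp: gain_def split: split_indicator)
  also have "\<dots> = ennreal (exp (- 1 / 2)) * ennreal p + ennreal (1 - p)"
    by (subst nn_integral_add) (simp_all add: nn_integral_cmult_indicator A A')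
  also have "\<dots> = ennreal (1 - p * (1 - exp (- 1 / 2)))"
    using p(2) p_le_1 by (simp add: ennreal_mult[symmetric] ennreal_plus[symmetric] algebra_simps del: ennreal_plus)
  finally show ?thesis unfolding \<rho>_def by (simp add: ennreal_mult'[symmetric])
qed

lemma dist_exp_step: "dist_exp \<bar>z - u\<bar> \<bar>x - u\<bar> \<le> dist_exp z x"
proof -
  have "\<bar>\<bar>x - u\<bar> - \<bar>z - u\<bar>\<bar> \<le> \<bar>x - z\<bar>" by linarith
  then show ?thesis unfolding dist_exp_def using \<theta>_pos by (intro ennreal_leI) simp
qed

text \<open>From \<open>z = 0\<close> an increment \<open>c y\<close> in
  \<open>(\<delta>, b]\<close> moves the copy up and the walk down, so the new gap is
  \<open>\<bar>x - 2 * c y\<bar>\<close>.\<close>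

lemma dist_exp_gain:
  assumes x: "b + \<delta> \<le> x"
  shows "dist_exp \<bar>0 - c y\<bar> \<bar>x - c y\<bar> \<le> gain y * dist_exp 0 x"
proof (cases "\<delta> < c y \<and> c y \<le> b")
  case True
  \<comment> \<open>If the two change order, the gap is at most \<open>2 * b - x\<close>, and this
    is at most \<open>x - 2 * \<delta>\<close> exactly when \<open>x \<ge> b + \<delta>\<close>: the
    origin of the threshold.\<close>
  have "\<bar>\<bar>x - c y\<bar> - \<bar>0 - c y\<bar>\<bar> \<le> x - 2 * \<delta>"
    using True x \<delta> by linarith
  then have "\<theta> * \<bar>\<bar>x - c y\<bar> - \<bar>0 - c y\<bar>\<bar> \<le> \<theta> * (x - 2 * \<delta>)"
    using \<theta>_pos by (intro mult_left_mono) auto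
  also have "\<dots> = \<theta> * x - 1 / 2" using \<delta> by (simp add: \<theta>_eq field_simps)
  finally have "exp (\<theta> * \<bar>\<bar>x - c y\<bar> - \<bar>0 - c y\<bar>\<bar>) \<le> exp (- 1 / 2) * exp (\<theta> * \<bar>x - 0\<bar>)"
    using x \<delta> \<delta>b by (simp add: exp_add[symmetric])
  then show ?thesis using True
    by (simp add: gain_def dist_exp_def ennreal_mult'[symmetric] ennreal_leI)
next
  case False
  then have "gain y = 1" by (simp add: gain_def)
  then show ?thesis using dist_exp_step[of 0 "c y" x] by (simp only: mult_1)
qed

lemma dist_exp_reset:
  assumes "\<bar>z\<bar> < a"
  shows "dist_exp 0 x \<le> \<gamma> * dist_exp z x"
proof -
  have "\<theta> * \<bar>x\<bar> \<le> \<theta> * (a + \<bar>x - z\<bar>)" using assms \<theta>_pos by (intro mult_left_mono) auto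
  also have "\<dots> = p / 4 + \<theta> * \<bar>x - z\<bar>" by (simp add: distrib_left \<theta>a)
  finally show ?thesis unfolding dist_exp_def
    by (simp add: ennreal_mult'[symmetric] exp_add[symmetric] ennreal_leI)
qed

text \<open>Probability that the first reset happens at step \<open>k + 1\<close>.\<close>

abbreviation reset_prob :: "nat \<Rightarrow> real \<Rightarrow> real \<Rightarrow> ennreal" where
  "reset_prob k \<equiv> (T1 ^^ k) (T0 (\<lambda>_ _. 1))"

lemma meas2_reset_prob: "meas2 (reset_prob k)"
  by (intro meas2_T1_pow meas2_T0) simp

lemma sum_reset_prob: "(\<Sum>k<n. reset_prob k z x) \<le> 1"
proof -
  have one: "T1 (\<lambda>_ _. 1) z x + T0 (\<lambda>_ _. 1) z x = 1" for z x
    using T_pow_const[of 1 1 z x] by (simp add: T_def add_ac)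
  have "(\<Sum>k<n. reset_prob k z x) + (T1 ^^ n) (\<lambda>_ _. 1) z x = 1"
  proof (induction n)
    case (Suc n)
    have "(T1 ^^ n) (\<lambda>_ _. 1) z x = (T1 ^^ n) (\<lambda>z x. T1 (\<lambda>_ _. 1) z x + T0 (\<lambda>_ _. 1) z x) z x"
      by (simp only: one)
    also have "\<dots> = (T1 ^^ Suc n) (\<lambda>_ _. 1) z x + reset_prob n z x"
      by (subst T1_pow_add) (simp_all add: meas2_T1 meas2_T0 funpow_swap1)
    finally show ?case using Suc by (simp add: add_ac del: funpow.simps)
  qed simp
  then show ?thesis by (metis le_iff_add)
qed

text \<open>Without a reset both components see the same increments and \<open>dist_exp\<close>
  cannot grow, so its initial value factors out and only the weight \<open>H\<close> is
  propagated.\<close>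

lemma T1_pow_dist_exp:
  assumes H: "meas2 H" and F: "\<And>z x. 0 \<le> z \<Longrightarrow> 0 \<le> x \<Longrightarrow> F z x \<le> k * (dist_exp z x * H z x)"
    and "0 \<le> z" "0 \<le> x"
  shows "(T1 ^^ n) F z x \<le> k * (dist_exp z x * (T1 ^^ n) H z x)"
  using assms(3,4)
proof (induction n arbitrary: z x)
  case 0
  then show ?case using F by simp
next
  case (Suc n)
  note [measurable (raw)] = meas2_compose[OF meas2_T1_pow[OF H, of n]]
  have "(T1 ^^ Suc n) F z x \<le> T1 (\<lambda>z x. k * (dist_exp z x * (T1 ^^ n) H z x)) z x"
    unfolding funpow.simps comp_def using Suc by (intro T1_mono) auto
  also have "\<dots> \<le> (\<integral>\<^sup>+y. (k * dist_exp z x) * (if \<bar>z - c y\<bar> < a then 0 else (T1 ^^ n) H \<bar>z - c y\<bar> \<bar>x - c y\<bar>) \<partial>\<mu>)"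
    using dist_exp_step
    by (subst T1_def, intro nn_integral_mono) (auto simp: mult.assoc intro!: mult_left_mono mult_right_mono)
  also have "\<dots> = (k * dist_exp z x) * T1 ((T1 ^^ n) H) z x"
    by (subst T1_def, rule nn_integral_cmult) measurable
  finally show ?case by (simp add: mult.assoc)
qed

lemma T1_indep_right:
  assumes "h \<in> borel_measurable borel"
  shows "(T1 ^^ n) (\<lambda>z x. h z) z x = (T1 ^^ n) (\<lambda>z x. h z) z 0"
  using assms by (simp add: T1_pow_eq_flow)

lemma T0_one: "T0 (\<lambda>_ _. 1) = (\<lambda>z x. emeasure \<mu> {y. \<bar>z - c y\<bar> < a})"
proof (intro ext)
  fix z x
  have "T0 (\<lambda>_ _. 1) z x = (\<integral>\<^sup>+y. indicator {y. \<bar>z - c y\<bar> < a} y \<partial>\<mu>)"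
    unfolding T0_def by (intro nn_integral_cong) (auto split: split_indicator)
  then show "T0 (\<lambda>_ _. 1) z x = emeasure \<mu> {y. \<bar>z - c y\<bar> < a}" by simp
qed

lemma reset_prob_indep: "reset_prob k z x = reset_prob k z 0"
proof -
  have "meas2 (T0 (\<lambda>_ _. 1))" by (intro meas2_T0) simp
  from meas2_compose[OF this, of "\<lambda>z. z" borel "\<lambda>_. 0"]
  have "(\<lambda>z. emeasure \<mu> {y. \<bar>z - c y\<bar> < a}) \<in> borel_measurable borel"
    by (simp add: T0_one)
  then show ?thesis unfolding T0_one by (rule T1_indep_right)
qed

text \<open>The factor for cycles of length \<open>k + 1\<close>: \<open>gain\<close> for the first
  step, the chance that the reset comes exactly at the last one, and \<open>\<gamma>\<close> for
  that reset. The case \<open>0\<close> is a cycle of a single step.\<close>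

definition first_gain :: "nat \<Rightarrow> ennreal" where
  "first_gain k = \<gamma> * (\<integral>\<^sup>+y. (case k of 0 \<Rightarrow> (if \<bar>c y\<bar> < a then gain y else 0)
     | Suc j \<Rightarrow> (if \<bar>c y\<bar> < a then 0 else gain y * reset_prob j \<bar>c y\<bar> 0)) \<partial>\<mu>)"

lemma sum_first_gain: "(\<Sum>k<n. first_gain k) \<le> ennreal \<rho>"
proof -
  note [measurable (raw)] = meas2_compose[OF meas2_reset_prob]
  \<comment> \<open>The extra term allows the case \<open>0\<close> to be split off for every
    \<open>n\<close>, including \<open>n = 0\<close>.\<close>
  have "(\<Sum>k<n. first_gain k) \<le> (\<Sum>k<Suc n. first_gain k)" by simp
  also have "\<dots> = \<gamma> * (\<integral>\<^sup>+y. (if \<bar>c y\<bar> < a then gain y else 0) +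
      (\<Sum>k<n. if \<bar>c y\<bar> < a then 0 else gain y * reset_prob k \<bar>c y\<bar> 0) \<partial>\<mu>)"
    unfolding first_gain_def sum.lessThan_Suc_shift
    by (subst nn_integral_add) (simp_all add: nn_integral_sum sum_distrib_left distrib_left)
  also have "\<dots> \<le> \<gamma> * (\<integral>\<^sup>+y. gain y \<partial>\<mu>)"
  proof (intro mult_left_mono nn_integral_mono)
    fix y
    have "gain y * (\<Sum>k<n. reset_prob k \<bar>c y\<bar> 0) \<le> gain y * 1"
      by (intro mult_left_mono sum_reset_prob) simp
    then show "(if \<bar>c y\<bar> < a then gain y else 0) +
        (\<Sum>k<n. if \<bar>c y\<bar> < a then 0 else gain y * reset_prob k \<bar>c y\<bar> 0) \<le> gain y"
      by (simp add: sum_distrib_left)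
  qed simp
  finally show ?thesis by (simp add: integral_gain)
qed

lemma T0_dist_exp:
  "T0 dist_exp z x \<le> \<gamma> * (dist_exp z x * T0 (\<lambda>_ _. 1) z x)"
proof -
  have "T0 dist_exp z x \<le> (\<integral>\<^sup>+y. (\<gamma> * dist_exp z x) * (if \<bar>z - c y\<bar> < a then 1 else 0) \<partial>\<mu>)"
    unfolding T0_def
  proof (intro nn_integral_mono)
    fix y
    have "dist_exp 0 \<bar>x - c y\<bar> \<le> \<gamma> * dist_exp z x" if "\<bar>z - c y\<bar> < a"
    proof -
      have "dist_exp 0 \<bar>x - c y\<bar> \<le> \<gamma> * dist_exp \<bar>z - c y\<bar> \<bar>x - c y\<bar>"
        using that by (intro dist_exp_reset) auto
      also have "\<dots> \<le> \<gamma> * dist_exp z x"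
        by (intro mult_left_mono dist_exp_step) simp
      finally show ?thesis .
    qed
    then show "(if \<bar>z - c y\<bar> < a then dist_exp 0 \<bar>x - c y\<bar> else 0) \<le>
        (\<gamma> * dist_exp z x) * (if \<bar>z - c y\<bar> < a then 1 else 0)" by simp
  qed
  also have "\<dots> = (\<gamma> * dist_exp z x) * T0 (\<lambda>_ _. 1) z x"
    unfolding T0_def by (rule nn_integral_cmult) measurable
  finally show ?thesis by (simp add: mult.assoc)
qed

text \<open>The first step is estimated on its own, since only there \<open>z = 0\<close> is known
  and \<open>dist_exp_gain\<close> applies; afterwards the distance merely does not grow, until the
  reset costs \<open>\<gamma>\<close>.\<close>

lemma cycle_far:
  assumes x: "b + \<delta> \<le> x"
  shows "(T1 ^^ k) (T0 dist_exp) 0 x \<le> first_gain k * dist_exp 0 x"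
proof (cases k)
  case 0
  have "T0 dist_exp 0 x \<le> (\<integral>\<^sup>+y. (\<gamma> * dist_exp 0 x) * (if \<bar>c y\<bar> < a then gain y else 0) \<partial>\<mu>)"
    unfolding T0_def
  proof (intro nn_integral_mono)
    fix y
    have "dist_exp 0 \<bar>x - c y\<bar> \<le> \<gamma> * dist_exp 0 x * gain y" if "\<bar>c y\<bar> < a"
    proof -
      have "dist_exp 0 \<bar>x - c y\<bar> \<le> \<gamma> * dist_exp \<bar>0 - c y\<bar> \<bar>x - c y\<bar>"
        using that by (intro dist_exp_reset) auto
      also have "\<dots> \<le> \<gamma> * (gain y * dist_exp 0 x)"
        by (intro mult_left_mono dist_exp_gain x) simp
      finally show ?thesis by (simp add: mult_ac)
    qed
    then show "(if \<bar>0 - c y\<bar> < a then dist_exp 0 \<bar>x - c y\<bar> else 0) \<le>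
        (\<gamma> * dist_exp 0 x) * (if \<bar>c y\<bar> < a then gain y else 0)" by simp
  qed
  also have "\<dots> = first_gain 0 * dist_exp 0 x"
    by (subst nn_integral_cmult) (simp_all add: first_gain_def mult_ac)
  finally show ?thesis using 0 by simp
next
  case (Suc j)
  note [measurable (raw)] = meas2_compose[OF meas2_reset_prob]
  have x0: "0 \<le> x" using x \<delta> \<delta>b by simp
  have "(T1 ^^ k) (T0 dist_exp) 0 x = T1 ((T1 ^^ j) (T0 dist_exp)) 0 x" using Suc by simp
  also have "\<dots> \<le> (\<integral>\<^sup>+y. (\<gamma> * dist_exp 0 x) * (if \<bar>c y\<bar> < a then 0 else gain y * reset_prob j \<bar>c y\<bar> 0) \<partial>\<mu>)"
  proof (subst T1_def, intro nn_integral_mono)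
    fix y
    have "(T1 ^^ j) (T0 dist_exp) \<bar>0 - c y\<bar> \<bar>x - c y\<bar> \<le>
        \<gamma> * (dist_exp \<bar>0 - c y\<bar> \<bar>x - c y\<bar> * reset_prob j \<bar>0 - c y\<bar> \<bar>x - c y\<bar>)"
      using T0_dist_exp by (intro T1_pow_dist_exp meas2_T0) auto
    also have "\<dots> \<le> \<gamma> * (gain y * dist_exp 0 x * reset_prob j \<bar>0 - c y\<bar> \<bar>x - c y\<bar>)"
      using dist_exp_gain[OF x] by (intro mult_left_mono mult_right_mono) auto
    also have "reset_prob j \<bar>0 - c y\<bar> \<bar>x - c y\<bar> = reset_prob j \<bar>c y\<bar> 0"
      using reset_prob_indep[of j "\<bar>c y\<bar>" "\<bar>x - c y\<bar>"] by simp
    finally show "(if \<bar>0 - c y\<bar> < a then 0 else (T1 ^^ j) (T0 dist_exp) \<bar>0 - c y\<bar> \<bar>x - c y\<bar>) \<le>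
        (\<gamma> * dist_exp 0 x) * (if \<bar>c y\<bar> < a then 0 else gain y * reset_prob j \<bar>c y\<bar> 0)"
      by (simp add: mult_ac)
  qed
  also have "\<dots> = first_gain k * dist_exp 0 x"
    by (subst nn_integral_cmult) (simp_all add: first_gain_def mult_ac Suc)
  finally show ?thesis .
qed

lemma cycle_near:
  assumes x: "x \<le> b + \<delta>" "0 \<le> x"
  shows "(T1 ^^ k) (T0 dist_exp) 0 x \<le> ennreal C * reset_prob k 0 0"
proof -
  have "(T1 ^^ k) (T0 dist_exp) 0 x \<le> \<gamma> * (dist_exp 0 x * reset_prob k 0 x)"
    using T0_dist_exp x by (intro T1_pow_dist_exp meas2_T0) auto
  also have "\<dots> \<le> \<gamma> * (ennreal (exp (\<theta> * (b + \<delta>))) * reset_prob k 0 x)"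
    unfolding dist_exp_def using x \<theta>_pos
    by (intro mult_left_mono mult_right_mono ennreal_leI) auto
  also have "\<dots> = ennreal C * reset_prob k 0 0"
    using reset_prob_indep[of k 0 x] by (simp add: C_def ennreal_mult' mult_ac)
  finally show ?thesis .
qed

text \<open>Solves \<open>W * (1 - \<rho>) = 1 + C\<close>, which leaves
  \<open>\<rho> * W + C \<le> W\<close> for the induction step and \<open>W \<ge> 1\<close> for its
  start.\<close>

definition W :: real where "W = (1 + C) / (1 - \<rho>)"

lemma W_bounds: "1 \<le> W" "\<rho> * W + C \<le> W" "0 \<le> C"
proof -
  show C: "0 \<le> C" by (simp add: C_def)
  have "1 - \<rho> \<le> 1 + C" using \<rho>_bounds C by simp
  then show "1 \<le> W" unfolding W_def using \<rho>_bounds by simp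
  have "W * (1 - \<rho>) = 1 + C" unfolding W_def using \<rho>_bounds by simp
  then show "\<rho> * W + C \<le> W" by (simp add: algebra_simps)
qed

text \<open>A renewal inequality. If the previous reset lies \<open>k + 1\<close> steps back, a
  distant \<open>x\<close> contributes \<open>first_gain k\<close> times an earlier moment, a near
  one at most \<open>C * reset_prob k 0 0\<close>. The weights sum to at most \<open>\<rho>\<close>
  and 1, so the bound does not grow with the number of cycles.\<close>

lemma reset_moment: "(T ^^ n) (at_reset dist_exp) 0 0 \<le> ennreal W"
proof (induction n rule: less_induct)
  case (less n)
  show ?case
  proof (cases n)
    case 0
    then show ?thesis using W_bounds by (simp add: at_reset_def dist_exp_def ennreal_leI[of 1])
  next
    case (Suc m)
    have bound: "at_reset ((T1 ^^ k) (T0 dist_exp)) z x \<le>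
        first_gain k * at_reset dist_exp z x + ennreal C * reset_prob k 0 0" if "0 \<le> x" for k z x
      using cycle_far[of x k] cycle_near[of x k] that
      by (cases "b + \<delta> \<le> x") (auto simp: at_reset_def intro: add_increasing add_increasing2)
    have "(T ^^ n) (at_reset dist_exp) 0 0 = (T ^^ m) (T0 dist_exp) 0 0"
      using Suc by (simp add: funpow_swap1 T_at_reset)
    also have "\<dots> = (\<Sum>k\<le>m. (T ^^ (m - k)) (at_reset ((T1 ^^ k) (T0 dist_exp))) 0 0)"
      by (intro last_reset meas2_T0 meas2_dist_exp)
    also have "\<dots> \<le> (\<Sum>k\<le>m. (T ^^ (m - k)) (\<lambda>z x. first_gain k * at_reset dist_exp z x + ennreal C * reset_prob k 0 0) 0 0)"
      using bound by (intro sum_mono T_pow_mono) auto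
    also have "\<dots> = (\<Sum>k\<le>m. first_gain k * (T ^^ (m - k)) (at_reset dist_exp) 0 0 + ennreal C * reset_prob k 0 0)"
      by (subst T_pow_add)
        (simp_all add: meas2_cmult meas2_at_reset meas2_dist_exp T_pow_cmult T_pow_const)
    also have "\<dots> \<le> (\<Sum>k\<le>m. first_gain k * ennreal W + ennreal C * reset_prob k 0 0)"
      using Suc by (intro sum_mono add_mono mult_left_mono less) auto
    also have "\<dots> = (\<Sum>k<Suc m. first_gain k) * ennreal W + ennreal C * (\<Sum>k<Suc m. reset_prob k 0 0)"
      by (simp only: sum.distrib sum_distrib_right sum_distrib_left lessThan_Suc_atMost)
    also have "\<dots> \<le> ennreal \<rho> * ennreal W + ennreal C * 1"
      by (intro add_mono mult_mono sum_first_gain sum_reset_prob) auto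
    also have "\<dots> = ennreal (\<rho> * W + C)"
      using \<rho>_bounds W_bounds by (simp add: ennreal_mult ennreal_plus)
    also have "\<dots> \<le> ennreal W" by (intro ennreal_leI W_bounds)
    finally show ?thesis .
  qed
qed

section \<open>Tails at arbitrary times\<close>

abbreviation survival :: "nat \<Rightarrow> ennreal" where
  "survival k \<equiv> (T1 ^^ k) (\<lambda>_ _. 1) 0 0"

lemma suminf_survival: "(\<Sum>k. survival k) = mean_hit"
proof -
  have "survival k = (\<integral>\<^sup>+ys. (if no_hit 0 k ys then 1 else 0) \<partial>S)" for k
    using T1_pow_eq_flow[of "\<lambda>_. 1" k 0 0] by simp
  then show ?thesis by (simp add: nn_integral_suminf)
qed

text \<open>Whatever the time \<open>n\<close>, a cycle of age \<open>k\<close> carries at most the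
  weight \<open>survival k\<close>, and these weights sum to \<open>mean_hit\<close>. The moment at
  the last reset is at most \<open>W\<close> and does not grow within the cycle.\<close>

lemma dist_moment: "(T ^^ n) dist_exp 0 0 \<le> mean_hit * ennreal W"
proof -
  have "(T ^^ n) dist_exp 0 0 = (\<Sum>k\<le>n. (T ^^ (n - k)) (at_reset ((T1 ^^ k) dist_exp)) 0 0)"
    by (intro last_reset meas2_dist_exp)
  also have "\<dots> \<le> (\<Sum>k\<le>n. (T ^^ (n - k)) (\<lambda>z x. survival k * at_reset dist_exp z x) 0 0)"
  proof (intro sum_mono T_pow_mono)
    fix k and z x :: real assume "0 \<le> x"
    then have "(T1 ^^ k) dist_exp 0 x \<le> 1 * (dist_exp 0 x * (T1 ^^ k) (\<lambda>_ _. 1) 0 x)"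
      by (intro T1_pow_dist_exp) auto
    then show "at_reset ((T1 ^^ k) dist_exp) z x \<le> survival k * at_reset dist_exp z x"
      using T1_indep_right[of "\<lambda>_. 1" k 0 x] by (simp add: at_reset_def mult.commute)
  qed auto
  also have "\<dots> = (\<Sum>k\<le>n. survival k * (T ^^ (n - k)) (at_reset dist_exp) 0 0)"
    by (simp add: T_pow_cmult meas2_at_reset meas2_dist_exp)
  also have "\<dots> \<le> (\<Sum>k\<le>n. survival k * ennreal W)"
    by (intro sum_mono mult_left_mono reset_moment) simp
  also have "\<dots> = (\<Sum>k<Suc n. survival k) * ennreal W"
    by (simp only: sum_distrib_right lessThan_Suc_atMost)
  also have "\<dots> \<le> (\<Sum>k. survival k) * ennreal W"
    by (intro mult_right_mono sum_le_suminf) auto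
  finally show ?thesis by (simp only: suminf_survival)
qed

text \<open>Bounding the probability of a reset at time \<open>n - k\<close> by 1 makes the
  right-hand side independent of \<open>n\<close>.\<close>

lemma reset_copy_tail:
  assumes h: "h \<in> borel_measurable borel"
  shows "(T ^^ n) (\<lambda>z x. h z) 0 0 \<le>
    visits h"
proof -
  let ?u = "\<lambda>k. (T1 ^^ k) (\<lambda>z x. h z) 0 0"
  have "meas2 (\<lambda>z x. h z)" using h by simp
  then have "(T ^^ n) (\<lambda>z x. h z) 0 0 = (\<Sum>k\<le>n. (T ^^ (n - k)) (at_reset ((T1 ^^ k) (\<lambda>z x. h z))) 0 0)"
    by (rule last_reset)
  also have "\<dots> \<le> (\<Sum>k\<le>n. (T ^^ (n - k)) (\<lambda>z x. ?u k) 0 0)"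
  proof (intro sum_mono T_pow_mono)
    fix k and z x :: real
    show "at_reset ((T1 ^^ k) (\<lambda>z x. h z)) z x \<le> ?u k"
      using T1_indep_right[OF h, of k 0 x] by (simp add: at_reset_def)
  qed auto
  also have "\<dots> = (\<Sum>k\<le>n. ?u k)" by (simp only: T_pow_const)
  also have "\<dots> \<le> (\<Sum>k. ?u k)" by (intro sum_le_suminf) auto
  finally show ?thesis using T1_pow_eq_flow[OF h] by simp
qed

text \<open>Either the copy itself exceeds \<open>K\<close> or the distance to it does; the second
  event is treated by Markov's inequality for \<open>dist_exp\<close>.\<close>

lemma tail_bound:
  "emeasure S {ys. 2 * K < rw n 0 ys} \<le>
    visits (indicator {K<..}) +
    ennreal (exp (- \<theta> * K)) * (mean_hit * ennreal W)"
proof -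
  have [measurable]: "(\<lambda>ys. rw n 0 ys) \<in> borel_measurable S" by measurable
  have "emeasure S {ys. 2 * K < rw n 0 ys} = (\<integral>\<^sup>+ys. indicator {2 * K<..} (rw n 0 ys) \<partial>S)"
  proof -
    have "(\<integral>\<^sup>+ys. indicator {2 * K<..} (rw n 0 ys) \<partial>S) = (\<integral>\<^sup>+ys. indicator {ys. 2 * K < rw n 0 ys} ys \<partial>S)"
      by (intro nn_integral_cong) (auto split: split_indicator)
    moreover have "{ys. 2 * K < rw n 0 ys} \<in> sets S"
      using measurable_sets[OF \<open>(\<lambda>ys. rw n 0 ys) \<in> _\<close>, of "{2*K<..}"] by (simp add: vimage_def)
    ultimately show ?thesis by simp
  qed
  also have "\<dots> = (T ^^ n) (\<lambda>z x. indicator {2 * K<..} x) 0 0"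
    by (simp add: T_pow_eq_flow)
  also have "\<dots> \<le> (T ^^ n) (\<lambda>z x. indicator {K<..} z + ennreal (exp (- \<theta> * K)) * dist_exp z x) 0 0"
  proof (intro T_pow_mono)
    fix z x :: real
    have "1 \<le> ennreal (exp (- \<theta> * K)) * dist_exp z x" if "2 * K < x" "\<not> K < z"
    proof -
      have "\<theta> * K \<le> \<theta> * \<bar>x - z\<bar>" using that \<theta>_pos by (intro mult_left_mono) auto
      then show ?thesis unfolding dist_exp_def
        by (simp add: ennreal_mult'[symmetric] exp_add[symmetric] ennreal_leI[of 1, simplified])
    qed
    then show "indicator {2 * K<..} x \<le> indicator {K<..} z + ennreal (exp (- \<theta> * K)) * dist_exp z x"
      by (auto split: split_indicator intro: add_increasing2)
  qed auto
  also have "\<dots> = (T ^^ n) (\<lambda>z x. indicator {K<..} z) 0 0 + ennreal (exp (- \<theta> * K)) * (T ^^ n) dist_exp 0 0"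
    by (subst T_pow_add) (simp_all add: meas2_cmult meas2_dist_exp T_pow_cmult)
  also have "\<dots> \<le> visits (indicator {K<..}) +
    ennreal (exp (- \<theta> * K)) * (mean_hit * ennreal W)"
    by (intro add_mono mult_left_mono reset_copy_tail dist_moment) auto
  finally show ?thesis .
qed

lemma tight_of_hit_time:
  assumes fin: "mean_hit < \<infinity>" and \<epsilon>: "0 < \<epsilon>"
  shows "\<exists>K. \<forall>n. emeasure S {ys. K < rw n 0 ys} < \<epsilon>"
proof -
  let ?B = "\<lambda>m::nat. visits (indicator {real m<..}) +
    ennreal (exp (- \<theta> * real m)) * (mean_hit * ennreal W)"
  have "(\<lambda>m. exp (- \<theta> * real m)) \<longlonglongrightarrow> 0"
    using \<theta>_pos by real_asymp
  then have "(\<lambda>m. ennreal (exp (- \<theta> * real m))) \<longlonglongrightarrow> 0"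
    using tendsto_ennrealI by fastforce
  moreover have "mean_hit * ennreal W \<noteq> \<infinity>"
    using fin by (simp add: ennreal_mult_eq_top_iff less_top)
  ultimately have "(\<lambda>m. ennreal (exp (- \<theta> * real m)) * (mean_hit * ennreal W)) \<longlonglongrightarrow> 0 * (mean_hit * ennreal W)"
    by (intro tendsto_mult_ennreal tendsto_const) auto
  from tendsto_add[OF tail_hit_time[OF fin] this]
  have "?B \<longlonglongrightarrow> 0" by simp
  then have "eventually (\<lambda>m. ?B m < \<epsilon>) sequentially"
    by (rule order_tendstoD) (rule \<epsilon>)
  then obtain m where "?B m < \<epsilon>" by (auto simp: eventually_sequentially)
  then show ?thesis using tail_bound[of "real m"] by (intro exI[of _ "2 * real m"]) (auto intro: le_less_trans)
qed

end

context coord_noise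
begin

theorem tight_coord:
  assumes pos: "emeasure \<mu> {y. 0 < c y} > 0"
    and fin: "\<And>a. 0 < a \<Longrightarrow> (\<integral>\<^sup>+ys. return_time (\<lambda>n. rw n 0 ys) {..<a} \<partial>S) < \<infinity>"
    and \<epsilon>: "0 < \<epsilon>"
  shows "\<exists>K. \<forall>n. emeasure S {ys. K < rw n x ys} < \<epsilon>"
proof -
  let ?A = "\<lambda>n::nat. {y. 1 / Suc n < c y \<and> c y \<le> Suc n}"
  have "\<exists>n. emeasure \<mu> (?A n) > 0"
  proof (rule ccontr)
    assume "\<not> ?thesis"
    then have "emeasure \<mu> (\<Union>n. ?A n) = 0"
      by (intro emeasure_UN_eq_0) (auto simp: not_less)
    moreover have "{y. 0 < c y} \<subseteq> (\<Union>n. ?A n)"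
    proof
      fix y assume "y \<in> {y. 0 < c y}"
      then have y: "0 < c y" by simp
      obtain k where k: "inverse (real (Suc k)) < c y" using reals_Archimedean[OF y] by auto
      obtain l where l: "c y \<le> real l" using real_arch_simple by blast
      have "inverse (real (Suc (k + l))) \<le> inverse (real (Suc k))" by (intro le_imp_inverse_le) auto
      then have "y \<in> ?A (k + l)" using k l by (auto simp: inverse_eq_divide)
      then show "y \<in> (\<Union>n. ?A n)" by (rule UN_I[OF UNIV_I])
    qed
    moreover have "(\<Union>n. ?A n) \<in> sets \<mu>" by measurable
    ultimately have "emeasure \<mu> {y. 0 < c y} = 0"
      using emeasure_mono[of "{y. 0 < c y}" "\<Union>n. ?A n" \<mu>] by (simp only: le_zero_eq)
    then show False using pos by simp
  qed
  then obtain n where n: "emeasure \<mu> (?A n) > 0" by auto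
  define p where "p = measure \<mu> (?A n)"
  define \<delta> where "\<delta> = 1 / real (Suc n)"
  have p: "0 < p" using n by (simp add: p_def emeasure_eq_measure)
  \<comment> \<open>Here \<open>b = 1 / \<delta>\<close>, and the increments in
    \<open>(\<delta>, b]\<close> have mass \<open>p\<close>. The reset level
    \<open>\<delta> * p\<close> is fixed only afterwards, which is possible because
    \<open>fin\<close> covers every level.\<close>
  interpret drift_chain \<mu> c "\<delta> * p" \<delta> "real (Suc n)" "1 / (4 * \<delta>)" p
    using p by unfold_locales (auto simp: \<delta>_def p_def field_simps)
  have "mean_hit = (\<integral>\<^sup>+ys. return_time (\<lambda>n. rw n 0 ys) {..<\<delta> * p} \<partial>S)"
    by (simp add: return_time_eq_suminf not_less)
  then have "mean_hit < \<infinity>" using fin[of "\<delta> * p"] a_pos by simp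
  from tight_of_hit_time[OF this \<epsilon>] obtain K where K: "\<And>n. emeasure S {ys. K < rw n 0 ys} < \<epsilon>" by auto
  \<comment> \<open>Starting at \<open>x\<close> instead of 0 shifts the walk by at most
    \<open>\<bar>x\<bar>\<close>.\<close>
  have "emeasure S {ys. K + \<bar>x\<bar> < rw n x ys} < \<epsilon>" for n
  proof -
    have "{ys. K + \<bar>x\<bar> < rw n x ys} \<subseteq> {ys. K < rw n 0 ys}"
    proof
      fix ys assume "ys \<in> {ys. K + \<bar>x\<bar> < rw n x ys}"
      then show "ys \<in> {ys. K < rw n 0 ys}" using rw_lipschitz[of n x ys 0] by simp
    qed
    then have "emeasure S {ys. K + \<bar>x\<bar> < rw n x ys} \<le> emeasure S {ys. K < rw n 0 ys}"
      by (intro emeasure_mono sets_Collect_S) measurable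
    then show ?thesis using K by (rule le_less_trans)
  qed
  then show ?thesis by blast
qed

end

section \<open>Contraction in one dimension\<close>

lemma real_subgroup_cyclic:
  fixes G :: "real set"
  assumes zero: "0 \<in> G" and diff: "\<And>x y. x \<in> G \<Longrightarrow> y \<in> G \<Longrightarrow> x - y \<in> G"
    and t: "t \<in> G" "0 < t" and d: "0 < d" and gap: "\<And>g. g \<in> G \<Longrightarrow> 0 < g \<Longrightarrow> d \<le> g"
  shows "\<exists>\<kappa>>0. \<kappa> \<in> G \<and> G \<subseteq> range (\<lambda>k::int. \<kappa> * of_int k)"
proof -
  let ?P = "{g \<in> G. 0 < g}"
  define \<kappa> where "\<kappa> = Inf ?P"
  have ne: "?P \<noteq> {}" using t by auto
  have bdd: "bdd_below ?P" by (rule bdd_belowI[of _ 0]) auto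
  have "d \<le> \<kappa>" unfolding \<kappa>_def using ne gap by (intro cInf_greatest) auto
  then have pos: "0 < \<kappa>" using d by simp
  obtain g where g: "g \<in> ?P" "g < \<kappa> + d"
    using cInf_lessD[OF ne, of "\<kappa> + d"] d by (auto simp: \<kappa>_def)
  \<comment> \<open>The infimum is attained: otherwise two distinct positive elements would lie in
    \<open>[\<kappa>, \<kappa> + d)\<close>, and their difference would be a positive element below
    \<open>d\<close>.\<close>
  have "\<kappa> = g"
  proof (rule ccontr)
    assume "\<kappa> \<noteq> g"
    moreover have "\<kappa> \<le> g" unfolding \<kappa>_def using g bdd by (intro cInf_lower) auto
    ultimately have "\<kappa> < g" by simp
    then obtain h where h: "h \<in> ?P" "h < g"
      using cInf_lessD[OF ne, of g] by (auto simp: \<kappa>_def)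
    moreover have "\<kappa> \<le> h" unfolding \<kappa>_def using h bdd by (intro cInf_lower) auto
    moreover have "d \<le> g - h" using g h by (intro gap diff) auto
    ultimately show False using g by auto
  qed
  then have \<kappa>: "\<kappa> \<in> G" using g by simp
  have add: "x + y \<in> G" if "x \<in> G" "y \<in> G" for x y
    using diff[OF that(1) diff[OF zero that(2)]] by simp
  have nat_mult: "\<kappa> * real n \<in> G" for n
    by (induction n) (use zero \<kappa> add in \<open>auto simp: distrib_left\<close>)
  have int_mult: "\<kappa> * of_int k \<in> G" for k
  proof (cases "0 \<le> k")
    case True
    then show ?thesis using nat_mult[of "nat k"] by simp
  next
    case False
    then show ?thesis using diff[OF zero nat_mult[of "nat (- k)"]] by simp
  qed
  have "g \<in> range (\<lambda>k::int. \<kappa> * of_int k)" if "g \<in> G" for g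
  proof -
    define k where "k = \<lfloor>g / \<kappa>\<rfloor>"
    have "of_int k \<le> g / \<kappa>" "g / \<kappa> < of_int k + 1" unfolding k_def by linarith+
    then have r: "0 \<le> g - \<kappa> * of_int k" "g - \<kappa> * of_int k < \<kappa>" using pos by (auto simp: field_simps)
    have "g - \<kappa> * of_int k = 0"
    proof (rule ccontr)
      assume "g - \<kappa> * of_int k \<noteq> 0"
      then have "g - \<kappa> * of_int k \<in> ?P" using r diff[OF that int_mult] by auto
      then have "\<kappa> \<le> g - \<kappa> * of_int k" unfolding \<kappa>_def using bdd by (intro cInf_lower)
      then show False using r by simp
    qed
    then show ?thesis by auto
  qed
  then show ?thesis using pos \<kappa> by auto
qed

text \<open>
  Read \<open>U\<close> as the set of \<open>u\<close> for which the walks from \<open>u\<close> and \<open>u + d\<close> never get closer.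
  Modulo \<open>t\<close> this set is stable under \<open>u \<mapsto> -d - u\<close> and under subtraction of increments,
  hence under the group generated by the increments, while it avoids an interval of length \<open>d\<close>.
\<close>

lemma rigid_pairs_gap:
  fixes U E :: "real set"
  assumes u0: "u0 \<in> U" and nonneg: "\<And>u. u \<in> U \<Longrightarrow> 0 \<le> u" and t: "t \<in> E" "0 < t" and d: "0 < d"
    and dich: "\<And>u y. u \<in> U \<Longrightarrow> y \<in> E \<Longrightarrow> y \<le> u \<or> u + d \<le> y"
    and below: "\<And>u y. u \<in> U \<Longrightarrow> y \<in> E \<Longrightarrow> y \<le> u \<Longrightarrow> u - y \<in> U"
    and above: "\<And>u y. u \<in> U \<Longrightarrow> y \<in> E \<Longrightarrow> u + d \<le> y \<Longrightarrow> y - d - u \<in> U"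
  shows "\<exists>G. 0 \<in> G \<and> (\<forall>x\<in>G. \<forall>y\<in>G. x - y \<in> G) \<and> E \<subseteq> G \<and> (\<forall>g\<in>G. 0 < g \<longrightarrow> d \<le> g)"
proof -
  \<comment> \<open>\<open>U\<close> modulo \<open>t\<close>, with representatives below
    \<open>t\<close>: for these the dichotomy with increment \<open>t\<close> leaves only
    \<open>u + d \<le> t\<close>, so that \<open>above\<close> applies.\<close>
  define V where "V = {w. \<exists>k::int. w + of_int k * t \<in> U \<and> w + of_int k * t < t}"
  have shift: "w + of_int k * t \<in> V" if "w \<in> V" for w and k :: int
  proof -
    from that obtain l :: int where l: "w + of_int l * t \<in> U" "w + of_int l * t < t" by (auto simp: V_def)
    have eq: "w + of_int k * t + of_int (l - k) * t = w + of_int l * t" by (simp add: algebra_simps)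
    show ?thesis unfolding V_def by (intro CollectI exI[of _ "l - k"]) (simp only: eq l simp_thms)
  qed
  have U_V: "u \<in> V" if "u \<in> U" for u
  proof -
    have "u < t + real n * t \<Longrightarrow> u \<in> U \<Longrightarrow> u \<in> V" for n u
    proof (induction n arbitrary: u)
      case 0
      then show ?case unfolding V_def by (intro CollectI exI[of _ 0]) simp
    next
      case (Suc n)
      show ?case
      proof (cases "u < t")
        case True
        then show ?thesis using Suc.prems unfolding V_def by (intro CollectI exI[of _ 0]) simp
      next
        case False
        then have "u - t \<in> U" using Suc.prems t by (intro below) auto
        then have "u - t \<in> V" using Suc by (simp add: algebra_simps)
        then show ?thesis using shift[of "u - t" 1] by simp
      qed
    qed
    moreover obtain n where "u < real n * t" using ex_less_of_nat_mult[OF t(2)] by auto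
    ultimately show ?thesis using that t(2) by (metis add_strict_increasing less_imp_le)
  qed
  have inv: "- d - w \<in> V" if w: "w \<in> V" for w
  proof -
    from w obtain l :: int where l: "w + of_int l * t \<in> U" "w + of_int l * t < t" by (auto simp: V_def)
    have "t - d - (w + of_int l * t) \<in> U"
      using dich[OF l(1) t(1)] l by (intro above t) auto
    then have "t - d - (w + of_int l * t) + of_int (l - 1) * t \<in> V" by (intro shift U_V)
    then show ?thesis by (simp add: algebra_simps)
  qed
  have minus: "w - y \<in> V" if w: "w \<in> V" and y: "y \<in> E" for w y
  proof -
    from w obtain l :: int where l: "w + of_int l * t \<in> U" "w + of_int l * t < t" by (auto simp: V_def)
    have "w + of_int l * t - y \<in> V"
    proof (cases "y \<le> w + of_int l * t")
      case True
      then show ?thesis using l y by (intro U_V below)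
    next
      case False
      then have "y - d - (w + of_int l * t) \<in> U" using dich[OF l(1) y] l y by (intro above) auto
      from inv[OF U_V[OF this]] show ?thesis by (simp add: algebra_simps)
    qed
    from shift[OF this, of "- l"] show ?thesis by (simp add: algebra_simps)
  qed
  have plus: "w + y \<in> V" if "w \<in> V" "y \<in> E" for w y
    using inv[OF minus[OF inv[OF that(1)] that(2)]] by simp
  \<comment> \<open>The stabiliser of \<open>V\<close> under translations is a group by
    construction; it remains to see that it contains the increments and no positive element below
    \<open>d\<close>.\<close>
  define G where "G = {g. \<forall>w. w + g \<in> V \<longleftrightarrow> w \<in> V}"
  have G_diff: "x - y \<in> G" if "x \<in> G" "y \<in> G" for x y
  proof -
    have "w + (x - y) \<in> V \<longleftrightarrow> w \<in> V" for w
      using that(1)[unfolded G_def, simplified, rule_format, of "w - y"]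
        that(2)[unfolded G_def, simplified, rule_format, of "w - y"] by (simp add: algebra_simps)
    then show ?thesis by (simp add: G_def)
  qed
  have E_G: "E \<subseteq> G"
  proof
    fix s assume s: "s \<in> E"
    have "w + s \<in> V \<longleftrightarrow> w \<in> V" for w
      using plus[OF _ s, of w] minus[OF _ s, of "w + s"] by auto
    then show "s \<in> G" by (simp add: G_def)
  qed
  have gap: "d \<le> g" if g: "g \<in> G" "0 < g" for g
  proof (rule ccontr)
    assume "\<not> d \<le> g"
    have mult: "w + real n * g \<in> V \<longleftrightarrow> w \<in> V" for w n
    proof (induction n)
      case (Suc n)
      have "w + real (Suc n) * g = (w + real n * g) + g" by (simp add: algebra_simps)
      also have "\<dots> \<in> V \<longleftrightarrow> w + real n * g \<in> V" using g(1) unfolding G_def by blast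
      finally show ?case using Suc by simp
    qed simp
    from U_V[OF u0] obtain l :: int where l: "u0 + of_int l * t \<in> U" "u0 + of_int l * t < t" by (auto simp: V_def)
    define w where "w = u0 + of_int l * t"
    have w: "w \<in> V" "w \<le> t - d" unfolding w_def using l dich[OF l(1) t(1)] U_V by auto
    \<comment> \<open>Multiples of some \<open>g < d\<close> cannot jump over
      \<open>(t - d, t)\<close>. A point of \<open>V\<close> in that interval has its representative
      in \<open>U\<close> at most at \<open>t - d\<close>, hence moved down by \<open>t\<close> at
      least once and negative.\<close>
    define n where "n = nat \<lfloor>(t - d - w) / g\<rfloor> + 1"
    have n: "real n = of_int \<lfloor>(t - d - w) / g\<rfloor> + 1" unfolding n_def using w g by simp
    have "(t - d - w) / g < real n" "real n \<le> (t - d - w) / g + 1" unfolding n by linarith+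
    then have "t - d < w + real n * g" "w + real n * g \<le> t - d + g"
      using g by (auto simp: field_simps)
    with \<open>\<not> d \<le> g\<close> have r: "t - d < w + real n * g" "w + real n * g < t" by auto
    have "w + real n * g \<in> V" using mult w by simp
    then obtain k :: int where k: "w + real n * g + of_int k * t \<in> U" "w + real n * g + of_int k * t < t"
      by (auto simp: V_def)
    have "w + real n * g + of_int k * t + d \<le> t" using dich[OF k(1) t(1)] k by auto
    with r have "of_int k * t < 0" by simp
    then have "k \<le> -1" using t(2) by (simp add: mult_less_0_iff)
    then have "of_int k * t \<le> (-1) * t" using t(2) by (intro mult_right_mono) auto
    then have "w + real n * g + of_int k * t < 0" using r by simp
    then show False using nonneg[OF k(1)] by simp
  qed
  have "0 \<in> G" by (simp add: G_def)
  then show ?thesis by (intro exI[of _ G] conjI ballI impI G_diff E_G gap)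
qed

lemma continuous_lipschitz2:
  fixes f :: "real \<Rightarrow> real \<Rightarrow> real"
  assumes "\<And>u v u' v'. \<bar>f u v - f u' v'\<bar> \<le> \<bar>u - u'\<bar> + \<bar>v - v'\<bar>"
  shows "continuous_on UNIV (\<lambda>p. f (fst p) (snd p))"
proof (rule lipschitz_on_continuous_on[where L=2], rule lipschitz_onI)
  fix p q :: "real \<times> real"
  have "dist (f (fst p) (snd p)) (f (fst q) (snd q)) \<le> dist (fst p) (fst q) + dist (snd p) (snd q)"
    using assms by (simp add: dist_real_def)
  also have "\<dots> \<le> 2 * dist p q" using dist_fst_le[of p q] dist_snd_le[of p q] by simp
  finally show "dist (f (fst p) (snd p)) (f (fst q) (snd q)) \<le> 2 * dist p q" .
qed simp

context coord_noise
begin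

section \<open>Expected distance of two walks with common increments\<close>

definition wdist :: "nat \<Rightarrow> real \<Rightarrow> real \<Rightarrow> real" where
  "wdist n u v = (\<integral>ys. \<bar>rw n u ys - rw n v ys\<bar> \<partial>S)"

text \<open>Limit of a decreasing sequence. Equality \<open>ldist u v = \<bar>u - v\<bar>\<close>
  says that the distance almost surely never shrinks, and averaging over one step leaves the
  function unchanged.\<close>

definition ldist :: "real \<Rightarrow> real \<Rightarrow> real" where
  "ldist u v = (INF n. wdist n u v)"

lemma rw_dist_mono: "m \<le> n \<Longrightarrow> \<bar>rw n u ys - rw n v ys\<bar> \<le> \<bar>rw m u ys - rw m v ys\<bar>"
proof (induction n rule: dec_induct)
  case (step n)
  have "\<bar>rw (Suc n) u ys - rw (Suc n) v ys\<bar> \<le> \<bar>rw n u ys - rw n v ys\<bar>"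
    unfolding flow_Suc_right by linarith
  with step show ?case by simp
qed simp

lemma rw_dist_integrable: "integrable S (\<lambda>ys. \<bar>rw n u ys - rw n v ys\<bar>)"
  by (rule S.integrable_const_bound[of _ "\<bar>u - v\<bar>"]) (simp_all add: rw_lipschitz)

lemma wdist_nonneg: "0 \<le> wdist n u v"
  unfolding wdist_def by simp

lemma wdist_antimono: "m \<le> n \<Longrightarrow> wdist n u v \<le> wdist m u v"
  unfolding wdist_def by (intro integral_mono rw_dist_integrable rw_dist_mono)

lemma wdist_0 [simp]: "wdist 0 u v = \<bar>u - v\<bar>"
  unfolding wdist_def using S.prob_space by simp

lemma wdist_le: "wdist n u v \<le> \<bar>u - v\<bar>"
  using wdist_antimono[of 0 n u v] by simp

lemma wdist_lipschitz: "\<bar>wdist n u v - wdist n u' v'\<bar> \<le> \<bar>u - u'\<bar> + \<bar>v - v'\<bar>"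
proof -
  have le: "wdist n u v \<le> wdist n u' v' + (\<bar>u - u'\<bar> + \<bar>v - v'\<bar>)" for u v u' v'
  proof -
    have "wdist n u v \<le> (\<integral>ys. \<bar>rw n u' ys - rw n v' ys\<bar> + (\<bar>u - u'\<bar> + \<bar>v - v'\<bar>) \<partial>S)"
      unfolding wdist_def
    proof (intro integral_mono Bochner_Integration.integrable_add rw_dist_integrable)
      fix ys
      show "\<bar>rw n u ys - rw n v ys\<bar> \<le> \<bar>rw n u' ys - rw n v' ys\<bar> + (\<bar>u - u'\<bar> + \<bar>v - v'\<bar>)"
        using rw_lipschitz[of n u ys u'] rw_lipschitz[of n v ys v'] by linarith
    qed simp_all
    also have "\<dots> = wdist n u' v' + (\<bar>u - u'\<bar> + \<bar>v - v'\<bar>)"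
      unfolding wdist_def
      by (subst Bochner_Integration.integral_add[OF rw_dist_integrable S.integrable_const])
         (use S.prob_space in simp)
    finally show ?thesis .
  qed
  show ?thesis using le[of u v u' v'] le[of u' v' u v] by (simp add: abs_le_iff)
qed

lemma wdist_tendsto: "(\<lambda>n. wdist n u v) \<longlonglongrightarrow> ldist u v"
  unfolding ldist_def
  by (intro LIMSEQ_decseq_INF bdd_belowI[of _ 0]) (auto simp: decseq_def wdist_nonneg wdist_antimono)

lemma ldist_nonneg: "0 \<le> ldist u v"
  using wdist_tendsto by (rule LIMSEQ_le_const) (auto simp: wdist_nonneg)

lemma ldist_le: "ldist u v \<le> \<bar>u - v\<bar>"
  using wdist_tendsto by (rule LIMSEQ_le_const2) (auto simp: wdist_le)

lemma ldist_commute: "ldist u v = ldist v u"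
  unfolding ldist_def wdist_def by (simp add: abs_minus_commute)

lemma ldist_lipschitz: "\<bar>ldist u v - ldist u' v'\<bar> \<le> \<bar>u - u'\<bar> + \<bar>v - v'\<bar>"
  by (rule LIMSEQ_le_const2[OF tendsto_rabs[OF tendsto_diff[OF wdist_tendsto wdist_tendsto]]])
     (auto simp: wdist_lipschitz)

lemma continuous_ldist: "continuous_on UNIV (\<lambda>p. ldist (fst p) (snd p))"
  by (intro continuous_lipschitz2 ldist_lipschitz)

lemma ldist_meas [measurable (raw)]:
  assumes "f \<in> borel_measurable N" "g \<in> borel_measurable N"
  shows "(\<lambda>x. ldist (f x) (g x)) \<in> borel_measurable N"
  using measurable_compose[OF borel_measurable_Pair[OF assms] borel_measurable_continuous_onI[OF continuous_ldist]]
  by simp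

lemma wdist_meas [measurable (raw)]:
  assumes "f \<in> borel_measurable N" "g \<in> borel_measurable N"
  shows "(\<lambda>x. wdist n (f x) (g x)) \<in> borel_measurable N"
  using measurable_compose[OF borel_measurable_Pair[OF assms]
      borel_measurable_continuous_onI[OF continuous_lipschitz2[OF wdist_lipschitz]]]
  by simp

lemma wdist_Suc: "wdist (Suc n) u v = (\<integral>y. wdist n \<bar>u - c y\<bar> \<bar>v - c y\<bar> \<partial>\<mu>)"
  unfolding wdist_def
  by (subst integral_Stream[where B="\<bar>u - v\<bar>"]) (simp_all add: rw_lipschitz del: flow.simps, simp)

lemma wdist_add: "wdist (n + m) u v = (\<integral>ys. wdist m (rw n u ys) (rw n v ys) \<partial>S)"
proof (induction n arbitrary: u v)
  case 0
  then show ?case using S.prob_space by simp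
next
  case (Suc n)
  have "\<bar>wdist m (rw (Suc n) u ys) (rw (Suc n) v ys)\<bar> \<le> \<bar>u - v\<bar>" for ys
    using wdist_nonneg order_trans[OF wdist_le rw_lipschitz] by (simp del: flow.simps)
  then have "(\<integral>ys. wdist m (rw (Suc n) u ys) (rw (Suc n) v ys) \<partial>S) =
      (\<integral>y. \<integral>ys. wdist m (rw n \<bar>u - c y\<bar> ys) (rw n \<bar>v - c y\<bar> ys) \<partial>S \<partial>\<mu>)"
    by (subst integral_Stream[where B="\<bar>u - v\<bar>"]) (simp_all del: flow.simps, simp)
  also have "\<dots> = wdist (Suc (n + m)) u v" by (simp add: Suc[symmetric] wdist_Suc)
  finally show ?case by simp
qed

lemma ldist_flow: "ldist u v = (\<integral>ys. ldist (rw n u ys) (rw n v ys) \<partial>S)"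
proof (rule LIMSEQ_unique)
  show "(\<lambda>m. wdist (n + m) u v) \<longlonglongrightarrow> ldist u v"
    using LIMSEQ_ignore_initial_segment[OF wdist_tendsto[of u v], of n] by (simp add: add.commute)
  show "(\<lambda>m. wdist (n + m) u v) \<longlonglongrightarrow> (\<integral>ys. ldist (rw n u ys) (rw n v ys) \<partial>S)"
    unfolding wdist_add
  proof (rule integral_dominated_convergence[where w="\<lambda>_. \<bar>u - v\<bar>"])
    show "AE ys in S. norm (wdist m (rw n u ys) (rw n v ys)) \<le> \<bar>u - v\<bar>" for m
      using wdist_nonneg order_trans[OF wdist_le rw_lipschitz] by simp
  qed (simp_all add: wdist_tendsto)
qed

lemma ldist_step: "ldist u v = (\<integral>y. ldist \<bar>u - c y\<bar> \<bar>v - c y\<bar> \<partial>\<mu>)"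
proof -
  have "\<bar>ldist (rw (Suc 0) u ys) (rw (Suc 0) v ys)\<bar> \<le> \<bar>u - v\<bar>" for ys
    using ldist_nonneg order_trans[OF ldist_le rw_lipschitz] by (simp del: flow.simps)
  then have "(\<integral>ys. ldist (rw (Suc 0) u ys) (rw (Suc 0) v ys) \<partial>S) = (\<integral>y. \<integral>ys. ldist \<bar>u - c y\<bar> \<bar>v - c y\<bar> \<partial>S \<partial>\<mu>)"
    by (subst integral_Stream[where B="\<bar>u - v\<bar>"]) (simp_all del: flow.simps, simp)
  also have "\<dots> = (\<integral>y. ldist \<bar>u - c y\<bar> \<bar>v - c y\<bar> \<partial>\<mu>)" using S.prob_space by simp
  finally show ?thesis using ldist_flow[of u v "Suc 0"] by simp
qed

text \<open>Support of the law of \<open>c\<close>, expressed on the space of increments;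
  \<open>esupp_eq\<close> identifies it with the support of a marginal.\<close>

definition esupp :: "real set" where
  "esupp = {s. \<forall>Q. open Q \<longrightarrow> s \<in> Q \<longrightarrow> emeasure \<mu> {y. c y \<in> Q} > 0}"

text \<open>By \<open>ldist_step\<close> the nonnegative loss \<open>h\<close> has mean 0; it
  vanishes almost surely, and by continuity at every point of the support.\<close>

lemma rigid_step:
  assumes rigid: "ldist u v = \<bar>u - v\<bar>" and s: "s \<in> esupp"
  shows "\<bar>\<bar>u - s\<bar> - \<bar>v - s\<bar>\<bar> = \<bar>u - v\<bar>" "ldist \<bar>u - s\<bar> \<bar>v - s\<bar> = \<bar>u - v\<bar>"
proof -
  define h where "h s = \<bar>u - v\<bar> - ldist \<bar>u - s\<bar> \<bar>v - s\<bar>" for s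
  have contr: "\<bar>\<bar>u - s\<bar> - \<bar>v - s\<bar>\<bar> \<le> \<bar>u - v\<bar>" for s by linarith
  have h_nonneg: "0 \<le> h s" for s using ldist_le[of "\<bar>u - s\<bar>" "\<bar>v - s\<bar>"] contr[of s] by (simp add: h_def)
  have h_cont: "continuous_on UNIV h"
    unfolding h_def
    by (intro continuous_intros continuous_on_compose2[OF continuous_ldist, of _ "\<lambda>s. (\<bar>u - s\<bar>, \<bar>v - s\<bar>)", simplified])
  have [measurable]: "(\<lambda>y. h (c y)) \<in> borel_measurable \<mu>"
    using measurable_compose[OF c_meas' borel_measurable_continuous_onI[OF h_cont]] .
  have int: "integrable \<mu> (\<lambda>y. ldist \<bar>u - c y\<bar> \<bar>v - c y\<bar>)"
    using ldist_nonneg order_trans[OF ldist_le contr]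
    by (intro integrable_const_bound[of _ "\<bar>u - v\<bar>"]) auto
  have "(\<integral>y. h (c y) \<partial>\<mu>) = 0"
    unfolding h_def using int rigid ldist_step[of u v] prob_space
    by (subst Bochner_Integration.integral_diff) auto
  moreover have "integrable \<mu> (\<lambda>y. h (c y))" unfolding h_def using int by simp
  ultimately have AE0: "AE y in \<mu>. h (c y) = 0"
    using integral_nonneg_eq_0_iff_AE[of \<mu> "\<lambda>y. h (c y)"] h_nonneg by simp
  have "h s = 0"
  proof (rule ccontr)
    assume "h s \<noteq> 0"
    then have "s \<in> {s. 0 < h s}" using h_nonneg[of s] by simp
    moreover have "open {s. 0 < h s}" by (intro open_Collect_less h_cont continuous_intros)
    ultimately have "emeasure \<mu> {y. c y \<in> {s. 0 < h s}} > 0" using s by (auto simp: esupp_def)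
    moreover have "AE y in \<mu>. y \<notin> {y. c y \<in> {s. 0 < h s}}" using AE0 by eventually_elim simp
    then have "emeasure \<mu> {y. c y \<in> {s. 0 < h s}} = 0"
      by (subst (asm) AE_iff_measurable[OF _ refl]) auto
    ultimately show False by simp
  qed
  then show "ldist \<bar>u - s\<bar> \<bar>v - s\<bar> = \<bar>u - v\<bar>" by (simp add: h_def)
  with ldist_le[of "\<bar>u - s\<bar>" "\<bar>v - s\<bar>"] contr[of s] show "\<bar>\<bar>u - s\<bar> - \<bar>v - s\<bar>\<bar> = \<bar>u - v\<bar>" by simp
qed

lemma rigid_gap:
  assumes rigid: "ldist u v = \<bar>u - v\<bar>" and uv: "0 \<le> u" "0 \<le> v" "u \<noteq> v" and t: "t \<in> esupp" "0 < t"
  shows "\<exists>G. 0 \<in> G \<and> (\<forall>x\<in>G. \<forall>y\<in>G. x - y \<in> G) \<and> esupp \<subseteq> G \<and> (\<forall>g\<in>G. 0 < g \<longrightarrow> \<bar>u - v\<bar> \<le> g)"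
proof -
  let ?d = "\<bar>u - v\<bar>"
  \<comment> \<open>The lower points of the rigid pairs at distance \<open>?d\<close>. An increment
    beyond both points reverses their order, so the new lower point is
    \<open>y - ?d - w\<close>.\<close>
  let ?U = "{w. 0 \<le> w \<and> ldist w (w + ?d) = ?d}"
  have "min u v + ?d = max u v" by auto
  then have u0: "min u v \<in> ?U"
    using rigid uv ldist_commute[of u v] by (auto simp: min_def max_def split: if_splits)
  show ?thesis
  proof (rule rigid_pairs_gap[OF u0 _ t])
    fix w y assume w: "w \<in> ?U" and y: "y \<in> esupp"
    then have r: "\<bar>\<bar>w - y\<bar> - \<bar>w + ?d - y\<bar>\<bar> = ?d" "ldist \<bar>w - y\<bar> \<bar>w + ?d - y\<bar> = ?d"
      using rigid_step[of w "w + ?d" y] by auto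
    show "y \<le> w \<or> w + ?d \<le> y" using r(1) uv(3) by linarith
    show "w - y \<in> ?U" if "y \<le> w" using r(2) that by (simp add: algebra_simps)
    show "y - ?d - w \<in> ?U" if le: "w + ?d \<le> y"
    proof -
      have "\<bar>w - y\<bar> = y - w" "\<bar>w + ?d - y\<bar> = y - ?d - w" using le by linarith+
      with r(2) have "ldist (y - w) (y - ?d - w) = ?d" by simp
      then show ?thesis using le ldist_commute[of "y - w"] by (simp add: algebra_simps)
    qed
  qed (use uv in auto)
qed

lemma strict_non_lattice:
  assumes nl: "\<not> (\<exists>\<kappa>>0. esupp \<subseteq> range (\<lambda>k::int. \<kappa> * of_int k))"
    and uv: "0 \<le> u" "0 \<le> v" "u \<noteq> v" and t: "t \<in> esupp" "0 < t"
  shows "ldist u v < \<bar>u - v\<bar>"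
proof (rule ccontr)
  assume "\<not> ?thesis"
  then have "ldist u v = \<bar>u - v\<bar>" using ldist_le[of u v] by simp
  from rigid_gap[OF this uv t] obtain G where G: "0 \<in> G" "\<forall>x\<in>G. \<forall>y\<in>G. x - y \<in> G"
    "esupp \<subseteq> G" "\<forall>g\<in>G. 0 < g \<longrightarrow> \<bar>u - v\<bar> \<le> g" by blast
  then obtain \<kappa> where "\<kappa> > 0" "G \<subseteq> range (\<lambda>k::int. \<kappa> * of_int k)"
    using real_subgroup_cyclic[of G t "\<bar>u - v\<bar>"] subsetD[OF G(3) t(1)] t uv by auto
  then show False using nl G(3) by blast
qed

text \<open>Gcd 1 forces the group from \<open>rigid_gap\<close> to contain 1, so its gap cannot
  exceed 1. Distance 1 has to be left out: integer walks keep the parity of their difference, so two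
  integers at distance 1 never get closer.\<close>

lemma strict_lattice:
  assumes int: "esupp \<subseteq> \<int>" and gcd: "Gcd {k::int. of_int k \<in> esupp} = 1"
    and uv: "0 \<le> u" "0 \<le> v" "1 < \<bar>u - v\<bar>" and t: "t \<in> esupp" "0 < t"
  shows "ldist u v < \<bar>u - v\<bar>"
proof (rule ccontr)
  assume "\<not> ?thesis"
  then have r: "ldist u v = \<bar>u - v\<bar>" using ldist_le[of u v] by simp
  have "u \<noteq> v" using uv by auto
  from rigid_gap[OF r uv(1,2) this t] obtain G where G: "0 \<in> G" "\<forall>x\<in>G. \<forall>y\<in>G. x - y \<in> G"
    "esupp \<subseteq> G" "\<forall>g\<in>G. 0 < g \<longrightarrow> \<bar>u - v\<bar> \<le> g" by blast
  have "\<exists>\<kappa>>0. \<kappa> \<in> G \<inter> \<int> \<and> G \<inter> \<int> \<subseteq> range (\<lambda>k::int. \<kappa> * of_int k)"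
    using G t int uv by (intro real_subgroup_cyclic[of _ t "\<bar>u - v\<bar>"]) auto
  then obtain \<kappa> where \<kappa>: "\<kappa> > 0" "\<kappa> \<in> G" "\<kappa> \<in> \<int>" "G \<inter> \<int> \<subseteq> range (\<lambda>k::int. \<kappa> * of_int k)" by auto
  from \<kappa>(3) obtain m :: int where m: "\<kappa> = of_int m" by (auto elim: Ints_cases)
  have "m dvd k" if k: "of_int k \<in> esupp" for k
  proof -
    have "of_int k \<in> G \<inter> \<int>" using k G(3) by auto
    then have "of_int k \<in> range (\<lambda>k::int. \<kappa> * of_int k)" by (rule subsetD[OF \<kappa>(4)])
    then obtain l :: int where "of_int k = \<kappa> * of_int l" by (rule rangeE)
    then have "k = m * l" unfolding m by (metis of_int_eq_iff of_int_mult)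
    then show ?thesis by simp
  qed
  then have "m dvd 1" unfolding gcd[symmetric] by (intro Gcd_greatest) auto
  then have "\<kappa> = 1" using m \<kappa>(1) by (simp add: zdvd1_eq)
  then show False using G(4) \<kappa>(2) uv(3) by fastforce
qed

text \<open>The expected distance still to be lost after time \<open>n\<close> is
  \<open>wdist n u v - ldist u v\<close>, which tends to 0. On the compact set of bounded pairs in
  \<open>A\<close> at distance at least \<open>\<epsilon>\<close> this loss is bounded below, so the
  walks are rarely there; tightness disposes of the unbounded pairs.\<close>

lemma contraction_prob:
  assumes A: "closed A" and A_nonneg: "\<And>u v. (u, v) \<in> A \<Longrightarrow> 0 \<le> u \<and> 0 \<le> v"
    and A_strict: "\<And>u v. (u, v) \<in> A \<Longrightarrow> u \<noteq> v \<Longrightarrow> ldist u v < \<bar>u - v\<bar>"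
    and uv: "\<And>n. AE ys in S. (rw n u ys, rw n v ys) \<in> A"
    and tight: "\<And>x \<epsilon>. 0 < \<epsilon> \<Longrightarrow> \<exists>K. \<forall>n. emeasure S {ys. K < rw n x ys} < \<epsilon>"
    and \<epsilon>: "0 < \<epsilon>"
  shows "(\<lambda>n. measure S {ys. \<epsilon> \<le> \<bar>rw n u ys - rw n v ys\<bar>}) \<longlonglongrightarrow> 0"
proof (rule LIMSEQ_I)
  let ?far = "\<lambda>n. {ys. \<epsilon> \<le> \<bar>rw n u ys - rw n v ys\<bar>}"
  fix r :: real assume r: "0 < r"
  obtain K1 K2 where K1: "\<And>n. emeasure S {ys. K1 < rw n u ys} < ennreal (r / 3)"
    and K2: "\<And>n. emeasure S {ys. K2 < rw n v ys} < ennreal (r / 3)"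
    using tight[of "ennreal (r / 3)"] r by (metis divide_pos_pos ennreal_less_zero_iff zero_less_numeral)
  let ?Q = "{p \<in> A. fst p \<le> K1 \<and> snd p \<le> K2 \<and> \<epsilon> \<le> \<bar>fst p - snd p\<bar>}"
  let ?g = "\<lambda>p. \<bar>fst p - snd p\<bar> - ldist (fst p) (snd p)"
  have "closed ?Q"
    unfolding Collect_conj_eq Collect_mem_eq
    by (intro closed_Int A closed_Collect_le continuous_intros)
  moreover have "bounded ?Q"
    by (rule bounded_subset[of "cbox (0, 0) (K1, K2)"]) (auto dest: A_nonneg)
  ultimately have "compact ?Q" by (simp add: compact_eq_bounded_closed)
  moreover have "continuous_on ?Q ?g"
    by (intro continuous_intros continuous_on_subset[OF continuous_ldist]) auto
  moreover have "0 < ?g p" if "p \<in> ?Q" for p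
    using A_strict[of "fst p" "snd p"] that \<epsilon> by auto
  \<comment> \<open>An empty \<open>?Q\<close> admits any \<open>\<eta>\<close>; otherwise the
    continuous loss attains a positive minimum.\<close>
  ultimately obtain \<eta> where \<eta>: "0 < \<eta>" "\<And>p. p \<in> ?Q \<Longrightarrow> \<eta> \<le> ?g p"
    by (cases "?Q = {}") (use continuous_attains_inf[of ?Q ?g] zero_less_one in \<open>blast+\<close>)
  have g_nonneg: "0 \<le> ?g p" for p using ldist_le[of "fst p" "snd p"] by simp
  have int_l: "integrable S (\<lambda>ys. ldist (rw n u ys) (rw n v ys))" for n
    using ldist_nonneg order_trans[OF ldist_le rw_lipschitz]
    by (intro S.integrable_const_bound[of _ "\<bar>u - v\<bar>"]) auto
  have meas_n [measurable]: "(?far n) \<in> sets S" "{ys. K1 < rw n u ys} \<in> sets S" "{ys. K2 < rw n v ys} \<in> sets S"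
    "{ys. \<eta> \<le> ?g (rw n u ys, rw n v ys)} \<in> sets S" for n
    by (intro sets_Collect_S; measurable)+
  have bound: "measure S (?far n) < (wdist n u v - ldist u v) / \<eta> + 2 * r / 3" for n
  proof -
    have "measure S (?far n) \<le>
      measure S ({ys. \<eta> \<le> ?g (rw n u ys, rw n v ys)} \<union> ({ys. K1 < rw n u ys} \<union> {ys. K2 < rw n v ys}))"
    proof (rule S.finite_measure_mono_AE)
      show "AE ys in S. ys \<in> (?far n) \<longrightarrow>
        ys \<in> {ys. \<eta> \<le> ?g (rw n u ys, rw n v ys)} \<union> ({ys. K1 < rw n u ys} \<union> {ys. K2 < rw n v ys})"
        using uv[of n] by eventually_elim (use \<eta>(2) in force)
    qed (intro sets.Un meas_n)
    also have "\<dots> \<le> measure S {ys. \<eta> \<le> ?g (rw n u ys, rw n v ys)} + (measure S {ys. K1 < rw n u ys} + measure S {ys. K2 < rw n v ys})"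
      by (intro order_trans[OF measure_Un_le] add_left_mono meas_n sets.Un order_refl)
    also have "measure S {ys. K1 < rw n u ys} < r / 3"
      using K1[of n] r by (simp add: S.emeasure_eq_measure ennreal_less_iff)
    also have "measure S {ys. K2 < rw n v ys} < r / 3"
      using K2[of n] r by (simp add: S.emeasure_eq_measure ennreal_less_iff)
    also have "measure S {ys. \<eta> \<le> ?g (rw n u ys, rw n v ys)} \<le> (\<integral>ys. ?g (rw n u ys, rw n v ys) \<partial>S) / \<eta>"
    proof -
      have "measure S {ys \<in> space S. \<eta> \<le> ?g (rw n u ys, rw n v ys)} \<le> (\<integral>ys. ?g (rw n u ys, rw n v ys) \<partial>S) / \<eta>"
        using int_l[of n] rw_dist_integrable[of n u v] ldist_le \<eta>(1)
        by (intro integral_Markov_inequality_measure[where A="{}"] AE_I2) auto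
      then show ?thesis by simp
    qed
    also have "(\<integral>ys. ?g (rw n u ys, rw n v ys) \<partial>S) = wdist n u v - ldist u v"
      using int_l[of n] rw_dist_integrable[of n u v] ldist_flow[of u v n]
      by (simp add: wdist_def)
    finally show ?thesis by simp
  qed
  have "(\<lambda>n. (wdist n u v - ldist u v) / \<eta>) \<longlonglongrightarrow> (ldist u v - ldist u v) / \<eta>"
    by (intro tendsto_intros wdist_tendsto) (use \<eta> in auto)
  then have "eventually (\<lambda>n. (wdist n u v - ldist u v) / \<eta> < r / 3) sequentially"
    using r by (intro order_tendstoD(2)) auto
  then have "eventually (\<lambda>n. measure S (?far n) < r) sequentially"
  proof eventually_elim
    case (elim n)
    then show ?case using bound[of n] by linarith
  qed
  then show "\<exists>N. \<forall>n\<ge>N. norm (measure S (?far n) - 0) < r"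
    by (simp add: eventually_sequentially)
qed

text \<open>Distances never increase, so being small once means staying small, and convergence in
  probability already implies almost sure convergence.\<close>

lemma contraction_AE:
  assumes lim: "\<And>\<epsilon>. 0 < \<epsilon> \<Longrightarrow> (\<lambda>n. measure S {ys. \<epsilon> \<le> \<bar>rw n u ys - rw n v ys\<bar>}) \<longlonglongrightarrow> 0"
  shows "AE ys in S. (\<lambda>n. \<bar>rw n u ys - rw n v ys\<bar>) \<longlonglongrightarrow> 0"
proof -
  have meas_n [measurable]: "{ys. \<epsilon> \<le> \<bar>rw n u ys - rw n v ys\<bar>} \<in> sets S" for n \<epsilon>
    by (intro sets_Collect_S) measurable
  have "AE ys in S. \<forall>k::nat. \<exists>n. \<bar>rw n u ys - rw n v ys\<bar> < 1 / Suc k"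
    unfolding AE_all_countable
  proof
    fix k :: nat
    let ?E = "\<Inter>n. {ys. 1 / Suc k \<le> \<bar>rw n u ys - rw n v ys\<bar>}"
    have E: "?E \<in> sets S" by (intro sets.countable_INT) auto
    have "measure S ?E \<le> 0"
      by (rule LIMSEQ_le_const[OF lim[of "1 / Suc k"]]) (auto intro!: S.finite_measure_mono)
    then have "emeasure S ?E = 0"
      using measure_nonneg[of S ?E] by (simp add: S.emeasure_eq_measure del: measure_nonneg)
    then have "AE ys in S. ys \<notin> ?E" using E by (intro AE_not_in) (auto simp: null_sets_def)
    then show "AE ys in S. \<exists>n. \<bar>rw n u ys - rw n v ys\<bar> < 1 / Suc k"
      by eventually_elim (auto simp: not_le)
  qed
  then show ?thesis
  proof eventually_elim
    case (elim ys)
    show ?case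
    proof (rule LIMSEQ_I)
      fix r :: real assume "0 < r"
      then obtain k where "inverse (real (Suc k)) < r" using reals_Archimedean by blast
      moreover obtain n where "\<bar>rw n u ys - rw n v ys\<bar> < 1 / Suc k" using elim by blast
      ultimately have "\<bar>rw n u ys - rw n v ys\<bar> < r" by (simp add: inverse_eq_divide)
      then have "norm (\<bar>rw m u ys - rw m v ys\<bar> - 0) < r" if "n \<le> m" for m
        using rw_dist_mono[OF that, of u ys v] by simp
      then show "\<exists>no. \<forall>n\<ge>no. norm (\<bar>rw n u ys - rw n v ys\<bar> - 0) < r" by blast
    qed
  qed
qed

end

section \<open>Parities\<close>

locale parity_space =
  fixes D :: "'n::finite set"
begin

abbreviation G where "G \<equiv> parity_group D"

lemma carrier_parity_group: "carrier G = (\<Pi>\<^sub>E i\<in>D. {0..<2})"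
  by (simp add: parity_group_def integer_mod_group_def)

lemma finite_carrier_parity_group: "finite (carrier G)"
  unfolding carrier_parity_group by (intro finite_PiE) auto

lemma mult_parity_group: "g \<otimes>\<^bsub>G\<^esub> h = (\<lambda>i\<in>D. (g i + h i) mod 2)"
  by (simp add: parity_group_def product_group_def integer_mod_group_def)

lemma one_parity_group: "\<one>\<^bsub>G\<^esub> = (\<lambda>i\<in>D. 0)"
  by (simp add: parity_group_def product_group_def integer_mod_group_def)

lemma comm_group_parity_group: "comm_group G"
proof (rule group.group_comm_groupI)
  show "group G" unfolding parity_group_def by (rule product_group) simp
qed (simp add: mult_parity_group add.commute)

sublocale G: comm_group G by (rule comm_group_parity_group)

lemma parity_self_mult: "g \<in> carrier G \<Longrightarrow> g \<otimes>\<^bsub>G\<^esub> g = \<one>\<^bsub>G\<^esub>"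
  by (auto simp: mult_parity_group one_parity_group fun_eq_iff)

lemma parity_self_inv: "g \<in> carrier G \<Longrightarrow> inv\<^bsub>G\<^esub> g = g"
  using parity_self_mult[of g] by (intro G.inv_equality) auto

lemma parity_mult_cancel: "g \<in> carrier G \<Longrightarrow> h \<in> carrier G \<Longrightarrow> (g \<otimes>\<^bsub>G\<^esub> h) \<otimes>\<^bsub>G\<^esub> h = g"
  by (simp add: G.m_assoc parity_self_mult)

lemma parity_mult_eq_iff:
  assumes "g \<in> carrier G" "h \<in> carrier G" "k \<in> carrier G"
  shows "g \<otimes>\<^bsub>G\<^esub> h = k \<longleftrightarrow> g = k \<otimes>\<^bsub>G\<^esub> h"
  using assms parity_mult_cancel by metis

lemma parity_in_carrier:
  fixes x :: "real ^ 'n"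
  shows "parity D x \<in> carrier G"
  by (auto simp: parity_def carrier_parity_group)

definition parity_point :: "('n \<Rightarrow> int) \<Rightarrow> real ^ 'n" where
  "parity_point g = (\<chi> i. if i \<in> D then of_int (g i) else 0)"

lemma parity_point:
  assumes "g \<in> carrier G"
  shows "parity D (parity_point g) = g" "parity_point g \<in> state_space D"
proof -
  have g: "g i \<in> {0..<2}" if "i \<in> D" for i
    using assms that by (auto simp: carrier_parity_group)
  show "parity D (parity_point g) = g"
  proof
    fix i
    show "parity D (parity_point g) i = g i"
      using assms g[of i] by (auto simp: parity_def parity_point_def carrier_parity_group PiE_def extensional_def)
  qed
  have "real_of_int (g i) \<in> \<nat>" if "i \<in> D" for i
    using g[OF that] by (metis atLeastLessThan_iff nonneg_int_cases of_int_of_nat_eq of_nat_in_Nats)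
  then show "parity_point g \<in> state_space D"
    by (auto simp: state_space_def coord_space_def parity_point_def)
qed

text \<open>Signs do not matter modulo 2, so a reflected step adds parities; on integer coordinates
  the floor is exact.\<close>

lemma parity_step:
  fixes x y :: "real ^ 'n"
  assumes x: "x \<in> state_space D" and y: "\<forall>i\<in>D. y $ i \<in> \<int>"
  shows "parity D \<bar>x - y\<bar> = parity D x \<otimes>\<^bsub>G\<^esub> parity D y" and "\<bar>x - y\<bar> \<in> state_space D"
proof -
  have ints: "\<exists>k l::int. x $ i = of_int k \<and> y $ i = of_int l" if "i \<in> D" for i
  proof -
    have "x $ i \<in> coord_space D i" using x by (simp add: state_space_def)
    then have "x $ i \<in> \<int>" using that Nats_subset_Ints by (auto simp: coord_space_def)
    then show ?thesis using y that by (meson Ints_cases)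
  qed
  show "parity D \<bar>x - y\<bar> = parity D x \<otimes>\<^bsub>G\<^esub> parity D y"
  proof
    fix i
    show "parity D \<bar>x - y\<bar> i = (parity D x \<otimes>\<^bsub>G\<^esub> parity D y) i"
    proof (cases "i \<in> D")
      case True
      then obtain k l :: int where kl: "x $ i = of_int k" "y $ i = of_int l" using ints by blast
      have "\<lfloor>\<bar>x - y\<bar> $ i\<rfloor> = \<bar>k - l\<bar>"
        by (simp add: abs_vec_def kl flip: of_int_diff of_int_abs)
      moreover have "\<bar>k - l\<bar> mod 2 = (k mod 2 + l mod 2) mod 2" by presburger
      ultimately show ?thesis using True by (simp add: parity_def mult_parity_group kl)
    qed (simp add: parity_def mult_parity_group)
  qed
  have "\<bar>x - y\<bar> $ i \<in> coord_space D i" for i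
  proof (cases "i \<in> D")
    case True
    then obtain k l :: int where kl: "x $ i = of_int k" "y $ i = of_int l" using ints by blast
    have "\<bar>x - y\<bar> $ i = real (nat \<bar>k - l\<bar>)"
      by (simp add: abs_vec_def kl flip: of_int_diff of_int_abs)
    then have "\<bar>x - y\<bar> $ i \<in> \<nat>" by (simp only: of_nat_in_Nats)
    then show ?thesis using True by (simp add: coord_space_def)
  qed (simp add: coord_space_def abs_vec_def)
  then show "\<bar>x - y\<bar> \<in> state_space D" by (simp add: state_space_def)
qed

definition cell :: "('n \<Rightarrow> int) \<Rightarrow> (real ^ 'n) set" where
  "cell g = {x \<in> state_space D. parity D x = g}"

text \<open>The floor is discontinuous, but the coordinates in \<open>D\<close> run through sets of
  natural numbers, which are closed. A \<open>g\<close> that is not extensional is no parity, and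
  its cell is empty.\<close>

lemma closed_cell: "closed (cell g :: (real ^ 'n) set)"
proof (cases "g \<in> extensional D")
  case True
  let ?A = "\<lambda>i. if i \<in> D then of_nat ` {k. int k mod 2 = g i} else {0::real..}"
  have closed: "closed (?A i)" for i by (auto intro: closed_of_nat_image)
  have "cell g = (\<Inter>i. (\<lambda>x. x $ i) -` ?A i)"
  proof (rule subset_antisym; rule subsetI)
    fix x :: "real ^ 'n" assume x: "x \<in> cell g"
    have "x $ i \<in> ?A i" for i
    proof (cases "i \<in> D")
      case i: True
      have "x $ i \<in> coord_space D i" using x by (simp add: cell_def state_space_def)
      then obtain k where k: "x $ i = real k"
        using i by (auto simp: coord_space_def elim: Nats_cases)
      have "parity D x i = g i" using x by (simp add: cell_def)
      then have "int k mod 2 = g i" using i by (simp add: parity_def k)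
      then show ?thesis using i k by auto
    next
      case False
      then show ?thesis using x by (auto simp: cell_def state_space_def coord_space_def dest: spec[of _ i])
    qed
    then show "x \<in> (\<Inter>i. (\<lambda>x. x $ i) -` ?A i)" by blast
  next
    fix x :: "real ^ 'n" assume "x \<in> (\<Inter>i. (\<lambda>x. x $ i) -` ?A i)"
    then have x: "x $ i \<in> ?A i" for i by blast
    have "parity D x i = g i" for i
    proof (cases "i \<in> D")
      case i: True
      then obtain k where "x $ i = real k" "int k mod 2 = g i" using x[of i] by auto
      then show ?thesis using i by (simp add: parity_def)
    next
      case False
      then show ?thesis using True by (simp add: parity_def extensional_def)
    qed
    moreover have "x $ i \<in> coord_space D i" for i using x[of i] by (auto simp: coord_space_def)
    ultimately show "x \<in> cell g" by (auto simp: cell_def state_space_def)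
  qed
  moreover have "closed (\<Inter>i. (\<lambda>x::real ^ 'n. x $ i) -` ?A i)"
    by (intro closed_INT ballI closed_vimage closed continuous_intros)
  ultimately show ?thesis by simp
next
  case False
  then have "cell g = ({} :: (real ^ 'n) set)" by (auto simp: cell_def parity_def)
  then show ?thesis by simp
qed

end

section \<open>The walk in several dimensions\<close>

lemma abs_vec_meas [measurable]:
  "case_prod (\<lambda>x y :: real ^ 'n. \<bar>x - y\<bar>) \<in> measurable (borel \<Otimes>\<^sub>M borel) borel"
proof -
  have "continuous_on UNIV (\<lambda>p::(real ^ 'n) \<times> (real ^ 'n). \<bar>fst p - snd p\<bar>)"
    unfolding abs_vec_def by (intro continuous_intros)
  from borel_measurable_continuous_onI[OF this] show ?thesis
    by (simp add: borel_prod case_prod_beta')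
qed

lemma abs_vec_compose [measurable (raw)]:
  fixes f g :: "'z \<Rightarrow> real ^ 'n"
  assumes "f \<in> borel_measurable N" "g \<in> borel_measurable N"
  shows "(\<lambda>x. \<bar>f x - g x\<bar>) \<in> borel_measurable N"
  using measurable_compose[OF measurable_Pair[OF assms] abs_vec_meas] by simp

lemma abs_vec_dist: "dist \<bar>x - z\<bar> \<bar>y - z\<bar> \<le> dist x y" for x y z :: "real ^ 'n"
  unfolding dist_norm
proof (rule norm_le_componentwise_cart)
  fix i
  have "\<bar>\<bar>x $ i - z $ i\<bar> - \<bar>y $ i - z $ i\<bar>\<bar> \<le> \<bar>x $ i - y $ i\<bar>" by linarith
  then show "norm ((\<bar>x - z\<bar> - \<bar>y - z\<bar>) $ i) \<le> norm ((x - y) $ i)" by (simp add: abs_vec_def)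
qed

text \<open>By second countability the complement of the support is a union of countably many basic
  open null sets.\<close>

lemma null_outside_supp:
  fixes \<nu> :: "'a::second_countable_topology measure"
  assumes [simp, measurable_cong]: "sets \<nu> = sets borel"
  shows "\<exists>N\<in>null_sets \<nu>. - supp \<nu> = N"
proof -
  obtain B :: "'a set set" where B: "countable B" "topological_basis B"
    using ex_countable_basis by auto
  let ?B = "{b \<in> B. emeasure \<nu> b = 0}"
  have op: "open b" if "b \<in> B" for b using B that by (simp add: topological_basis_open)
  have "\<Union>?B \<in> null_sets \<nu>"
    using B op by (intro null_sets_UN'[where N="\<lambda>b. b", simplified]) (auto simp: null_sets_def)
  moreover have "- supp \<nu> = \<Union>?B"
  proof (intro equalityI subsetI)
    fix x assume "x \<in> - supp \<nu>"
    then obtain U where U: "open U" "x \<in> U" "emeasure \<nu> U = 0"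
      by (auto simp: supp_def not_less)
    obtain b where b: "b \<in> B" "x \<in> b" "b \<subseteq> U"
      using topological_basisE[OF B(2) U(1,2)] by blast
    have "emeasure \<nu> b \<le> emeasure \<nu> U" using U(1) by (intro emeasure_mono b(3)) simp
    then show "x \<in> \<Union>?B" using U b by auto
  next
    fix x assume "x \<in> \<Union>?B"
    then obtain b where "b \<in> B" "x \<in> b" "emeasure \<nu> b = 0" by auto
    then show "x \<in> - supp \<nu>" using op by (auto simp: supp_def intro!: exI[of _ b])
  qed
  ultimately show ?thesis by blast
qed

lemma supp_meets_open:
  fixes \<nu> :: "'a::second_countable_topology measure"
  assumes s: "sets \<nu> = sets borel" and U: "open U" "emeasure \<nu> U > 0"
  shows "\<exists>t. t \<in> supp \<nu> \<and> t \<in> U"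
proof (rule ccontr)
  assume none: "\<not> ?thesis"
  obtain N where N: "N \<in> null_sets \<nu>" "- supp \<nu> = N" using null_outside_supp[OF s] by blast
  have "U \<in> sets \<nu>" using U by (simp add: s)
  then have "U \<in> null_sets \<nu>" using null_sets_subset[OF N(1)] none N(2) by blast
  then show False using U(2) by (simp add: null_sets_def)
qed

text \<open>\<open>hit\<close> is the form in which positive recurrence of the coordinates enters;
  since a coordinate started at 0 stays nonnegative, \<open>{..<a}\<close> amounts to
  \<open>[0, a)\<close>.\<close>

locale refl_law = noise \<mu> + parity_space D for \<mu> :: "(real ^ 'n) measure" and D :: "'n set" +
  assumes int_law: "AE y in \<mu>. \<forall>i\<in>D. y $ i \<in> \<int>"
    and pos: "\<And>i. emeasure (marginal \<mu> i) {0<..} > 0"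
    and int_supp: "\<And>i. i \<in> D \<Longrightarrow> supp (marginal \<mu> i) \<subseteq> \<int>"
    and gcd_supp: "\<And>i. i \<in> D \<Longrightarrow> Gcd {k::int. of_int k \<in> supp (marginal \<mu> i)} = 1"
    and non_lat: "\<And>i. i \<notin> D \<Longrightarrow> non_lattice (marginal \<mu> i)"
    and hit: "\<And>i a. 0 < a \<Longrightarrow>
      (\<integral>\<^sup>+ys. return_time (\<lambda>n. flow (\<lambda>x y. \<bar>x - y $ i\<bar>) n 0 ys) {..<a} \<partial>stream_space \<mu>) < \<infinity>"
begin

abbreviation X :: "nat \<Rightarrow> real ^ 'n \<Rightarrow> (real ^ 'n) stream \<Rightarrow> real ^ 'n" where
  "X \<equiv> flow (\<lambda>x y. \<bar>x - y\<bar>)"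

abbreviation B :: "nat \<Rightarrow> real ^ 'n \<Rightarrow> (real ^ 'n) stream \<Rightarrow> real ^ 'n" where
  "B \<equiv> back_flow (\<lambda>x y. \<bar>x - y\<bar>)"

lemma X_meas [measurable (raw)]:
  "f \<in> measurable N borel \<Longrightarrow> g \<in> measurable N S \<Longrightarrow> (\<lambda>x. X n (f x) (g x)) \<in> borel_measurable N"
  by (rule measurable_flow[OF abs_vec_meas])

lemma B_meas [measurable (raw)]:
  "f \<in> measurable N borel \<Longrightarrow> g \<in> measurable N S \<Longrightarrow> (\<lambda>x. B n (f x) (g x)) \<in> borel_measurable N"
  by (rule measurable_back_flow[OF abs_vec_meas])

lemma X_dist: "dist (X n x ys) (X n y ys) \<le> dist x y"
  by (induction n arbitrary: x y ys) (auto intro: order_trans[OF _ abs_vec_dist])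

lemma B_dist: "dist (B n x ys) (B n y ys) \<le> dist x y"
  by (induction n arbitrary: ys) (auto intro: order_trans[OF abs_vec_dist])

lemma kernel_eq:
  assumes A: "A \<in> sets borel"
  shows "(\<integral>\<^sup>+y. indicator A \<bar>x - y\<bar> \<partial>\<mu>) = emeasure \<mu> {y. \<bar>x - y\<bar> \<in> A}"
proof -
  have "(\<lambda>y. \<bar>x - y\<bar>) \<in> borel_measurable \<mu>"
    by (rule abs_vec_compose) (simp_all add: measurable_cong_sets[OF sets_noise refl])
  from measurable_sets[OF this A] have "{y. \<bar>x - y\<bar> \<in> A} \<in> sets \<mu>" by (simp add: vimage_def)
  then have "emeasure \<mu> {y. \<bar>x - y\<bar> \<in> A} = (\<integral>\<^sup>+y. indicator {y. \<bar>x - y\<bar> \<in> A} y \<partial>\<mu>)" by simp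
  then show ?thesis by (simp add: indicator_def)
qed

lemma coord: "coord_noise \<mu> (\<lambda>y. y $ i)"
proof
  show "(\<lambda>y::real ^ 'n. y $ i) \<in> borel_measurable borel"
    by (intro borel_measurable_continuous_onI continuous_intros)
qed

lemma nth_meas [measurable]: "(\<lambda>y::real ^ 'n. y $ i) \<in> borel_measurable borel"
  by (intro borel_measurable_continuous_onI continuous_intros)

lemma emeasure_marginal:
  assumes "A \<in> sets borel"
  shows "emeasure (marginal \<mu> i) A = emeasure \<mu> {y. y $ i \<in> A}"
  unfolding marginal_def using assms
  by (subst emeasure_distr) (auto simp: vimage_def measurable_cong_sets[OF sets_noise refl])

lemma esupp_eq: "coord_noise.esupp \<mu> (\<lambda>y. y $ i) = supp (marginal \<mu> i)"
  unfolding coord_noise.esupp_def[OF coord] supp_def by (auto simp: emeasure_marginal)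

lemma supp_pos: "\<exists>t. t \<in> supp (marginal \<mu> i) \<and> 0 < t"
  using supp_meets_open[of "marginal \<mu> i" "{0<..}"] pos[of i] by (auto simp: marginal_def)

lemma tight:
  assumes "0 < \<epsilon>"
  shows "\<exists>K. \<forall>n. emeasure S {ys. K < flow (\<lambda>x y. \<bar>x - y $ i\<bar>) n x ys} < \<epsilon>"
proof -
  interpret C: coord_noise \<mu> "\<lambda>y. y $ i" by (rule coord)
  show ?thesis
  proof (rule C.tight_coord[OF _ hit assms])
    show "emeasure \<mu> {y. 0 < y $ i} > 0"
      using pos[of i] by (simp add: emeasure_marginal)
  qed
qed

lemma AE_int: "AE ys in S. \<forall>n. \<forall>i\<in>D. (ys !! n) $ i \<in> \<int>"
proof -
  have "closed (\<Inter>i\<in>D. (\<lambda>y::real ^ 'n. y $ i) -` \<int>)"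
    by (intro closed_INT ballI closed_vimage closed_Ints continuous_intros)
  then have "(\<Inter>i\<in>D. (\<lambda>y::real ^ 'n. y $ i) -` \<int>) \<in> sets \<mu>" by simp
  moreover have "(\<Inter>i\<in>D. (\<lambda>y::real ^ 'n. y $ i) -` \<int>) = {y. \<forall>i\<in>D. y $ i \<in> \<int>}" by auto
  ultimately have "Measurable.pred \<mu> (\<lambda>y. \<forall>i\<in>D. y $ i \<in> \<int>)" by (simp add: pred_def)
  from AE_stream_all[OF this int_law] show ?thesis
    by eventually_elim (use snth_sset in blast)
qed

lemma even_pairs_step:
  fixes u v y :: real
  assumes "(u - v) / 2 \<in> \<int>" "v \<in> \<int>" "y \<in> \<int>"
  shows "(\<bar>u - y\<bar> - \<bar>v - y\<bar>) / 2 \<in> \<int>" "\<bar>v - y\<bar> \<in> \<int>"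
proof -
  have d: "v - y \<in> \<int>" using assms by simp
  then show "\<bar>v - y\<bar> \<in> \<int>" by simp
  \<comment> \<open>The four sign patterns. If \<open>y\<close> separates the points, the half
    difference changes by the integer \<open>v - y\<close>, up to sign.\<close>
  have "(\<bar>u - y\<bar> - \<bar>v - y\<bar>) / 2 \<in> {(u - v) / 2, - ((u - v) / 2), (u - v) / 2 + (v - y), - ((u - v) / 2 + (v - y))}"
    by (auto simp: abs_if field_simps)
  then show "(\<bar>u - y\<bar> - \<bar>v - y\<bar>) / 2 \<in> \<int>"
    by (elim insertE emptyE) (simp_all only: Ints_minus Ints_add assms(1) d)
qed

lemma contract_coord:
  assumes x: "x \<in> cell g" and y: "y \<in> cell g" and \<epsilon>: "0 < \<epsilon>"
  shows "(\<lambda>n. measure S {ys. \<epsilon> \<le> \<bar>X n x ys $ i - X n y ys $ i\<bar>}) \<longlonglongrightarrow> 0"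
proof -
  interpret C: coord_noise \<mu> "\<lambda>y. y $ i" by (rule coord)
  \<comment> \<open>A closed set that the pair of walks almost surely never leaves. For
    \<open>i \<in> D\<close> it forces an even difference, so distinct points are at distance at
    least 2 and \<open>strict_lattice\<close> applies.\<close>
  let ?A = "{p::real \<times> real. 0 \<le> fst p \<and> 0 \<le> snd p \<and> (i \<in> D \<longrightarrow> (fst p - snd p) / 2 \<in> \<int> \<and> snd p \<in> \<int>)}"
  obtain t where t: "t \<in> C.esupp" "0 < t" using supp_pos[of i] esupp_eq[of i] by auto
  have "(\<lambda>n. measure S {ys. \<epsilon> \<le> \<bar>C.rw n (x $ i) ys - C.rw n (y $ i) ys\<bar>}) \<longlonglongrightarrow> 0"
  proof (rule C.contraction_prob[where A="?A"])
    have "closed ((\<lambda>p::real \<times> real. (fst p - snd p) / 2) -` \<int>)" "closed ((\<lambda>p::real \<times> real. snd p) -` \<int>)"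
      by (intro closed_vimage closed_Ints continuous_intros; simp)+
    then have "closed {p::real \<times> real. (fst p - snd p) / 2 \<in> \<int>}" "closed {p::real \<times> real. snd p \<in> \<int>}"
      by (simp_all add: vimage_def)
    then show "closed ?A"
      unfolding Collect_conj_eq imp_conv_disj Collect_disj_eq
      by (intro closed_Int closed_Un closed_Collect_le continuous_intros) auto
    show "0 \<le> u \<and> 0 \<le> v" if "(u, v) \<in> ?A" for u v using that by simp
    show "C.ldist u v < \<bar>u - v\<bar>" if A: "(u, v) \<in> ?A" and ne: "u \<noteq> v" for u v
    proof (cases "i \<in> D")
      case True
      then obtain k :: int where k: "(u - v) / 2 = of_int k" using A by (auto elim: Ints_cases)
      then have "k \<noteq> 0" using ne by auto
      then have "1 \<le> \<bar>real_of_int k\<bar>" by linarith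
      moreover have "\<bar>u - v\<bar> = 2 * \<bar>real_of_int k\<bar>" unfolding k[symmetric] by simp
      ultimately have "1 < \<bar>u - v\<bar>" by linarith
      then show ?thesis
        using A t int_supp[OF True] gcd_supp[OF True] by (intro C.strict_lattice) (auto simp: esupp_eq)
    next
      case False
      then show ?thesis
        using A t ne non_lat[OF False] by (intro C.strict_non_lattice) (auto simp: esupp_eq non_lattice_def)
    qed
    have start: "(x $ i, y $ i) \<in> ?A"
    proof -
      have c: "x $ i \<in> coord_space D i" "y $ i \<in> coord_space D i" and p: "parity D x = parity D y"
        using x y by (auto simp: cell_def state_space_def)
      have "(x $ i - y $ i) / 2 \<in> \<int> \<and> y $ i \<in> \<int>" if i: "i \<in> D"
      proof -
        obtain k l where kl: "x $ i = of_nat k" "y $ i = of_nat l"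
          using c i by (auto simp: coord_space_def elim!: Nats_cases)
        have "int k mod 2 = int l mod 2" using fun_cong[OF p, of i] i kl by (simp add: parity_def)
        then have "2 dvd (int k - int l)" by (simp add: mod_eq_dvd_iff)
        then obtain m where "int k - int l = 2 * m" by (rule dvdE)
        then have "x $ i - y $ i = 2 * of_int m" unfolding kl
          by (metis of_int_diff of_int_mult of_int_numeral of_int_of_nat_eq)
        then show ?thesis using kl by simp
      qed
      moreover have "0 \<le> x $ i" "0 \<le> y $ i"
        using c by (auto simp: coord_space_def split: if_splits elim!: Nats_cases)
      ultimately show ?thesis by simp
    qed
    show "AE ys in S. (C.rw n (x $ i) ys, C.rw n (y $ i) ys) \<in> ?A" for n
      using AE_int
    proof eventually_elim
      case (elim ys)
      show ?case
      proof (induction n)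
        case (Suc n)
        have "i \<in> D \<Longrightarrow> (ys !! n) $ i \<in> \<int>" using elim by blast
        then show ?case unfolding flow_Suc_right
          using Suc even_pairs_step[of "C.rw n (x $ i) ys" "C.rw n (y $ i) ys" "(ys !! n) $ i"] by auto
      next
        case 0
        show ?case using start by simp
      qed
    qed
    show "\<exists>K. \<forall>n. emeasure S {ys. K < C.rw n z ys} < e" if "0 < e" for z e
      by (rule tight[OF that])
    show "0 < \<epsilon>" by (rule \<epsilon>)
  qed
  then show ?thesis by (simp add: flow_coord)
qed

lemma contract_AE:
  assumes "x \<in> cell g" "y \<in> cell g"
  shows "AE ys in S. (\<lambda>n. dist (X n x ys) (X n y ys)) \<longlonglongrightarrow> 0"
proof -
  have "AE ys in S. \<forall>i\<in>UNIV. (\<lambda>n. \<bar>X n x ys $ i - X n y ys $ i\<bar>) \<longlonglongrightarrow> 0"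
  proof (rule AE_finite_allI)
    fix i
    interpret C: coord_noise \<mu> "\<lambda>y. y $ i" by (rule coord)
    show "AE ys in S. (\<lambda>n. \<bar>X n x ys $ i - X n y ys $ i\<bar>) \<longlonglongrightarrow> 0"
      using C.contraction_AE[of "x $ i" "y $ i"] contract_coord[OF assms, where i=i] by (simp add: flow_coord)
  qed simp
  then show ?thesis
  proof eventually_elim
    case (elim ys)
    have "(\<lambda>n. \<Sum>i\<in>UNIV. \<bar>X n x ys $ i - X n y ys $ i\<bar>) \<longlonglongrightarrow> (\<Sum>i\<in>(UNIV::'n set). 0)"
      using elim by (intro tendsto_sum) auto
    then have lim: "(\<lambda>n. \<Sum>i\<in>UNIV. \<bar>X n x ys $ i - X n y ys $ i\<bar>) \<longlonglongrightarrow> 0" by simp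
    have le: "norm (dist (X n x ys) (X n y ys)) \<le> (\<Sum>i\<in>UNIV. \<bar>X n x ys $ i - X n y ys $ i\<bar>)" for n
      using norm_le_l1_cart[of "X n x ys - X n y ys"] by (simp add: dist_norm)
    show ?case by (rule Lim_null_comparison[OF always_eventually[OF allI[OF le]] lim])
  qed
qed

text \<open>At each fixed time the pair of backward walks has the law of the pair of forward walks,
  so convergence in probability carries over. Almost sure convergence would not, since it involves
  the joint law of all times.\<close>

lemma contract_prob:
  assumes "x \<in> cell g" "y \<in> cell g" "0 < \<epsilon>"
  shows "(\<lambda>n. measure S {ys. \<epsilon> \<le> dist (B n x ys) (B n y ys)}) \<longlonglongrightarrow> 0"
proof -
  let ?c = "\<epsilon> / real CARD('n)"
  let ?E = "\<lambda>n i. {ys. ?c \<le> \<bar>X n x ys $ i - X n y ys $ i\<bar>}"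
  have c: "0 < ?c" using assms(3) by simp
  have eq: "measure S {ys. \<epsilon> \<le> dist (B n x ys) (B n y ys)} = measure S {ys. \<epsilon> \<le> dist (X n x ys) (X n y ys)}" for n
  proof -
    \<comment> \<open>The pair is treated as one walk on the product space, so that time reversal
      applies to the joint law of its components.\<close>
    let ?\<phi> = "\<lambda>p y. (\<bar>fst p - y\<bar>, \<bar>snd p - y\<bar>) :: (real ^ 'n) \<times> (real ^ 'n)"
    have A: "{p::(real ^ 'n) \<times> (real ^ 'n). \<epsilon> \<le> dist (fst p) (snd p)} \<in> sets borel"
      by (intro borel_closed closed_Collect_le continuous_intros)
    have "case_prod ?\<phi> \<in> measurable (borel \<Otimes>\<^sub>M borel) (borel \<Otimes>\<^sub>M borel)"
      by (simp add: case_prod_beta' borel_prod[symmetric])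
    then have \<phi>: "case_prod ?\<phi> \<in> measurable (borel \<Otimes>\<^sub>M borel) borel" by (simp add: borel_prod)
    have bp: "back_flow ?\<phi> n (x, y) ys = (B n x ys, B n y ys)"
      and fp: "flow ?\<phi> n (x, y) ys = (X n x ys, X n y ys)" for ys
      using back_flow_prod[of "\<lambda>x y. \<bar>x - y\<bar>" "\<lambda>x y. \<bar>x - y\<bar>" n "(x, y)" ys]
        flow_prod[of "\<lambda>x y. \<bar>x - y\<bar>" "\<lambda>x y. \<bar>x - y\<bar>" n "(x, y)" ys] by simp_all
    show ?thesis using measure_back_flow[OF \<phi> A, of n "(x, y)"] by (simp add: bp fp)
  qed
  have le: "norm (measure S {ys. \<epsilon> \<le> dist (X n x ys) (X n y ys)}) \<le> (\<Sum>i\<in>UNIV. measure S (?E n i))" for n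
  proof -
    have "{ys. \<epsilon> \<le> dist (X n x ys) (X n y ys)} \<subseteq> (\<Union>i\<in>UNIV. (?E n i))"
    proof (rule subsetI, rule ccontr)
      fix ys assume le: "ys \<in> {ys. \<epsilon> \<le> dist (X n x ys) (X n y ys)}"
        and "ys \<notin> (\<Union>i\<in>UNIV. (?E n i))"
      then have lt: "\<bar>X n x ys $ i - X n y ys $ i\<bar> < ?c" for i by (auto simp: not_le)
      have "dist (X n x ys) (X n y ys) \<le> (\<Sum>i\<in>UNIV. \<bar>X n x ys $ i - X n y ys $ i\<bar>)"
        using norm_le_l1_cart[of "X n x ys - X n y ys"] by (simp add: dist_norm)
      also have "\<dots> < (\<Sum>i\<in>(UNIV::'n set). ?c)" using lt by (intro sum_strict_mono) auto
      also have "\<dots> = \<epsilon>" by simp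
      finally show False using le by simp
    qed
    moreover have m: "(?E n i) \<in> sets S" for i
      by (intro sets_Collect_S) measurable
    ultimately have "measure S {ys. \<epsilon> \<le> dist (X n x ys) (X n y ys)} \<le> measure S (\<Union>i\<in>UNIV. (?E n i))"
      by (intro S.finite_measure_mono sets.finite_UN) auto
    also have "\<dots> \<le> (\<Sum>i\<in>UNIV. measure S (?E n i))"
      using m by (intro measure_UNION_le) auto
    finally show ?thesis by simp
  qed
  have "(\<lambda>n. \<Sum>i\<in>UNIV. measure S (?E n i)) \<longlonglongrightarrow> (\<Sum>i\<in>(UNIV::'n set). 0)"
    by (intro tendsto_sum contract_coord[OF assms(1,2) c])
  then have lim: "(\<lambda>n. \<Sum>i\<in>UNIV. measure S (?E n i)) \<longlonglongrightarrow> 0" by simp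
  show ?thesis unfolding eq by (rule Lim_null_comparison[OF always_eventually[OF allI[OF le]] lim])
qed

lemma tight_vec:
  assumes \<epsilon>: "0 < \<epsilon>"
  shows "\<exists>K. \<forall>n. measure S {ys. K < norm (X n x ys)} < \<epsilon>"
proof -
  let ?e = "ennreal (\<epsilon> / real CARD('n))"
  have "0 < ?e" using \<epsilon> by simp
  then have "\<forall>i. \<exists>K. \<forall>n. emeasure S {ys. K < flow (\<lambda>x y. \<bar>x - y $ i\<bar>) n \<bar>x $ i\<bar> ys} < ?e"
    using tight by blast
  then obtain K where K: "\<And>i n. emeasure S {ys. K i < flow (\<lambda>x y. \<bar>x - y $ i\<bar>) n \<bar>x $ i\<bar> ys} < ?e"
    by metis
  \<comment> \<open>Nonnegativity is preserved only from a nonnegative start; the walks from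
    \<open>x $ i\<close> and \<open>\<bar>x $ i\<bar>\<close> differ by at most
    \<open>2 * \<bar>x $ i\<bar>\<close>.\<close>
  let ?b = "\<lambda>i. K i + 2 * \<bar>x $ i\<bar>"
  have "measure S {ys. (\<Sum>i\<in>UNIV. ?b i) < norm (X n x ys)} < \<epsilon>" for n
  proof -
    let ?E = "\<lambda>i. {ys. K i < flow (\<lambda>x y. \<bar>x - y $ i\<bar>) n \<bar>x $ i\<bar> ys}"
    have "{ys. (\<Sum>i\<in>UNIV. ?b i) < norm (X n x ys)} \<subseteq> (\<Union>i\<in>UNIV. ?E i)"
    proof (rule subsetI, rule ccontr)
      fix ys assume lt: "ys \<in> {ys. (\<Sum>i\<in>UNIV. ?b i) < norm (X n x ys)}" and n: "ys \<notin> (\<Union>i\<in>UNIV. ?E i)"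
      have "\<bar>X n x ys $ i\<bar> \<le> ?b i" for i
      proof -
        interpret C: coord_noise \<mu> "\<lambda>y. y $ i" by (rule coord)
        have "C.rw n \<bar>x $ i\<bar> ys \<le> K i" using n by (auto simp: not_less)
        then show ?thesis
          using C.rw_lipschitz[of n "x $ i" ys "\<bar>x $ i\<bar>"] C.rw_nonneg[of "\<bar>x $ i\<bar>" n ys]
          by (simp add: flow_coord abs_le_iff) linarith
      qed
      then have "norm (X n x ys) \<le> (\<Sum>i\<in>UNIV. ?b i)"
        by (intro order_trans[OF norm_le_l1_cart] sum_mono)
      then show False using lt by simp
    qed
    moreover have m: "?E i \<in> sets S" for i
    proof -
      interpret C: coord_noise \<mu> "\<lambda>y. y $ i" by (rule coord)
      show ?thesis by (intro sets_Collect_S) measurable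
    qed
    ultimately have "measure S {ys. (\<Sum>i\<in>UNIV. ?b i) < norm (X n x ys)} \<le> measure S (\<Union>i\<in>UNIV. ?E i)"
      by (intro S.finite_measure_mono sets.finite_UN) auto
    also have "\<dots> \<le> (\<Sum>i\<in>UNIV. measure S (?E i))"
      using m by (intro measure_UNION_le) auto
    also have "\<dots> < (\<Sum>i\<in>(UNIV::'n set). \<epsilon> / real CARD('n))"
      using K[of _ n] \<epsilon> by (intro sum_strict_mono) (auto simp: S.emeasure_eq_measure ennreal_less_iff)
    also have "\<dots> = \<epsilon>" by simp
    finally show ?thesis .
  qed
  then show ?thesis by blast
qed

end

section \<open>Existence of invariant measures\<close>

lemma vec_lambda_meas:
  fixes f :: "'n::finite \<Rightarrow> 'z \<Rightarrow> real"
  assumes "\<And>i. f i \<in> borel_measurable N"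
  shows "(\<lambda>x. \<chi> i. f i x) \<in> borel_measurable N"
  using assms by (auto simp: borel_measurable_iff_halfspace_le Basis_vec_def inner_axis
      intro!: borel_measurable_euclidean_space[THEN iffD2])

locale refl_class = refl_law \<mu> D for \<mu> :: "(real ^ 'n) measure" and D :: "'n set" +
  fixes C :: "('n \<Rightarrow> int) set"
  assumes C: "C \<in> rcosets\<^bsub>parity_group D\<^esub> (parity_subgroup \<mu> D)"
begin

section \<open>Parities of the increments and the coset\<close>

abbreviation parity_op (infixl "\<oplus>" 65) where "g \<oplus> h \<equiv> g \<otimes>\<^bsub>G\<^esub> h"

lemma parity_mass:
  assumes "g \<in> carrier G"
  shows "emeasure (distr \<mu> (count_space (carrier G)) (parity D)) {g} = emeasure \<mu> {y. parity D y = g}"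
  using assms by (subst emeasure_distr[OF parity_measurable[OF sets_noise]]) (auto simp: vimage_def)

lemma parity_supp_iff: "g \<in> parity_supp \<mu> D \<longleftrightarrow> g \<in> carrier G \<and> emeasure \<mu> {y. parity D y = g} > 0"
  unfolding parity_supp_def by (auto simp: parity_mass)

lemma parity_sets: "{y. parity D y = g} \<in> sets \<mu>"
proof (cases "g \<in> carrier G")
  case True
  then have "parity D -` {g} \<inter> space \<mu> \<in> sets \<mu>"
    by (intro measurable_sets[OF parity_measurable[OF sets_noise]]) simp
  then show ?thesis by (simp add: vimage_def)
next
  case False
  then have "{y. parity D y = g} = {}" using parity_in_carrier by auto
  then show ?thesis by simp
qed

lemma AE_parity_supp: "AE y in \<mu>. parity D y \<in> parity_supp \<mu> D"
proof -
  have "AE y in \<mu>. \<forall>g\<in>carrier G - parity_supp \<mu> D. parity D y \<noteq> g"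
  proof (rule AE_finite_allI)
    show "finite (carrier G - parity_supp \<mu> D)" using finite_carrier_parity_group by simp
    fix g assume "g \<in> carrier G - parity_supp \<mu> D"
    then have "emeasure \<mu> {y. parity D y = g} = 0" by (auto simp: parity_supp_iff)
    then have "AE y in \<mu>. y \<notin> {y. parity D y = g}"
      using parity_sets by (intro AE_not_in) (auto simp: null_sets_def)
    then show "AE y in \<mu>. parity D y \<noteq> g" by simp
  qed
  then show ?thesis by eventually_elim (use parity_in_carrier in auto)
qed

lemma subgroup_parity: "subgroup (parity_subgroup \<mu> D) G"
  unfolding parity_subgroup_def by (rule G.generate_is_subgroup) (auto simp: parity_supp_def)

lemma C_cases: "\<exists>a\<in>carrier G. C = (\<lambda>h. h \<oplus> a) ` parity_subgroup \<mu> D"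
  using C by (auto simp: RCOSETS_def r_coset_def)

lemma C_carrier: "C \<subseteq> carrier G"
  using C_cases subgroup.mem_carrier[OF subgroup_parity] by auto

lemma finite_C: "finite C"
  using C_carrier finite_carrier_parity_group by (rule finite_subset)

lemma C_nonempty: "C \<noteq> {}"
  using C_cases subgroup.one_closed[OF subgroup_parity] by auto

lemma C_step:
  assumes g: "g \<in> C" and s: "s \<in> parity_supp \<mu> D"
  shows "g \<oplus> s \<in> C"
proof -
  obtain a where a: "a \<in> carrier G" "C = (\<lambda>h. h \<oplus> a) ` parity_subgroup \<mu> D" using C_cases by blast
  obtain h where h: "h \<in> parity_subgroup \<mu> D" "g = h \<oplus> a" using g a by auto
  have s': "s \<in> parity_subgroup \<mu> D" "s \<in> carrier G"
    using s by (auto simp: parity_subgroup_def parity_supp_def intro: generate.incl)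
  have h': "h \<in> carrier G" using h subgroup.mem_carrier[OF subgroup_parity] by auto
  have "g \<oplus> s = (h \<oplus> s) \<oplus> a" unfolding h using h' s' a by (simp add: G.m_ac)
  moreover have "h \<oplus> s \<in> parity_subgroup \<mu> D" using h s' subgroup.m_closed[OF subgroup_parity] by auto
  ultimately show ?thesis using a by auto
qed

lemma C_trans:
  assumes "g \<in> C" "k \<in> C"
  shows "\<exists>h\<in>parity_subgroup \<mu> D. g = k \<oplus> h"
proof -
  obtain a where a: "a \<in> carrier G" "C = (\<lambda>h. h \<oplus> a) ` parity_subgroup \<mu> D" using C_cases by blast
  obtain h l where h: "h \<in> parity_subgroup \<mu> D" "g = h \<oplus> a" and l: "l \<in> parity_subgroup \<mu> D" "k = l \<oplus> a"
    using assms a by auto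
  have c: "h \<in> carrier G" "l \<in> carrier G" using h l subgroup.mem_carrier[OF subgroup_parity] by auto
  \<comment> \<open>Every parity is its own inverse, so \<open>l \<oplus> h\<close> is the quotient
    of \<open>g\<close> by \<open>k\<close>.\<close>
  have "k \<oplus> (l \<oplus> h) = (l \<oplus> l) \<oplus> (h \<oplus> a)" unfolding l using c a by (simp add: G.m_ac)
  also have "\<dots> = g" using c a h by (simp add: parity_self_mult)
  finally show ?thesis using h l subgroup.m_closed[OF subgroup_parity] by (intro bexI[of _ "l \<oplus> h"]) auto
qed

section \<open>Backward iteration with a prescribed parity at its end\<close>

primrec parity_sum :: "nat \<Rightarrow> (real ^ 'n) stream \<Rightarrow> ('n \<Rightarrow> int)" where
  "parity_sum 0 ys = \<one>\<^bsub>G\<^esub>"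
| "parity_sum (Suc n) ys = parity D (shd ys) \<oplus> parity_sum n (stl ys)"

lemma parity_sum_carrier [simp]: "parity_sum n ys \<in> carrier G"
  by (induction n arbitrary: ys) (auto intro: parity_in_carrier)

lemma parity_sum_add: "parity_sum (n + m) ys = parity_sum n ys \<oplus> parity_sum m (sdrop n ys)"
  by (induction n arbitrary: ys) (simp_all add: parity_in_carrier G.m_assoc)

lemma parity_sum_meas [measurable]: "(\<lambda>ys. parity_sum n ys i) \<in> measurable S (count_space UNIV)"
proof (induction n)
  case 0
  then show ?case by simp
next
  case (Suc n)
  have 1: "(\<lambda>ys. shd ys $ i) \<in> borel_measurable S"
    using measurable_compose[OF measurable_shd, of "\<lambda>y. y $ i" \<mu> borel]
    by (simp add: measurable_cong_sets[OF sets_noise refl])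
  have 2: "(\<lambda>ys. parity_sum n (stl ys) i) \<in> measurable S (count_space UNIV)"
    by (rule measurable_compose[OF measurable_stl Suc])
  show ?case
  proof (cases "i \<in> D")
    case True
    then show ?thesis
      using 1 2 by (simp add: mult_parity_group parity_def)
  next
    case False
    then show ?thesis by (simp add: mult_parity_group)
  qed
qed

text \<open>
  The starting point of the backward iteration is chosen as a function of the increments so that
  the endpoint always has parity \<open>g\<close>.
\<close>

definition Zn :: "nat \<Rightarrow> ('n \<Rightarrow> int) \<Rightarrow> (real ^ 'n) stream \<Rightarrow> real ^ 'n" where
  "Zn n g ys = B n (parity_point (g \<oplus> parity_sum n ys)) ys"

lemma Zn_meas [measurable]: "Zn n g \<in> borel_measurable S"
proof -
  have "(\<lambda>ys. (if i \<in> D then real_of_int ((g \<oplus> parity_sum n ys) i) else 0)) \<in> borel_measurable S" for i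
    by (cases "i \<in> D") (simp_all add: mult_parity_group)
  then have "(\<lambda>ys. parity_point (g \<oplus> parity_sum n ys)) \<in> borel_measurable S"
    unfolding parity_point_def by (rule vec_lambda_meas)
  then show ?thesis unfolding Zn_def[abs_def] by (intro B_meas) simp_all
qed

lemma B_cell:
  assumes ys: "\<forall>n. \<forall>i\<in>D. (ys !! n) $ i \<in> \<int>" and x: "x \<in> cell h"
  shows "B n x ys \<in> cell (h \<oplus> parity_sum n ys)"
  using ys
proof (induction n arbitrary: ys)
  case 0
  have "h \<in> carrier G" using x parity_in_carrier by (auto simp: cell_def)
  then show ?case using x by simp
next
  case (Suc n)
  have "\<forall>n. \<forall>i\<in>D. (stl ys !! n) $ i \<in> \<int>" using Suc.prems by (metis snth.simps(2))
  note IH = Suc.IH[OF this]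
  have 0: "\<forall>i\<in>D. shd ys $ i \<in> \<int>" using spec[OF Suc.prems, of 0] by simp
  have h: "h \<in> carrier G" using x parity_in_carrier by (auto simp: cell_def)
  have "parity D \<bar>B n x (stl ys) - shd ys\<bar> = (h \<oplus> parity_sum n (stl ys)) \<oplus> parity D (shd ys)"
    using IH 0 by (subst parity_step) (auto simp: cell_def)
  moreover have "\<bar>B n x (stl ys) - shd ys\<bar> \<in> state_space D"
    using IH 0 by (intro parity_step) (auto simp: cell_def)
  ultimately show ?case
    using h by (simp add: cell_def G.m_ac parity_in_carrier)
qed

lemma parity_point_cell: "g \<in> carrier G \<Longrightarrow> parity_point g \<in> cell g"
  using parity_point by (simp add: cell_def)

lemma Zn_cell:
  assumes "\<forall>n. \<forall>i\<in>D. (ys !! n) $ i \<in> \<int>" "g \<in> carrier G"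
  shows "Zn n g ys \<in> cell g"
  using B_cell[OF assms(1) parity_point_cell, of "g \<oplus> parity_sum n ys" n] assms(2)
  by (simp add: Zn_def parity_mult_cancel)

text \<open>Prepending \<open>y\<close> adds its parity both to the prescribed endpoint and to the
  sum of the increments, so the starting point stays the same. In the limit this identity becomes
  invariance.\<close>

lemma Zn_step:
  assumes "g \<in> carrier G"
  shows "\<bar>Zn n g ys - y\<bar> = Zn (Suc n) (g \<oplus> parity D y) (y ## ys)"
proof -
  have "(g \<oplus> parity D y) \<oplus> (parity D y \<oplus> parity_sum n ys) = g \<oplus> parity_sum n ys"
    using assms by (simp add: parity_mult_cancel parity_in_carrier flip: G.m_assoc)
  then show ?thesis by (simp add: Zn_def)
qed

text \<open>\<open>contract_prob\<close> concerns fixed starting points, whereas those of the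
  backward iteration depend on the stream. Nonexpansiveness reduces the compact part of a cell to a
  finite net, which gives one exceptional set \<open>E n\<close> for all starting points at
  once.\<close>

lemma uniform_contract:
  assumes \<epsilon>: "0 < \<epsilon>"
  shows "\<exists>E. (\<forall>n. E n \<in> sets S) \<and> (\<lambda>n. measure S (E n)) \<longlonglongrightarrow> 0 \<and>
    (\<forall>n ys g x y. ys \<notin> E n \<longrightarrow> x \<in> cell g \<longrightarrow> y \<in> cell g \<longrightarrow> norm x \<le> K \<longrightarrow> norm y \<le> K \<longrightarrow>
       dist (B n x ys) (B n y ys) < \<epsilon>)"
proof -
  let ?far = "\<lambda>n p. {ys. \<epsilon> / 3 \<le> dist (B n (fst (snd p)) ys) (B n (snd (snd p)) ys)}"
  have "\<exists>F. finite F \<and> F \<subseteq> cell g \<inter> cball 0 K \<and> cell g \<inter> cball 0 K \<subseteq> (\<Union>x\<in>F. ball x (\<epsilon> / 3))" for g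
  proof -
    have "compact (cell g \<inter> cball 0 K)" by (intro closed_Int_compact closed_cell compact_cball)
    then have "seq_compact (cell g \<inter> cball 0 K)" by (rule compact_imp_seq_compact)
    from seq_compact_imp_totally_bounded[OF this] show ?thesis using \<epsilon> by (elim allE[of _ "\<epsilon> / 3"]) simp
  qed
  then obtain F where F: "\<And>g. finite (F g)" "\<And>g. F g \<subseteq> cell g \<inter> cball 0 K"
    "\<And>g. cell g \<inter> cball 0 K \<subseteq> (\<Union>x\<in>F g. ball x (\<epsilon> / 3))" by metis
  define I where "I = (SIGMA g:carrier G. F g \<times> F g)"
  define E where "E n = (\<Union>p\<in>I. (?far n p))" for n
  have fin: "finite I" unfolding I_def using F(1) finite_carrier_parity_group by auto
  have m: "{ys. \<epsilon> / 3 \<le> dist (B n x ys) (B n y ys)} \<in> sets S" for n x y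
    by (intro sets_Collect_S) measurable
  have E_sets: "E n \<in> sets S" for n unfolding E_def using fin m by (intro sets.finite_UN) auto
  have le: "measure S (E n) \<le> (\<Sum>p\<in>I. measure S (?far n p))" for n
    unfolding E_def using fin m by (intro measure_UNION_le) auto
  have "(\<lambda>n. \<Sum>p\<in>I. measure S (?far n p)) \<longlonglongrightarrow> (\<Sum>p\<in>I. 0)"
  proof (rule tendsto_sum)
    fix p assume "p \<in> I"
    then have "fst (snd p) \<in> cell (fst p)" "snd (snd p) \<in> cell (fst p)" using F(2)[of "fst p"] by (auto simp: I_def)
    then show "(\<lambda>n. measure S (?far n p)) \<longlonglongrightarrow> 0"
      using \<epsilon> by (intro contract_prob) auto
  qed
  then have "(\<lambda>n. \<Sum>p\<in>I. measure S (?far n p)) \<longlonglongrightarrow> 0"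
    by simp
  moreover have "norm (measure S (E n)) \<le> (\<Sum>p\<in>I. measure S (?far n p))" for n
    using le by simp
  ultimately have lim: "(\<lambda>n. measure S (E n)) \<longlonglongrightarrow> 0"
    by (rule Lim_null_comparison[OF always_eventually[OF allI], rotated])
  have "dist (B n x ys) (B n y ys) < \<epsilon>"
    if ys: "ys \<notin> E n" and xy: "x \<in> cell g" "y \<in> cell g" "norm x \<le> K" "norm y \<le> K" for n ys g x y
  proof -
    have g: "g \<in> carrier G" using xy(1) parity_in_carrier by (auto simp: cell_def)
    have "x \<in> cell g \<inter> cball 0 K" and y: "y \<in> cell g \<inter> cball 0 K" using xy by auto
    then obtain u where u: "u \<in> F g" "dist u x < \<epsilon> / 3"
      using subsetD[OF F(3), of x g] by (auto simp: mem_ball)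
    obtain v where v: "v \<in> F g" "dist v y < \<epsilon> / 3"
      using subsetD[OF F(3) y] by (auto simp: mem_ball)
    have "(g, u, v) \<in> I" using g u v by (simp add: I_def)
    then have "dist (B n u ys) (B n v ys) < \<epsilon> / 3" using ys by (force simp: E_def not_le)
    moreover have "dist (B n x ys) (B n u ys) < \<epsilon> / 3" "dist (B n v ys) (B n y ys) < \<epsilon> / 3"
      using B_dist[of n x ys u] B_dist[of n v ys y] u v by (simp_all add: dist_commute)
    moreover have "dist (B n x ys) (B n y ys) \<le> dist (B n x ys) (B n u ys) + (dist (B n u ys) (B n v ys) + dist (B n v ys) (B n y ys))"
      by (intro order_trans[OF dist_triangle[of _ _ "B n u ys"]] add_left_mono dist_triangle)
    ultimately show ?thesis by linarith
  qed
  then show ?thesis using E_sets lim by blast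
qed

lemma measure_back:
  "measure S {ys. K < norm (B m x (sdrop n ys))} = measure S {ys. K < norm (X m x ys)}"
proof -
  have A: "{v::real ^ 'n. K < norm v} \<in> sets borel" by measurable
  have m: "{ys. K < norm (B m x ys)} \<in> sets S" "{ys. K < norm (B m x (sdrop n ys))} \<in> sets S"
    by (intro sets_Collect_S; measurable)+
  have "(\<integral>\<^sup>+ys. indicator {ys. K < norm (B m x ys)} (sdrop n ys) \<partial>S) = emeasure S {ys. K < norm (B m x ys)}"
    using m(1) by (subst nn_integral_sdrop) simp_all
  moreover have "(\<integral>\<^sup>+ys. indicator {ys. K < norm (B m x ys)} (sdrop n ys) \<partial>S) =
      (\<integral>\<^sup>+ys. indicator {ys. K < norm (B m x (sdrop n ys))} ys \<partial>S)"
    by (simp add: indicator_def)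
  ultimately show ?thesis
    using m(2) measure_back_flow[OF abs_vec_meas A, of m x] by (simp add: measure_def)
qed

text \<open>Passing from horizon \<open>n\<close> to \<open>n + m\<close> replaces the start of the
  outer \<open>n\<close> steps by the endpoint of \<open>m\<close> inner ones. That endpoint has the
  right parity, and tightness bounds it up to small probability, so \<open>uniform_contract\<close>
  applies.\<close>

lemma Zn_cauchy:
  assumes \<epsilon>: "0 < \<epsilon>" and r: "0 < r"
  shows "\<exists>N. \<forall>n\<ge>N. \<forall>m. \<forall>g\<in>carrier G. measure S {ys. \<epsilon> < dist (Zn (n + m) g ys) (Zn n g ys)} \<le> r"
proof -
  let ?\<xi> = "parity_point"
  let ?c = "real (card (carrier G))"
  have c: "0 < ?c" using finite_carrier_parity_group G.one_closed card_gt_0_iff by fastforce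
  \<comment> \<open>Which starting point occurs depends on the stream, so the error is divided by
    the number of parities for a union bound.\<close>
  have "\<forall>h. \<exists>K. \<forall>n. measure S {ys. K < norm (X n (?\<xi> h) ys)} < r / (2 * ?c)"
    using tight_vec[of "r / (2 * ?c)"] r c by simp
  then obtain K0 where K0: "\<And>h n. measure S {ys. K0 h < norm (X n (?\<xi> h) ys)} < r / (2 * ?c)" by metis
  define K where "K = (\<Sum>h\<in>carrier G. \<bar>K0 h\<bar> + norm (?\<xi> h))"
  have K: "K0 h \<le> K" "norm (?\<xi> h) \<le> K" if "h \<in> carrier G" for h
  proof -
    have "\<bar>K0 h\<bar> + norm (?\<xi> h) \<le> K"
      unfolding K_def using that finite_carrier_parity_group by (intro member_le_sum) auto
    then show "K0 h \<le> K" "norm (?\<xi> h) \<le> K"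
      using norm_ge_zero[of "?\<xi> h"] abs_ge_self[of "K0 h"] abs_ge_zero[of "K0 h"] by linarith+
  qed
  obtain E where E: "\<And>n. E n \<in> sets S" "(\<lambda>n. measure S (E n)) \<longlonglongrightarrow> 0"
    "\<And>n ys g x y. ys \<notin> E n \<Longrightarrow> x \<in> cell g \<Longrightarrow> y \<in> cell g \<Longrightarrow> norm x \<le> K \<Longrightarrow> norm y \<le> K \<Longrightarrow>
       dist (B n x ys) (B n y ys) < \<epsilon>"
    using uniform_contract[OF \<epsilon>, of K] by blast
  have "eventually (\<lambda>n. measure S (E n) < r / 2) sequentially"
    using E(2) r by (intro order_tendstoD(2)) auto
  then obtain N where N: "\<And>n. N \<le> n \<Longrightarrow> measure S (E n) < r / 2" by (auto simp: eventually_sequentially)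
  have "measure S {ys. \<epsilon> < dist (Zn (n + m) g ys) (Zn n g ys)} \<le> r" if n: "N \<le> n" and g: "g \<in> carrier G" for n m g
  proof -
    let ?T = "\<lambda>h. {ys. K < norm (B m (?\<xi> h) (sdrop n ys))}"
    have T: "?T h \<in> sets S" for h by (intro sets_Collect_S) measurable
    have "measure S {ys. \<epsilon> < dist (Zn (n + m) g ys) (Zn n g ys)} \<le> measure S (E n \<union> (\<Union>h\<in>carrier G. ?T h))"
    proof (rule S.finite_measure_mono_AE)
      show "AE ys in S. ys \<in> {ys. \<epsilon> < dist (Zn (n + m) g ys) (Zn n g ys)} \<longrightarrow> ys \<in> E n \<union> (\<Union>h\<in>carrier G. ?T h)"
        using AE_int
      proof eventually_elim
        case (elim ys)
        show ?case
        proof (intro impI, rule ccontr)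
          assume lt: "ys \<in> {ys. \<epsilon> < dist (Zn (n + m) g ys) (Zn n g ys)}"
            and "ys \<notin> E n \<union> (\<Union>h\<in>carrier G. ?T h)"
          then have nE: "ys \<notin> E n" and nT: "\<And>h. h \<in> carrier G \<Longrightarrow> norm (B m (?\<xi> h) (sdrop n ys)) \<le> K"
            by (auto simp: not_less)
          \<comment> \<open>\<open>h\<close> is the parity at which horizon \<open>n\<close> starts,
            \<open>k\<close> the one for horizon \<open>n + m\<close>; after the \<open>m\<close>
            inner steps the latter has reached parity \<open>h\<close>.\<close>
          define h where "h = g \<oplus> parity_sum n ys"
          have h: "h \<in> carrier G" unfolding h_def using g by simp
          define k where "k = h \<oplus> parity_sum m (sdrop n ys)"
          have k: "k \<in> carrier G" unfolding k_def using h by simp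
          have "\<forall>j. \<forall>i\<in>D. (sdrop n ys !! j) $ i \<in> \<int>" using elim by (simp add: sdrop_snth)
          then have "B m (?\<xi> k) (sdrop n ys) \<in> cell (k \<oplus> parity_sum m (sdrop n ys))"
            by (rule B_cell) (rule parity_point_cell[OF k])
          then have v: "B m (?\<xi> k) (sdrop n ys) \<in> cell h"
            using h by (simp add: k_def parity_mult_cancel)
          have "g \<oplus> parity_sum (n + m) ys = k"
            using g by (simp add: parity_sum_add k_def h_def G.m_assoc)
          then have "dist (Zn (n + m) g ys) (Zn n g ys) = dist (B n (B m (?\<xi> k) (sdrop n ys)) ys) (B n (?\<xi> h) ys)"
            by (simp add: Zn_def back_flow_add h_def)
          also have "\<dots> < \<epsilon>" by (rule E(3)[OF nE v parity_point_cell[OF h] nT[OF k] K(2)[OF h]])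
          finally show False using lt by simp
        qed
      qed
      show "E n \<union> (\<Union>h\<in>carrier G. ?T h) \<in> sets S"
        using E(1) T finite_carrier_parity_group by (intro sets.Un sets.finite_UN) auto
    qed
    also have "\<dots> \<le> measure S (E n) + measure S (\<Union>h\<in>carrier G. ?T h)"
      using E(1) T finite_carrier_parity_group by (intro measure_Un_le sets.finite_UN) auto
    also have "measure S (\<Union>h\<in>carrier G. ?T h) \<le> (\<Sum>h\<in>carrier G. measure S (?T h))"
      using T finite_carrier_parity_group by (intro measure_UNION_le) auto
    also have "\<dots> \<le> (\<Sum>h\<in>carrier G. r / (2 * ?c))"
    proof (rule sum_mono)
      fix h assume h: "h \<in> carrier G"
      have "measure S {ys. K < norm (X m (?\<xi> h) ys)} \<le> measure S {ys. K0 h < norm (X m (?\<xi> h) ys)}"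
      proof (rule S.finite_measure_mono)
        show "{ys. K0 h < norm (X m (?\<xi> h) ys)} \<in> sets S" by (intro sets_Collect_S) measurable
      qed (use K(1)[OF h] in auto)
      then show "measure S (?T h) \<le> r / (2 * ?c)" using K0[of h m] by (simp add: measure_back)
    qed
    also have "\<dots> = r / 2" using c by simp
    finally show ?thesis using N[OF n] by simp
  qed
  then show ?thesis by blast
qed

section \<open>Limit of the backward iteration and the invariant measure\<close>

definition K :: "(real ^ 'n) set" where
  "K = {x \<in> state_space D. parity D x \<in> C}"

definition invariant :: "(real ^ 'n) measure \<Rightarrow> bool" where
  "invariant \<nu> \<longleftrightarrow> prob_space \<nu> \<and> sets \<nu> = sets borel \<and> emeasure \<nu> K = 1 \<and>
     (\<forall>A\<in>sets borel. (\<integral>\<^sup>+x. emeasure \<mu> {y. \<bar>x - y\<bar> \<in> A} \<partial>\<nu>) = emeasure \<nu> A)"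

lemma K_eq: "K = (\<Union>g\<in>C. cell g)"
  by (auto simp: K_def cell_def)

lemma K_sets: "K \<in> sets borel"
proof -
  have "closed K" unfolding K_eq using finite_C closed_cell by (intro closed_UN) auto
  then show ?thesis by simp
qed

text \<open>Convergence in probability gives almost sure convergence only along a subsequence
  \<open>s\<close>. Since the recursion relates time \<open>s k\<close> to \<open>Suc (s k)\<close>,
  the limit along the shifted times has to be shown to be the same.\<close>

lemma Zn_limit:
  "\<exists>Z. (\<forall>g. Z g \<in> borel_measurable S) \<and> (\<forall>g\<in>carrier G. AE ys in S. Z g ys \<in> cell g) \<and>
     (\<forall>g\<in>carrier G. AE y in \<mu>. AE ys in S. \<bar>Z g ys - y\<bar> = Z (g \<oplus> parity D y) (y ## ys))"
proof -
  have "\<forall>k. \<exists>N. \<forall>n\<ge>N. \<forall>m. \<forall>g\<in>carrier G. measure S {ys. (1/2)^k < dist (Zn (n + m) g ys) (Zn n g ys)} \<le> (1/2)^k"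
    by (intro allI Zn_cauchy) simp_all
  from choice[OF this] obtain N where N0: "\<forall>k. \<forall>n\<ge>N k. \<forall>m. \<forall>g\<in>carrier G.
      measure S {ys. (1/2)^k < dist (Zn (n + m) g ys) (Zn n g ys)} \<le> (1/2)^k" ..
  have N: "measure S {ys. (1/2)^k < dist (Zn (n + m) g ys) (Zn n g ys)} \<le> (1/2)^k"
    if "N k \<le> n" "g \<in> carrier G" for k n m g
    using N0[rule_format, OF that] .
  define s where "s k = (\<Sum>j\<le>k. N j)" for k
  have s_ge: "N k \<le> s k" for k unfolding s_def by (intro member_le_sum) auto
  have s_Suc: "s k \<le> s (Suc k)" for k unfolding s_def by simp
  have close: "measure S {ys. (1/2)^k < dist (Zn n g ys) (Zn (s k) g ys)} \<le> (1/2)^k"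
    if "s k \<le> n" "g \<in> carrier G" for k n g
    using N[of k "s k" g "n - s k"] s_ge[of k] that by simp
  \<comment> \<open>Used with \<open>f k = s (Suc k)\<close> for convergence along \<open>s\<close>,
    and with \<open>f k = Suc (s k)\<close> for the shifted times.\<close>
  have ev: "AE ys in S. eventually (\<lambda>k. dist (Zn (f k) g ys) (Zn (s k) g ys) \<le> (1/2)^k) sequentially"
    if f: "\<And>k. s k \<le> f k" and g: "g \<in> carrier G" for f g
  proof -
    let ?A = "\<lambda>k. {ys. (1/2)^k < dist (Zn (f k) g ys) (Zn (s k) g ys)}"
    have "AE ys in S. eventually (\<lambda>k. ys \<in> space S - ?A k) sequentially"
    proof (rule borel_cantelli_AE1)
      show "?A k \<in> sets S" for k by (intro sets_Collect_S) measurable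
      show "emeasure S (?A k) < \<infinity>" for k by (simp add: S.emeasure_eq_measure)
      show "summable (\<lambda>k. measure S (?A k))"
        by (rule summable_comparison_test[of _ "\<lambda>k. (1/2)^k"]) (use close[OF f g] in auto)
    qed
    then show ?thesis by eventually_elim (auto elim!: eventually_mono simp: not_less)
  qed
  define Z where "Z g ys = lim (\<lambda>k. Zn (s k) g ys)" for g ys
  have Z_meas: "Z g \<in> borel_measurable S" for g unfolding Z_def[abs_def] by measurable
  have lim: "AE ys in S. (\<lambda>k. Zn (s k) g ys) \<longlonglongrightarrow> Z g ys" if g: "g \<in> carrier G" for g
    using ev[of "\<lambda>k. s (Suc k)", OF s_Suc g]
  proof eventually_elim
    case (elim ys)
    let ?z = "\<lambda>k. Zn (s k) g ys"
    have "summable (\<lambda>k. ?z (Suc k) - ?z k)"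
      by (rule summable_comparison_test_ev[OF _ summable_geometric[of "1/2::real"]])
         (use elim in \<open>auto elim!: eventually_mono simp: dist_norm\<close>)
    then have "(\<lambda>n. \<Sum>k<n. ?z (Suc k) - ?z k) \<longlonglongrightarrow> (\<Sum>k. ?z (Suc k) - ?z k)"
      by (rule summable_LIMSEQ)
    then have "(\<lambda>n. ?z n - ?z 0) \<longlonglongrightarrow> (\<Sum>k. ?z (Suc k) - ?z k)"
      by (simp only: sum_lessThan_telescope[of ?z])
    from tendsto_add[OF this tendsto_const[of "?z 0"]] have "convergent ?z"
      by (auto simp: convergent_def)
    then show ?case by (simp add: Z_def convergent_LIMSEQ_iff)
  qed
  have lim': "AE ys in S. (\<lambda>k. Zn (Suc (s k)) g ys) \<longlonglongrightarrow> Z g ys" if g: "g \<in> carrier G" for g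
    using ev[of "\<lambda>k. Suc (s k)", OF _ g, simplified] lim[OF g]
  proof eventually_elim
    case (elim ys)
    have pow: "(\<lambda>k. (1/2)^k :: real) \<longlonglongrightarrow> 0" by (rule LIMSEQ_power_zero) simp
    have "eventually (\<lambda>k. norm (Zn (Suc (s k)) g ys - Zn (s k) g ys) \<le> (1/2)^k) sequentially"
      using elim(1) by (simp only: dist_norm)
    then have "(\<lambda>k. Zn (Suc (s k)) g ys - Zn (s k) g ys) \<longlonglongrightarrow> 0"
      by (rule Lim_null_comparison[OF _ pow])
    from tendsto_add[OF this elim(2)] show ?case by simp
  qed
  have cell: "AE ys in S. Z g ys \<in> cell g" if g: "g \<in> carrier G" for g
    using lim[OF g] AE_int
  proof eventually_elim
    case (elim ys)
    show ?case by (rule closed_sequentially[OF closed_cell Zn_cell[OF elim(2) g] elim(1)])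
  qed
  have step: "AE y in \<mu>. AE ys in S. \<bar>Z g ys - y\<bar> = Z (g \<oplus> parity D y) (y ## ys)" if g: "g \<in> carrier G" for g
  proof -
    \<comment> \<open>The target parity \<open>g \<oplus> parity D y\<close> varies with
      \<open>y\<close>, so convergence is needed for all parities outside one null set; the group is
      finite.\<close>
    have "AE ys in S. \<forall>h\<in>carrier G. (\<lambda>k. Zn (Suc (s k)) h ys) \<longlonglongrightarrow> Z h ys"
      using finite_carrier_parity_group lim' by (rule AE_finite_allI)
    then have "AE y in \<mu>. AE ys in S. \<forall>h\<in>carrier G. (\<lambda>k. Zn (Suc (s k)) h (y ## ys)) \<longlonglongrightarrow> Z h (y ## ys)"
      by (rule AE_Stream)
    then show ?thesis
    proof eventually_elim
      case (elim y)
      show ?case using elim lim[OF g]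
      proof eventually_elim
        case (elim ys)
        let ?h = "g \<oplus> parity D y"
        have "?h \<in> carrier G" using g parity_in_carrier by simp
        then have 1: "(\<lambda>k. Zn (Suc (s k)) ?h (y ## ys)) \<longlonglongrightarrow> Z ?h (y ## ys)" using elim(1) by blast
        have "(\<lambda>k. dist (Zn (s k) g ys) (Z g ys)) \<longlonglongrightarrow> 0" by (rule tendsto_dist_iff[THEN iffD1, OF elim(2)])
        moreover have "norm (dist \<bar>Zn (s k) g ys - y\<bar> \<bar>Z g ys - y\<bar>) \<le> dist (Zn (s k) g ys) (Z g ys)" for k
          by (simp add: abs_vec_dist)
        ultimately have "(\<lambda>k. dist \<bar>Zn (s k) g ys - y\<bar> \<bar>Z g ys - y\<bar>) \<longlonglongrightarrow> 0"
          by (rule Lim_null_comparison[OF always_eventually[OF allI], rotated])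
        then have "(\<lambda>k. dist (Zn (Suc (s k)) ?h (y ## ys)) \<bar>Z g ys - y\<bar>) \<longlonglongrightarrow> 0"
          by (simp only: Zn_step[OF g])
        then have "(\<lambda>k. Zn (Suc (s k)) ?h (y ## ys)) \<longlonglongrightarrow> \<bar>Z g ys - y\<bar>"
          by (rule tendsto_dist_iff[THEN iffD2])
        from LIMSEQ_unique[OF this 1] show ?case .
      qed
    qed
  qed
  show ?thesis
  proof (rule exI[of _ Z], rule conjI[OF _ conjI])
    show "\<forall>g. Z g \<in> borel_measurable S" by (rule allI[OF Z_meas])
    show "\<forall>g\<in>carrier G. AE ys in S. Z g ys \<in> cell g" by (rule ballI[OF cell])
    show "\<forall>g\<in>carrier G. AE y in \<mu>. AE ys in S. \<bar>Z g ys - y\<bar> = Z (g \<oplus> parity D y) (y ## ys)"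
      by (rule ballI[OF step])
  qed
qed

text \<open>A step with increment \<open>y\<close> turns the limit of parity \<open>g\<close> into
  the limit of parity \<open>g \<oplus> parity D y\<close>. Translation by a parity in the support
  permutes \<open>C\<close>, so the uniform mixture over \<open>C\<close> is preserved.\<close>

lemma exists_invariant: "\<exists>\<nu>. invariant \<nu>"
proof -
  from Zn_limit obtain Z where Z: "(\<forall>g. Z g \<in> borel_measurable S) \<and>
     (\<forall>g\<in>carrier G. AE ys in S. Z g ys \<in> cell g) \<and>
     (\<forall>g\<in>carrier G. AE y in \<mu>. AE ys in S. \<bar>Z g ys - y\<bar> = Z (g \<oplus> parity D y) (y ## ys))" ..
  note Z_meas [measurable] = Z[THEN conjunct1, rule_format]
    and Z_cell = Z[THEN conjunct2, THEN conjunct1, rule_format]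
    and Z_step = Z[THEN conjunct2, THEN conjunct2, rule_format]
  let ?c = "ennreal (1 / real (card C))"
  define P where "P = uniform_count_measure C \<Otimes>\<^sub>M S"
  define \<nu> where "\<nu> = distr P borel (\<lambda>p. Z (fst p) (snd p))"
  have cpos: "0 < card C" using finite_C C_nonempty by (simp add: card_gt_0_iff)
  interpret U: prob_space "uniform_count_measure C"
    using finite_C C_nonempty by (rule prob_space_uniform_count_measure)
  have Pm: "(\<lambda>p. Z (fst p) (snd p)) \<in> borel_measurable P"
  proof -
    have "(\<lambda>p. Z (fst p) (snd p)) \<in> borel_measurable (count_space C \<Otimes>\<^sub>M S)"
      using finite_C by (intro measurable_pair_measure_countable1) (auto intro: countable_finite)
    then show ?thesis
      unfolding P_def
      by (simp add: measurable_cong_sets[OF sets_pair_measure_cong[OF sets_uniform_count_measure_count_space refl] refl])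
  qed
  have nn: "(\<integral>\<^sup>+x. F x \<partial>\<nu>) = ?c * (\<Sum>g\<in>C. \<integral>\<^sup>+ys. F (Z g ys) \<partial>S)"
    if F: "F \<in> borel_measurable borel" for F
  proof -
    have FP: "(\<lambda>p. F (Z (fst p) (snd p))) \<in> borel_measurable P" by (rule measurable_compose[OF Pm F])
    have "(\<integral>\<^sup>+x. F x \<partial>\<nu>) = (\<integral>\<^sup>+p. F (Z (fst p) (snd p)) \<partial>P)"
      unfolding \<nu>_def by (rule nn_integral_distr[OF Pm]) (simp add: F)
    also have "\<dots> = (\<integral>\<^sup>+g. \<integral>\<^sup>+ys. F (Z g ys) \<partial>S \<partial>uniform_count_measure C)"
      using S.nn_integral_fst[OF FP[unfolded P_def]] by (simp add: P_def)
    also have "\<dots> = (\<Sum>g\<in>C. ?c * (\<integral>\<^sup>+ys. F (Z g ys) \<partial>S))"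
      unfolding uniform_count_measure_def using finite_C
      by (subst nn_integral_point_measure_finite) (auto simp: mult.commute)
    finally show ?thesis by (simp add: sum_distrib_left)
  qed
  have sets_\<nu>: "sets \<nu> = sets borel" by (simp add: \<nu>_def)
  have em: "emeasure \<nu> A = ?c * (\<Sum>g\<in>C. emeasure S {ys. Z g ys \<in> A})" if A: "A \<in> sets borel" for A
  proof -
    have "emeasure \<nu> A = (\<integral>\<^sup>+x. indicator A x \<partial>\<nu>)" using A by (simp add: sets_\<nu>)
    also have "\<dots> = ?c * (\<Sum>g\<in>C. \<integral>\<^sup>+ys. indicator A (Z g ys) \<partial>S)" by (rule nn[OF borel_measurable_indicator[OF A]])
    also have "(\<Sum>g\<in>C. \<integral>\<^sup>+ys. indicator A (Z g ys) \<partial>S) = (\<Sum>g\<in>C. emeasure S {ys. Z g ys \<in> A})"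
    proof (rule sum.cong[OF refl])
      fix g
      have "{ys. Z g ys \<in> A} \<in> sets S" using measurable_sets[OF Z_meas A, of g] by (simp add: vimage_def)
      then have "emeasure S {ys. Z g ys \<in> A} = (\<integral>\<^sup>+ys. indicator {ys. Z g ys \<in> A} ys \<partial>S)" by simp
      then show "(\<integral>\<^sup>+ys. indicator A (Z g ys) \<partial>S) = emeasure S {ys. Z g ys \<in> A}"
        by (simp add: indicator_def)
    qed
    finally show ?thesis .
  qed
  have one: "emeasure \<nu> A = 1" if A: "A \<in> sets borel" and 1: "\<And>g. g \<in> C \<Longrightarrow> AE ys in S. Z g ys \<in> A" for A
  proof -
    have "emeasure S {ys. Z g ys \<in> A} = 1" if "g \<in> C" for g
    proof -
      have "{ys. Z g ys \<in> A} \<in> sets S" using measurable_sets[OF Z_meas A, of g] by (simp add: vimage_def)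
      then show ?thesis using S.emeasure_eq_1_AE[of "{ys. Z g ys \<in> A}"] 1[OF that] by simp
    qed
    then have "emeasure \<nu> A = ?c * of_nat (card C)" by (simp add: em[OF A])
    also have "\<dots> = 1" using cpos by (simp add: ennreal_of_nat_eq_real_of_nat ennreal_mult[symmetric] del: ennreal_of_nat_eq_real_of_nat[symmetric])
    finally show ?thesis .
  qed
  have "prob_space \<nu>"
  proof
    show "emeasure \<nu> (space \<nu>) = 1" using one[of UNIV] by (simp add: \<nu>_def)
  qed
  moreover have "emeasure \<nu> K = 1"
  proof (rule one[OF K_sets])
    fix g assume g: "g \<in> C"
    show "AE ys in S. Z g ys \<in> K"
      using Z_cell[OF subsetD[OF C_carrier g]] by eventually_elim (use g in \<open>auto simp: K_eq\<close>)
  qed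
  moreover have "(\<integral>\<^sup>+x. emeasure \<mu> {y. \<bar>x - y\<bar> \<in> A} \<partial>\<nu>) = emeasure \<nu> A" if A: "A \<in> sets borel" for A
  proof -
    note [measurable] = A
    have IA: "(indicator A :: _ \<Rightarrow> ennreal) \<in> borel_measurable (borel :: (real ^ 'n) measure)"
      by (rule borel_measurable_indicator[OF A])
    have abs_m: "(\<lambda>p. indicator A \<bar>fst p - snd p\<bar> :: ennreal) \<in> borel_measurable (borel \<Otimes>\<^sub>M \<mu>)"
      by (rule measurable_compose[OF abs_vec_compose IA]) (simp_all cong: measurable_cong_sets)
    have ker_meas: "(\<lambda>x. \<integral>\<^sup>+y. indicator A \<bar>x - y\<bar> \<partial>\<mu>) \<in> borel_measurable borel"
      using abs_m by (intro borel_measurable_nn_integral) (simp add: case_prod_beta')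
    have ZS: "(\<lambda>p. indicator A (Z h (fst p ## snd p)) :: ennreal) \<in> borel_measurable (\<mu> \<Otimes>\<^sub>M S)" for h
      using measurable_compose[OF measurable_compose[OF measurable_Stream Z_meas] IA, of fst "\<mu> \<Otimes>\<^sub>M S" snd h] by simp
    have Zabs: "(\<lambda>(y, ys). indicator A \<bar>Z g ys - y\<bar> :: ennreal) \<in> borel_measurable (\<mu> \<Otimes>\<^sub>M S)" for g
    proof -
      have "(\<lambda>p. \<bar>Z g (snd p) - fst p\<bar>) \<in> borel_measurable (\<mu> \<Otimes>\<^sub>M S)"
        by (rule abs_vec_compose) (simp_all cong: measurable_cong_sets)
      from measurable_compose[OF this IA] show ?thesis by (simp add: case_prod_beta')
    qed
    interpret PS: pair_sigma_finite \<mu> S ..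
    have y_meas: "(\<lambda>y. \<integral>\<^sup>+ys. indicator A \<bar>Z g ys - y\<bar> \<partial>S) \<in> borel_measurable \<mu>" for g
      using Zabs[of g] by (intro S.borel_measurable_nn_integral)
    have yZ_meas: "(\<lambda>y. \<integral>\<^sup>+ys. indicator A (Z h (y ## ys)) \<partial>S) \<in> borel_measurable \<mu>" for h
      using ZS[of h] by (intro S.borel_measurable_nn_integral) (simp add: case_prod_beta')
    have "(\<integral>\<^sup>+x. emeasure \<mu> {y. \<bar>x - y\<bar> \<in> A} \<partial>\<nu>) = ?c * (\<Sum>g\<in>C. \<integral>\<^sup>+ys. \<integral>\<^sup>+y. indicator A \<bar>Z g ys - y\<bar> \<partial>\<mu> \<partial>S)"
      unfolding kernel_eq[OF A, symmetric] by (rule nn[OF ker_meas])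
    also have "(\<Sum>g\<in>C. \<integral>\<^sup>+ys. \<integral>\<^sup>+y. indicator A \<bar>Z g ys - y\<bar> \<partial>\<mu> \<partial>S) = (\<Sum>g\<in>C. \<integral>\<^sup>+y. \<integral>\<^sup>+ys. indicator A \<bar>Z g ys - y\<bar> \<partial>S \<partial>\<mu>)"
      by (intro sum.cong refl) (rule PS.Fubini'[OF Zabs])
    also have "\<dots> = (\<integral>\<^sup>+y. (\<Sum>g\<in>C. \<integral>\<^sup>+ys. indicator A \<bar>Z g ys - y\<bar> \<partial>S) \<partial>\<mu>)"
      using y_meas by (simp add: nn_integral_sum)
    also have "\<dots> = (\<integral>\<^sup>+y. (\<Sum>g\<in>C. \<integral>\<^sup>+ys. indicator A (Z g (y ## ys)) \<partial>S) \<partial>\<mu>)"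
    proof (rule nn_integral_cong_AE)
      have "AE y in \<mu>. \<forall>g\<in>C. AE ys in S. \<bar>Z g ys - y\<bar> = Z (g \<oplus> parity D y) (y ## ys)"
        using finite_C Z_step C_carrier by (intro AE_finite_allI) auto
      then show "AE y in \<mu>. (\<Sum>g\<in>C. \<integral>\<^sup>+ys. indicator A \<bar>Z g ys - y\<bar> \<partial>S) = (\<Sum>g\<in>C. \<integral>\<^sup>+ys. indicator A (Z g (y ## ys)) \<partial>S)"
        using AE_parity_supp
      proof eventually_elim
        case (elim y)
        have "(\<Sum>g\<in>C. \<integral>\<^sup>+ys. indicator A \<bar>Z g ys - y\<bar> \<partial>S) = (\<Sum>g\<in>C. \<integral>\<^sup>+ys. indicator A (Z (g \<oplus> parity D y) (y ## ys)) \<partial>S)"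
          using elim(1) by (intro sum.cong refl nn_integral_cong_AE) (auto elim!: AE_mp)
        also have "\<dots> = (\<Sum>g\<in>C. \<integral>\<^sup>+ys. indicator A (Z g (y ## ys)) \<partial>S)"
          using C_step[OF _ elim(2)] C_carrier parity_in_carrier[of y]
          by (intro sum.reindex_bij_witness[of C "\<lambda>g. g \<oplus> parity D y" "\<lambda>g. g \<oplus> parity D y"])
             (auto simp: parity_mult_cancel subset_iff)
        finally show ?case .
      qed
    qed
    also have "\<dots> = (\<Sum>g\<in>C. \<integral>\<^sup>+y. \<integral>\<^sup>+ys. indicator A (Z g (y ## ys)) \<partial>S \<partial>\<mu>)"
      using yZ_meas by (simp add: nn_integral_sum)
    also have "\<dots> = (\<Sum>g\<in>C. \<integral>\<^sup>+ys. indicator A (Z g ys) \<partial>S)"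
      using measurable_compose[OF Z_meas IA]
      by (intro sum.cong refl nn_integral_stream_space[symmetric])
    also have "?c * \<dots> = emeasure \<nu> A"
      using nn[OF IA] A by (simp add: sets_\<nu>)
    finally show ?thesis .
  qed
  ultimately have "invariant \<nu>" unfolding invariant_def using sets_\<nu> by simp
  then show ?thesis ..
qed

end

section \<open>Uniqueness, absorption and recurrence\<close>

text \<open>Open sets generate the Borel sets and are stable under intersection; the indicator of
  one is the limit of truncated multiples of the distance to its complement.\<close>

lemma measure_eqI_lipschitz:
  fixes \<nu>1 \<nu>2 :: "'a::{metric_space, second_countable_topology} measure"
  assumes "prob_space \<nu>1" "prob_space \<nu>2" and s1: "sets \<nu>1 = sets borel" and s2: "sets \<nu>2 = sets borel"
    and eq: "\<And>F L. (\<And>x. 0 \<le> F x \<and> F x \<le> 1) \<Longrightarrow> (\<And>x y. \<bar>F x - F y\<bar> \<le> L * dist x y) \<Longrightarrow>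
      (\<integral>x. F x \<partial>\<nu>1) = (\<integral>x. F x \<partial>\<nu>2)"
  shows "\<nu>1 = \<nu>2"
proof (rule measure_eqI_generator_eq[where E="{U. open U}" and \<Omega>=UNIV and A="\<lambda>_. UNIV"])
  interpret P1: prob_space \<nu>1 by fact
  interpret P2: prob_space \<nu>2 by fact
  have sp: "space \<nu>1 = UNIV" "space \<nu>2 = UNIV"
    using sets_eq_imp_space_eq[OF s1] sets_eq_imp_space_eq[OF s2] by simp_all
  fix U :: "'a set" assume "U \<in> {U. open U}"
  then have U: "open U" by simp
  show "emeasure \<nu>1 U = emeasure \<nu>2 U"
  proof (cases "U = UNIV")
    case True
    then show ?thesis using P1.emeasure_space_1 P2.emeasure_space_1 sp by simp
  next
    case False
    \<comment> \<open>This needs a nonempty complement: \<open>infdist\<close> to the empty set is 0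
      by convention, hence the separate case \<open>U = UNIV\<close>.\<close>
    define F where "F k x = min 1 (real k * infdist x (- U))" for k x
    have F01: "0 \<le> F k x \<and> F k x \<le> 1" for k x by (simp add: F_def infdist_nonneg)
    have FL: "\<bar>F k x - F k y\<bar> \<le> real k * dist x y" for k x y
    proof -
      have "\<bar>F k x - F k y\<bar> \<le> \<bar>real k * infdist x (- U) - real k * infdist y (- U)\<bar>"
        unfolding F_def by (simp add: min_def)
      also have "\<dots> = real k * \<bar>infdist x (- U) - infdist y (- U)\<bar>"
        by (simp add: abs_mult flip: right_diff_distrib)
      also have "\<dots> \<le> real k * dist x y" by (intro mult_left_mono infdist_triangle_abs) simp
      finally show ?thesis .
    qed
    have Fm: "F k \<in> borel_measurable borel" for k
      unfolding F_def by (intro borel_measurable_continuous_onI continuous_intros)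
    have lim: "(\<lambda>k. F k x) \<longlonglongrightarrow> indicator U x" for x
    proof (cases "x \<in> U")
      case True
      have "0 < infdist x (- U)"
        using True False U by (intro infdist_pos_not_in_closed) auto
      then obtain k0 where "1 / infdist x (- U) \<le> real k0" using real_arch_simple by blast
      then have k0: "1 \<le> real k0 * infdist x (- U)" using \<open>0 < infdist x (- U)\<close> by (simp add: field_simps)
      have "F k x = 1" if "k0 \<le> k" for k
      proof -
        have "real k0 * infdist x (- U) \<le> real k * infdist x (- U)"
          using that by (intro mult_right_mono) (auto simp: infdist_nonneg)
        then show ?thesis using k0 by (simp add: F_def)
      qed
      then show ?thesis using True by (intro tendsto_eventually) (auto simp: eventually_sequentially)
    next
      case False
      then have "F k x = 0" for k by (simp add: F_def)
      then show ?thesis using False by simp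
    qed
    have conv: "(\<lambda>k. \<integral>x. F k x \<partial>\<nu>) \<longlonglongrightarrow> measure \<nu> U" if \<nu>: "prob_space \<nu>" "sets \<nu> = sets borel" for \<nu>
    proof -
      interpret P: prob_space \<nu> by fact
      have "(\<lambda>k. \<integral>x. F k x \<partial>\<nu>) \<longlonglongrightarrow> (\<integral>x. indicator U x \<partial>\<nu>)"
      proof (rule integral_dominated_convergence[where w="\<lambda>_. 1"])
        show "F k \<in> borel_measurable \<nu>" for k using Fm by (simp add: measurable_cong_sets[OF \<nu>(2) refl])
        show "AE x in \<nu>. norm (F k x) \<le> 1" for k using F01 by simp
        show "(indicator U :: _ \<Rightarrow> real) \<in> borel_measurable \<nu>" using U by (intro borel_measurable_indicator) (simp add: \<nu>)
      qed (simp_all add: lim)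
      moreover have "U \<in> sets \<nu>" using U \<nu> by simp
      ultimately show ?thesis by simp
    qed
    have "(\<integral>x. F k x \<partial>\<nu>1) = (\<integral>x. F k x \<partial>\<nu>2)" for k by (rule eq[OF F01 FL])
    with conv[OF \<open>prob_space \<nu>1\<close> s1] conv[OF \<open>prob_space \<nu>2\<close> s2] have "measure \<nu>1 U = measure \<nu>2 U"
      using LIMSEQ_unique by auto
    then show ?thesis by (simp add: P1.emeasure_eq_measure P2.emeasure_eq_measure)
  qed
next
  show "Int_stable {U::'a set. open U}" by (auto simp: Int_stable_def)
  show "sets \<nu>1 = sigma_sets UNIV {U. open U}" "sets \<nu>2 = sigma_sets UNIV {U. open U}"
    using s1 s2 by (simp_all add: borel_def)
  interpret P1: prob_space \<nu>1 by fact
  show "emeasure \<nu>1 UNIV \<noteq> \<infinity>" by (simp add: P1.emeasure_eq_measure)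
qed auto

context refl_class
begin

section \<open>Stationarity and the masses of the parity cells\<close>

lemma invariant_nn_integral:
  assumes inv: "invariant \<nu>" and F: "F \<in> borel_measurable borel"
  shows "(\<integral>\<^sup>+x. \<integral>\<^sup>+y. F \<bar>x - y\<bar> \<partial>\<mu> \<partial>\<nu>) = (\<integral>\<^sup>+x. F x \<partial>\<nu>)"
proof -
  interpret N: prob_space \<nu> using inv by (simp add: invariant_def)
  have s [measurable_cong]: "sets \<nu> = sets borel" using inv by (simp add: invariant_def)
  have m: "(\<lambda>p. \<bar>fst p - snd p\<bar>) \<in> borel_measurable (\<nu> \<Otimes>\<^sub>M \<mu>)"
    by (rule abs_vec_compose) (simp_all cong: measurable_cong_sets)
  have fub: "(\<integral>\<^sup>+p. H \<bar>fst p - snd p\<bar> \<partial>(\<nu> \<Otimes>\<^sub>M \<mu>)) = (\<integral>\<^sup>+x. \<integral>\<^sup>+y. H \<bar>x - y\<bar> \<partial>\<mu> \<partial>\<nu>)"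
    if H: "H \<in> borel_measurable borel" for H
    using nn_integral_fst[OF measurable_compose[OF m H]] by simp
  have "distr (\<nu> \<Otimes>\<^sub>M \<mu>) borel (\<lambda>p. \<bar>fst p - snd p\<bar>) = \<nu>"
  proof (rule measure_eqI)
    fix A assume "A \<in> sets (distr (\<nu> \<Otimes>\<^sub>M \<mu>) borel (\<lambda>p. \<bar>fst p - snd p\<bar>))"
    then have A: "A \<in> sets borel" by simp
    have IA: "(indicator A :: _ \<Rightarrow> ennreal) \<in> borel_measurable borel" by (rule borel_measurable_indicator[OF A])
    have "emeasure (distr (\<nu> \<Otimes>\<^sub>M \<mu>) borel (\<lambda>p. \<bar>fst p - snd p\<bar>)) A =
        (\<integral>\<^sup>+x. indicator A x \<partial>distr (\<nu> \<Otimes>\<^sub>M \<mu>) borel (\<lambda>p. \<bar>fst p - snd p\<bar>))"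
      using A by simp
    also have "\<dots> = (\<integral>\<^sup>+p. indicator A \<bar>fst p - snd p\<bar> \<partial>(\<nu> \<Otimes>\<^sub>M \<mu>))"
      by (rule nn_integral_distr[OF m]) (use A in simp)
    also have "\<dots> = (\<integral>\<^sup>+x. emeasure \<mu> {y. \<bar>x - y\<bar> \<in> A} \<partial>\<nu>)"
      by (simp only: fub[OF IA] kernel_eq[OF A])
    also have "\<dots> = emeasure \<nu> A" using inv A by (simp add: invariant_def)
    finally show "emeasure (distr (\<nu> \<Otimes>\<^sub>M \<mu>) borel (\<lambda>p. \<bar>fst p - snd p\<bar>)) A = emeasure \<nu> A" .
  qed (simp add: s)
  then have "(\<integral>\<^sup>+x. F x \<partial>\<nu>) = (\<integral>\<^sup>+x. F x \<partial>distr (\<nu> \<Otimes>\<^sub>M \<mu>) borel (\<lambda>p. \<bar>fst p - snd p\<bar>))" by simp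
  also have "\<dots> = (\<integral>\<^sup>+p. F \<bar>fst p - snd p\<bar> \<partial>(\<nu> \<Otimes>\<^sub>M \<mu>))"
    by (rule nn_integral_distr[OF m]) (use F in simp)
  finally show ?thesis by (simp add: fub[OF F])
qed

lemma nn_integral_X_meas:
  assumes F: "F \<in> borel_measurable borel"
  shows "(\<lambda>x. \<integral>\<^sup>+ys. F (X n x ys) \<partial>S) \<in> borel_measurable borel"
proof -
  have "(\<lambda>p. X n (fst p) (snd p)) \<in> borel_measurable (borel \<Otimes>\<^sub>M S)"
    by (intro X_meas) simp_all
  from measurable_compose[OF this F] show ?thesis
    by (intro S.borel_measurable_nn_integral) (simp add: case_prod_beta')
qed

lemma invariant_flow:
  assumes inv: "invariant \<nu>" and F: "F \<in> borel_measurable borel"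
  shows "(\<integral>\<^sup>+x. \<integral>\<^sup>+ys. F (X n x ys) \<partial>S \<partial>\<nu>) = (\<integral>\<^sup>+x. F x \<partial>\<nu>)"
proof (induction n)
  case 0
  then show ?case by simp
next
  case (Suc n)
  have "(\<integral>\<^sup>+ys. F (X (Suc n) x ys) \<partial>S) = (\<integral>\<^sup>+y. \<integral>\<^sup>+ys. F (X n \<bar>x - y\<bar> ys) \<partial>S \<partial>\<mu>)" for x
  proof -
    have "(\<lambda>ys. X (Suc n) x ys) \<in> borel_measurable S" by (intro X_meas) simp_all
    from measurable_compose[OF this F] show ?thesis
      by (subst nn_integral_stream_space) simp_all
  qed
  then show ?case
    using invariant_nn_integral[OF inv nn_integral_X_meas[OF F, of n]] Suc by (simp del: flow.simps)
qed

lemma invariant_AE_K: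
  assumes inv: "invariant \<nu>" shows "AE x in \<nu>. x \<in> K"
proof -
  interpret N: prob_space \<nu> using inv by (simp add: invariant_def)
  have "K \<in> sets \<nu>" "emeasure \<nu> K = 1" using inv K_sets by (auto simp: invariant_def)
  then show ?thesis by (intro N.AE_prob_1) (simp add: N.emeasure_eq_measure)
qed

lemma cell_mass:
  assumes inv: "invariant \<nu>" and g: "g \<in> carrier G"
  shows "emeasure \<nu> (cell g) = (\<integral>\<^sup>+y. emeasure \<nu> (cell (g \<oplus> parity D y)) \<partial>\<mu>)"
proof -
  interpret N: prob_space \<nu> using inv by (simp add: invariant_def)
  interpret PS: pair_sigma_finite \<nu> \<mu> ..
  have s [measurable_cong]: "sets \<nu> = sets borel" using inv by (simp add: invariant_def)
  have I: "(indicator (cell g) :: _ \<Rightarrow> ennreal) \<in> borel_measurable borel"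
    by (rule borel_measurable_indicator) (simp add: closed_cell)
  have m: "(\<lambda>p. \<bar>fst p - snd p\<bar>) \<in> borel_measurable (\<nu> \<Otimes>\<^sub>M \<mu>)"
    by (rule abs_vec_compose) (simp_all cong: measurable_cong_sets)
  have cs: "cell h \<in> sets \<nu>" for h by (simp add: s closed_cell)
  have "emeasure \<nu> (cell g) = (\<integral>\<^sup>+x. \<integral>\<^sup>+y. indicator (cell g) \<bar>x - y\<bar> \<partial>\<mu> \<partial>\<nu>)"
    using invariant_nn_integral[OF inv I] cs[of g] by simp
  also have "\<dots> = (\<integral>\<^sup>+y. \<integral>\<^sup>+x. indicator (cell g) \<bar>x - y\<bar> \<partial>\<nu> \<partial>\<mu>)"
    using measurable_compose[OF m I] by (intro PS.Fubini'[symmetric]) (simp add: case_prod_beta')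
  also have "\<dots> = (\<integral>\<^sup>+y. emeasure \<nu> (cell (g \<oplus> parity D y)) \<partial>\<mu>)"
  proof (rule nn_integral_cong_AE)
    show "AE y in \<mu>. (\<integral>\<^sup>+x. indicator (cell g) \<bar>x - y\<bar> \<partial>\<nu>) = emeasure \<nu> (cell (g \<oplus> parity D y))"
      using int_law
    proof eventually_elim
      case (elim y)
      have "(\<integral>\<^sup>+x. indicator (cell g) \<bar>x - y\<bar> \<partial>\<nu>) = (\<integral>\<^sup>+x. indicator (cell (g \<oplus> parity D y)) x \<partial>\<nu>)"
      proof (rule nn_integral_cong_AE)
        show "AE x in \<nu>. indicator (cell g) \<bar>x - y\<bar> = (indicator (cell (g \<oplus> parity D y)) x :: ennreal)"
          using invariant_AE_K[OF inv]
        proof eventually_elim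
          case (elim x)
          then have x: "x \<in> state_space D" by (simp add: K_def)
          have "\<bar>x - y\<bar> \<in> cell g \<longleftrightarrow> x \<in> cell (g \<oplus> parity D y)"
            using parity_step[OF x \<open>\<forall>i\<in>D. y $ i \<in> \<int>\<close>] x parity_mult_eq_iff[OF parity_in_carrier parity_in_carrier g]
            by (simp add: cell_def)
          then show ?case by (simp add: indicator_def)
        qed
      qed
      then show ?case using cs by simp
    qed
  qed
  finally show ?thesis .
qed

text \<open>Maximum principle: by \<open>cell_mass\<close> the mass of a cell is the mean of the
  masses of its neighbours. So the maximisers in \<open>C\<close> are closed under adding parities
  of the support, hence under the subgroup, which acts transitively on \<open>C\<close>.\<close>

lemma cell_mass_const:
  assumes inv: "invariant \<nu>" and g: "g \<in> C"
  shows "measure \<nu> (cell g) = 1 / real (card C)"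
proof -
  interpret N: prob_space \<nu> using inv by (simp add: invariant_def)
  have s: "sets \<nu> = sets borel" using inv by (simp add: invariant_def)
  let ?m = "\<lambda>g. measure \<nu> (cell g)"
  define Mx where "Mx = {g \<in> C. \<forall>h\<in>C. ?m h \<le> ?m g}"
  have step: "g \<oplus> t \<in> Mx" if g: "g \<in> Mx" and t: "t \<in> parity_supp \<mu> D" for g t
  proof -
    have gC: "g \<in> C" using g by (simp add: Mx_def)
    then have gG: "g \<in> carrier G" using C_carrier by auto
    have meas: "(\<lambda>y. ?m (g \<oplus> parity D y)) \<in> borel_measurable \<mu>"
    proof (rule measurable_compose[OF parity_measurable[OF sets_noise]])
      show "(\<lambda>h. ?m (g \<oplus> h)) \<in> borel_measurable (count_space (carrier G))" by simp
    qed
    have le: "AE y in \<mu>. ?m (g \<oplus> parity D y) \<le> ?m g"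
      using AE_parity_supp by eventually_elim (use C_step[OF gC] g in \<open>auto simp: Mx_def\<close>)
    have int: "integrable \<mu> (\<lambda>y. ?m (g \<oplus> parity D y))"
      using meas by (intro integrable_const_bound[of _ 1]) auto
    have "ennreal (?m g) = (\<integral>\<^sup>+y. ennreal (?m (g \<oplus> parity D y)) \<partial>\<mu>)"
      using cell_mass[OF inv gG] by (simp add: N.emeasure_eq_measure)
    also have "\<dots> = ennreal (\<integral>y. ?m (g \<oplus> parity D y) \<partial>\<mu>)"
      by (rule nn_integral_eq_integral[OF int]) simp
    finally have "?m g = (\<integral>y. ?m (g \<oplus> parity D y) \<partial>\<mu>)"
      by (subst (asm) ennreal_inj) (auto intro: integral_nonneg_AE)
    then have "(\<integral>y. ?m g - ?m (g \<oplus> parity D y) \<partial>\<mu>) = 0"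
      using int prob_space by (subst Bochner_Integration.integral_diff) auto
    moreover have "integrable \<mu> (\<lambda>y. ?m g - ?m (g \<oplus> parity D y))" using int by simp
    moreover have "AE y in \<mu>. 0 \<le> ?m g - ?m (g \<oplus> parity D y)" using le by eventually_elim simp
    ultimately have "AE y in \<mu>. ?m g - ?m (g \<oplus> parity D y) = 0"
      using integral_nonneg_eq_0_iff_AE by blast
    then have eq: "AE y in \<mu>. ?m (g \<oplus> parity D y) = ?m g" by eventually_elim simp
    have "?m (g \<oplus> t) = ?m g"
    proof (rule ccontr)
      assume ne: "?m (g \<oplus> t) \<noteq> ?m g"
      have "AE y in \<mu>. y \<notin> {y. parity D y = t}" using eq by eventually_elim (use ne in auto)
      then have "emeasure \<mu> {y. parity D y = t} = 0"
        using parity_sets by (subst (asm) AE_iff_measurable[OF _ refl]) auto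
      then show False using t by (simp add: parity_supp_iff)
    qed
    then show ?thesis using g C_step[OF gC t] by (simp add: Mx_def)
  qed
  have Mx_G: "g \<in> carrier G" if "g \<in> Mx" for g using that C_carrier by (auto simp: Mx_def)
  have gen: "g \<oplus> h \<in> Mx" if "h \<in> parity_subgroup \<mu> D" "g \<in> Mx" for g h
    using that unfolding parity_subgroup_def
  proof (induction h arbitrary: g rule: generate.induct)
    case one
    then show ?case using Mx_G by simp
  next
    case (incl h)
    then show ?case using step by simp
  next
    case (inv h)
    then have "h \<in> carrier G" by (simp add: parity_supp_def)
    then show ?case using inv step by (simp add: parity_self_inv)
  next
    case (eng h1 h2)
    have "parity_supp \<mu> D \<subseteq> carrier G" by (auto simp: parity_supp_def)
    note car = G.generate_in_carrier[OF this]
    have "(g \<oplus> h1) \<oplus> h2 \<in> Mx" by (intro eng.IH eng.prems)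
    then show ?case by (simp only: G.m_assoc Mx_G[OF eng.prems] car[OF eng.hyps(1)] car[OF eng.hyps(2)])
  qed
  obtain g0 where g0: "g0 \<in> Mx"
  proof -
    have "Max (?m ` C) \<in> ?m ` C" using finite_C C_nonempty by (intro Max_in) auto
    then obtain g where "g \<in> C" "?m g = Max (?m ` C)" by auto
    then show ?thesis using finite_C by (intro that[of g]) (auto simp: Mx_def)
  qed
  have "h \<in> Mx" if "h \<in> C" for h
  proof -
    have "g0 \<in> C" using g0 by (simp add: Mx_def)
    from C_trans[OF that this] obtain k where "k \<in> parity_subgroup \<mu> D" "h = g0 \<oplus> k" by blast
    then show ?thesis using gen[OF _ g0] by simp
  qed
  then have const: "?m h = ?m g" if "h \<in> C" for h using that g by (auto simp: Mx_def intro: antisym)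
  have "cell h \<in> sets \<nu>" for h by (simp add: s closed_cell)
  then have cs: "cell ` C \<subseteq> sets \<nu>" by blast
  have dis: "disjoint_family_on cell C" by (auto simp: disjoint_family_on_def cell_def)
  have "1 = measure \<nu> K" using inv by (simp add: invariant_def N.emeasure_eq_measure)
  also have "\<dots> = (\<Sum>h\<in>C. ?m h)"
    unfolding K_eq by (rule N.finite_measure_finite_Union[OF finite_C cs dis])
  also have "\<dots> = real (card C) * ?m g" using const by simp
  finally show ?thesis using finite_C C_nonempty by (simp add: field_simps)
qed

text \<open>The sequence does not involve \<open>\<nu>\<close>, so its limit determines the
  integrals against \<open>\<nu>\<close>. Stationarity lets \<open>T n\<close> replace
  \<open>F\<close>, contraction moves each starting point to the representative of its cell, and the
  weights of the cells are known.\<close>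

lemma invariant_limit:
  fixes F :: "real ^ 'n \<Rightarrow> real"
  assumes inv: "invariant \<nu>" and F01: "\<And>x. 0 \<le> F x \<and> F x \<le> 1"
    and FL: "\<And>x y. \<bar>F x - F y\<bar> \<le> L * dist x y"
  shows "(\<lambda>n. (\<Sum>g\<in>C. \<integral>ys. F (X n (parity_point g) ys) \<partial>S) / real (card C)) \<longlonglongrightarrow> (\<integral>x. F x \<partial>\<nu>)"
proof -
  interpret N: prob_space \<nu> using inv by (simp add: invariant_def)
  have s [measurable_cong]: "sets \<nu> = sets borel" using inv by (simp add: invariant_def)
  have L: "0 \<le> L"
  proof (rule ccontr)
    assume "\<not> 0 \<le> L"
    then have "L * dist (0 :: real ^ 'n) (\<chi> i. 1) < 0"
      by (intro mult_neg_pos) (auto simp: vec_eq_iff)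
    then show False using FL[of 0 "\<chi> i. 1"] by linarith
  qed
  have "continuous_on UNIV F"
    using FL L by (intro lipschitz_on_continuous_on[of L] lipschitz_onI) (auto simp: dist_real_def)
  then have Fm: "F \<in> borel_measurable borel" by (rule borel_measurable_continuous_onI)
  have FX: "(\<lambda>ys. F (X n x ys)) \<in> borel_measurable S" for n x
  proof -
    have "(\<lambda>ys. X n x ys) \<in> borel_measurable S" by (intro X_meas) simp_all
    from measurable_compose[OF this Fm] show ?thesis .
  qed
  have FX_int: "integrable S (\<lambda>ys. F (X n x ys))" for n x
    using F01 FX by (intro S.integrable_const_bound[of _ 1]) auto
  define T where "T n x = (\<integral>ys. F (X n x ys) \<partial>S)" for n x
  have T01: "0 \<le> T n x \<and> T n x \<le> 1" for n x
  proof -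
    have "T n x \<le> (\<integral>ys. 1 \<partial>S)" unfolding T_def using F01 FX_int by (intro integral_mono) auto
    then show ?thesis using S.prob_space F01 unfolding T_def by (auto intro!: integral_nonneg_AE)
  qed
  have T_nn: "ennreal (T n x) = (\<integral>\<^sup>+ys. ennreal (F (X n x ys)) \<partial>S)" for n x
    unfolding T_def using F01 by (intro nn_integral_eq_integral[symmetric] FX_int) auto
  have Tm: "T n \<in> borel_measurable borel" for n
  proof -
    have "(\<lambda>x. \<integral>\<^sup>+ys. ennreal (F (X n x ys)) \<partial>S) \<in> borel_measurable borel"
      using Fm by (intro nn_integral_X_meas) simp
    then have "(\<lambda>x. enn2real (ennreal (T n x))) \<in> borel_measurable borel" unfolding T_nn by simp
    then show ?thesis using T01 by simp
  qed
  have T_int: "integrable \<nu> (T n)" for n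
    using T01 Tm by (intro N.integrable_const_bound[of _ 1]) auto
  have T_inv: "(\<integral>x. T n x \<partial>\<nu>) = (\<integral>x. F x \<partial>\<nu>)" for n
  proof -
    have "ennreal (\<integral>x. T n x \<partial>\<nu>) = (\<integral>\<^sup>+x. ennreal (T n x) \<partial>\<nu>)"
      using T01 by (intro nn_integral_eq_integral[symmetric] T_int) auto
    also have "\<dots> = (\<integral>\<^sup>+x. ennreal (F x) \<partial>\<nu>)"
      unfolding T_nn using Fm by (intro invariant_flow[OF inv]) simp
    also have "\<dots> = ennreal (\<integral>x. F x \<partial>\<nu>)"
      using F01 Fm by (intro nn_integral_eq_integral N.integrable_const_bound[of _ 1]) auto
    finally show ?thesis
      using T01 F01 by (subst (asm) ennreal_inj) (auto intro!: integral_nonneg_AE)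
  qed
  \<comment> \<open>\<open>T n\<close> with the starting point replaced by the
    \<open>parity_point\<close> of its cell, and 0 off the class.\<close>
  define R where "R n x = (\<Sum>g\<in>C. indicator (cell g) x * T n (parity_point g))" for n x
  have cs: "cell g \<in> sets \<nu>" for g by (simp add: s closed_cell)
  have Rm: "R n \<in> borel_measurable \<nu>" for n
    unfolding R_def using cs by (intro borel_measurable_sum borel_measurable_times borel_measurable_indicator) auto
  have R_eq: "R n x = T n (parity_point g)" if "x \<in> cell g" "g \<in> C" for n x g
  proof -
    have "R n x = (\<Sum>h\<in>C. if h = g then T n (parity_point g) else 0)"
      unfolding R_def using that by (intro sum.cong) (auto simp: cell_def indicator_def)
    then show ?thesis using that finite_C by simp
  qed
  have R_int: "(\<integral>x. R n x \<partial>\<nu>) = (\<Sum>g\<in>C. T n (parity_point g)) / real (card C)" for n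
  proof -
    have "(\<integral>x. R n x \<partial>\<nu>) = (\<Sum>g\<in>C. \<integral>x. indicator (cell g) x * T n (parity_point g) \<partial>\<nu>)"
      unfolding R_def using cs by (intro Bochner_Integration.integral_sum) (auto simp: N.emeasure_eq_measure)
    also have "\<dots> = (\<Sum>g\<in>C. 1 / real (card C) * T n (parity_point g))"
      using cs cell_mass_const[OF inv] by (intro sum.cong) auto
    finally show ?thesis by (simp add: sum_divide_distrib)
  qed
  have "(\<lambda>n. \<integral>x. T n x - R n x \<partial>\<nu>) \<longlonglongrightarrow> (\<integral>x. 0 \<partial>\<nu>)"
  proof (rule integral_dominated_convergence[where w="\<lambda>_. 1"])
    show "(\<lambda>x. T n x - R n x) \<in> borel_measurable \<nu>" for n
      using Tm Rm by (intro borel_measurable_diff) (simp_all add: measurable_cong_sets[OF s refl])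
    show "AE x in \<nu>. norm (T n x - R n x) \<le> 1" for n
      using invariant_AE_K[OF inv]
    proof eventually_elim
      case (elim x)
      then obtain g where "g \<in> C" "x \<in> cell g" by (auto simp: K_eq)
      then have "R n x = T n (parity_point g)" by (intro R_eq)
      then show ?case using T01[of n x] T01[of n "parity_point g"] by (simp add: abs_le_iff)
    qed
    show "AE x in \<nu>. (\<lambda>n. T n x - R n x) \<longlonglongrightarrow> 0"
      using invariant_AE_K[OF inv]
    proof eventually_elim
      case (elim x)
      then obtain g where g: "g \<in> C" "x \<in> cell g" by (auto simp: K_eq)
      then have pg: "parity_point g \<in> cell g" using C_carrier by (intro parity_point_cell) auto
      have "(\<lambda>n. \<integral>ys. F (X n x ys) - F (X n (parity_point g) ys) \<partial>S) \<longlonglongrightarrow> (\<integral>ys. 0 \<partial>S)"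
      proof (rule integral_dominated_convergence[where w="\<lambda>_. 1"])
        show "(\<lambda>ys. F (X n x ys) - F (X n (parity_point g) ys)) \<in> borel_measurable S" for n
          by (intro borel_measurable_diff FX)
        show "AE ys in S. norm (F (X n x ys) - F (X n (parity_point g) ys)) \<le> 1" for n
        proof (rule AE_I2)
          fix ys
          show "norm (F (X n x ys) - F (X n (parity_point g) ys)) \<le> 1"
            using F01[of "X n x ys"] F01[of "X n (parity_point g) ys"] by (simp add: abs_le_iff)
        qed
        show "AE ys in S. (\<lambda>n. F (X n x ys) - F (X n (parity_point g) ys)) \<longlonglongrightarrow> 0"
          using contract_AE[OF g(2) pg]
        proof eventually_elim
          case (elim ys)
          have "(\<lambda>n. L * dist (X n x ys) (X n (parity_point g) ys)) \<longlonglongrightarrow> 0"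
            using tendsto_mult_right_zero[OF elim, of L] .
          moreover have "norm (F (X n x ys) - F (X n (parity_point g) ys)) \<le> L * dist (X n x ys) (X n (parity_point g) ys)" for n
            using FL by simp
          ultimately show ?case by (rule Lim_null_comparison[OF always_eventually[OF allI], rotated])
        qed
      qed simp_all
      then have "(\<lambda>n. T n x - T n (parity_point g)) \<longlonglongrightarrow> 0"
        unfolding T_def using FX_int by simp
      then show ?case by (simp only: R_eq[OF g(2,1)])
    qed
  qed simp_all
  then have lim: "(\<lambda>n. \<integral>x. T n x - R n x \<partial>\<nu>) \<longlonglongrightarrow> 0" by simp
  have R_integrable: "integrable \<nu> (R n)" for n
    unfolding R_def using cs by (intro Bochner_Integration.integrable_sum) (auto simp: N.emeasure_eq_measure)
  have eq: "(\<integral>x. T n x - R n x \<partial>\<nu>) = (\<integral>x. F x \<partial>\<nu>) - (\<Sum>g\<in>C. T n (parity_point g)) / real (card C)" for n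
    by (subst Bochner_Integration.integral_diff[OF T_int R_integrable]) (simp add: T_inv R_int)
  have "(\<lambda>n. (\<integral>x. F x \<partial>\<nu>) - (\<integral>x. T n x - R n x \<partial>\<nu>)) \<longlonglongrightarrow> (\<integral>x. F x \<partial>\<nu>) - 0"
    by (intro tendsto_diff tendsto_const lim)
  then show ?thesis unfolding eq by (simp add: T_def)
qed

lemma invariant_unique:
  assumes "invariant \<nu>1" "invariant \<nu>2"
  shows "\<nu>1 = \<nu>2"
proof (rule measure_eqI_lipschitz)
  fix F :: "real ^ 'n \<Rightarrow> real" and L
  assume F: "\<And>x. 0 \<le> F x \<and> F x \<le> 1" "\<And>x y. \<bar>F x - F y\<bar> \<le> L * dist x y"
  show "(\<integral>x. F x \<partial>\<nu>1) = (\<integral>x. F x \<partial>\<nu>2)"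
    by (rule LIMSEQ_unique[OF invariant_limit[OF assms(1) F] invariant_limit[OF assms(2) F]])
qed (use assms in \<open>auto simp: invariant_def\<close>)

text \<open>By stationarity the walk from almost every point stays in the support forever. Each cell
  of the class has positive mass, so the cell of \<open>x\<close> contains such a point, and the two
  walks approach each other.\<close>

lemma invariant_absorbs:
  assumes inv: "invariant \<nu>" and x: "x \<in> K"
  shows "AE ys in S. (\<lambda>n. infdist (X n x ys) (supp \<nu>)) \<longlonglongrightarrow> 0"
proof -
  interpret N: prob_space \<nu> using inv by (simp add: invariant_def)
  have s: "sets \<nu> = sets borel" using inv by (simp add: invariant_def)
  obtain N where N: "N \<in> null_sets \<nu>" "- supp \<nu> = N" using null_outside_supp[OF s] by blast
  have Nb: "N \<in> sets borel" using N s by (auto simp: null_sets_def)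
  have IN: "(indicator N :: _ \<Rightarrow> ennreal) \<in> borel_measurable borel" by (rule borel_measurable_indicator[OF Nb])
  have "AE z in \<nu>. \<forall>n. AE ys in S. X n z ys \<in> supp \<nu>"
    unfolding AE_all_countable
  proof
    fix n
    have "(\<integral>\<^sup>+z. \<integral>\<^sup>+ys. indicator N (X n z ys) \<partial>S \<partial>\<nu>) = 0"
      using invariant_flow[OF inv IN] N by (simp add: null_sets_def)
    then have "AE z in \<nu>. (\<integral>\<^sup>+ys. indicator N (X n z ys) \<partial>S) = 0"
      using nn_integral_X_meas[OF IN, of n] by (subst (asm) nn_integral_0_iff_AE) (simp_all add: measurable_cong_sets[OF s refl])
    then show "AE z in \<nu>. AE ys in S. X n z ys \<in> supp \<nu>"
    proof eventually_elim
      case (elim z)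
      have "(\<lambda>ys. X n z ys) \<in> borel_measurable S" by (intro X_meas) simp_all
      from measurable_compose[OF this IN] elim have "AE ys in S. indicator N (X n z ys) = (0 :: ennreal)"
        by (subst (asm) nn_integral_0_iff_AE) simp_all
      then show ?case by eventually_elim (use N(2) in \<open>auto simp: indicator_def split: if_splits\<close>)
    qed
  qed
  then have AEz: "AE z in \<nu>. AE ys in S. \<forall>n. X n z ys \<in> supp \<nu>"
    by eventually_elim (rule AE_all_countable[THEN iffD2])
  obtain g where g: "g \<in> C" "x \<in> cell g" using x by (auto simp: K_eq)
  have "\<exists>z\<in>cell g. AE ys in S. \<forall>n. X n z ys \<in> supp \<nu>"
  proof (rule ccontr)
    assume none: "\<not> ?thesis"
    have "AE z in \<nu>. z \<notin> cell g" using AEz by eventually_elim (use none in blast)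
    then have "emeasure \<nu> (cell g) = 0"
      by (subst (asm) AE_iff_measurable[OF _ refl]) (auto simp: s closed_cell sets_eq_imp_space_eq[OF s])
    then have "measure \<nu> (cell g) = 0" by (simp add: measure_def)
    moreover have "0 < measure \<nu> (cell g)"
      using cell_mass_const[OF inv g(1)] finite_C C_nonempty by (simp add: card_gt_0_iff)
    ultimately show False by simp
  qed
  then obtain z where z: "z \<in> cell g" "AE ys in S. \<forall>n. X n z ys \<in> supp \<nu>" by blast
  show ?thesis using contract_AE[OF g(2) z(1)] z(2)
  proof eventually_elim
    case (elim ys)
    have "norm (infdist (X n x ys) (supp \<nu>)) \<le> dist (X n x ys) (X n z ys)" for n
      using infdist_le[of "X n z ys" "supp \<nu>" "X n x ys"] elim(2) by (simp add: infdist_nonneg)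
    then show ?case by (rule Lim_null_comparison[OF always_eventually[OF allI] elim(1)])
  qed
qed

section \<open>Return times under an invariant measure\<close>

lemma return_time_meas:
  assumes U: "open U"
  shows "(\<lambda>p. if \<forall>j\<in>{1..n}. X j (fst p) (snd p) \<notin> U then 1 else 0 :: ennreal) \<in> borel_measurable (borel \<Otimes>\<^sub>M S)"
proof -
  have [measurable]: "(\<lambda>p. X j (fst p) (snd p)) \<in> borel_measurable (borel \<Otimes>\<^sub>M S)" for j
    by (intro X_meas) simp_all
  have [measurable]: "U \<in> sets borel" using U by simp
  show ?thesis by measurable
qed

text \<open>
  By stationarity, the survival probabilities integrated over \<open>V\<close> form a telescoping series.
\<close>

lemma kac:
  assumes inv: "invariant \<nu>" and V: "open V"
  shows "(\<integral>\<^sup>+x. indicator V x * (\<integral>\<^sup>+ys. return_time (\<lambda>n. X n x ys) V \<partial>S) \<partial>\<nu>) \<le> 1"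
proof -
  interpret N: prob_space \<nu> using inv by (simp add: invariant_def)
  have s: "sets \<nu> = sets borel" using inv by (simp add: invariant_def)
  have Vb: "V \<in> sets borel" using V by simp
  have cV: "- V \<in> sets borel" using sets.compl_sets[OF Vb] by (simp add: Compl_eq_Diff_UNIV)
  have IV: "(indicator V :: _ \<Rightarrow> ennreal) \<in> borel_measurable \<nu>"
    by (rule borel_measurable_indicator) (simp add: s Vb)
  define h where "h n x = (\<integral>\<^sup>+ys. (if \<forall>j\<in>{1..n}. X j x ys \<notin> V then 1 else 0) \<partial>S)" for n x
  have hm: "h n \<in> borel_measurable borel" for n
    unfolding h_def using return_time_meas[OF V, of n]
    by (intro S.borel_measurable_nn_integral) (simp add: case_prod_beta')
  have hm': "h n \<in> borel_measurable \<nu>" for n using hm by (simp add: measurable_cong_sets[OF s refl])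
  have hS: "(\<lambda>ys. if \<forall>j\<in>{1..n}. X j x ys \<notin> V then 1 else 0 :: ennreal) \<in> borel_measurable S" for n x
    using measurable_compose[OF _ return_time_meas[OF V, of n], of "\<lambda>ys. (x, ys)" S] by simp
  have h_Suc: "h (Suc n) x = (\<integral>\<^sup>+y. indicator (- V) \<bar>x - y\<bar> * h n \<bar>x - y\<bar> \<partial>\<mu>)" for n x
  proof -
    have eq: "(\<forall>j\<in>{1..Suc n}. X j x (y ## ys) \<notin> V) \<longleftrightarrow> \<bar>x - y\<bar> \<notin> V \<and> (\<forall>j\<in>{1..n}. X j \<bar>x - y\<bar> ys \<notin> V)" for y ys
      unfolding all_Suc_shift by simp
    have "h (Suc n) x = (\<integral>\<^sup>+y. \<integral>\<^sup>+ys. (if \<forall>j\<in>{1..Suc n}. X j x (y ## ys) \<notin> V then 1 else 0) \<partial>S \<partial>\<mu>)"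
      unfolding h_def by (rule nn_integral_stream_space[OF hS])
    also have "\<dots> = (\<integral>\<^sup>+y. indicator (- V) \<bar>x - y\<bar> * h n \<bar>x - y\<bar> \<partial>\<mu>)"
      unfolding eq h_def by (intro nn_integral_cong) (auto simp: indicator_def)
    finally show ?thesis .
  qed
  \<comment> \<open>Under \<open>\<nu>\<close> the position after one step again has law
    \<open>\<nu>\<close>; avoiding \<open>V\<close> for \<open>n + 1\<close> steps thus has the same
    weight as starting outside \<open>V\<close> and avoiding it for \<open>n\<close> steps.\<close>
  have t_Suc: "(\<integral>\<^sup>+x. h n x \<partial>\<nu>) = (\<integral>\<^sup>+x. indicator V x * h n x \<partial>\<nu>) + (\<integral>\<^sup>+x. h (Suc n) x \<partial>\<nu>)" for n
  proof -
    have "(\<integral>\<^sup>+x. h (Suc n) x \<partial>\<nu>) = (\<integral>\<^sup>+x. indicator (- V) x * h n x \<partial>\<nu>)"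
      unfolding h_Suc
      by (rule invariant_nn_integral[OF inv]) (intro borel_measurable_times_ennreal hm borel_measurable_indicator cV)
    moreover have "(\<integral>\<^sup>+x. h n x \<partial>\<nu>) = (\<integral>\<^sup>+x. indicator V x * h n x + indicator (- V) x * h n x \<partial>\<nu>)"
      by (intro nn_integral_cong) (auto simp: indicator_def)
    moreover have "\<dots> = (\<integral>\<^sup>+x. indicator V x * h n x \<partial>\<nu>) + (\<integral>\<^sup>+x. indicator (- V) x * h n x \<partial>\<nu>)"
      by (rule nn_integral_add; intro borel_measurable_times_ennreal hm' borel_measurable_indicator) (simp_all only: s Vb cV)
    ultimately show ?thesis by simp
  qed
  have "(\<Sum>k<n. \<integral>\<^sup>+x. indicator V x * h k x \<partial>\<nu>) + (\<integral>\<^sup>+x. h n x \<partial>\<nu>) = 1" for n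
  proof (induction n)
    case 0
    show ?case using N.emeasure_space_1 by (simp add: h_def)
  next
    case (Suc n)
    then show ?case using t_Suc[of n] by (simp add: add_ac)
  qed
  then have "(\<Sum>k<n. \<integral>\<^sup>+x. indicator V x * h k x \<partial>\<nu>) \<le> 1" for n
    by (metis le_iff_add)
  then have sum: "(\<Sum>k. \<integral>\<^sup>+x. indicator V x * h k x \<partial>\<nu>) \<le> 1"
    by (intro suminf_le_const) auto
  have ret: "(\<integral>\<^sup>+ys. return_time (\<lambda>n. X n x ys) V \<partial>S) = (\<Sum>k. h k x)" for x
    unfolding return_time_eq_suminf h_def by (rule nn_integral_suminf[OF hS])
  have "(\<integral>\<^sup>+x. indicator V x * (\<integral>\<^sup>+ys. return_time (\<lambda>n. X n x ys) V \<partial>S) \<partial>\<nu>) = (\<integral>\<^sup>+x. (\<Sum>k. indicator V x * h k x) \<partial>\<nu>)"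
    unfolding ret by simp
  also have "\<dots> = (\<Sum>k. \<integral>\<^sup>+x. indicator V x * h k x \<partial>\<nu>)"
    by (rule nn_integral_suminf) (intro borel_measurable_times_ennreal hm' IV)
  finally show ?thesis using sum by simp
qed

lemma invariant_recurrent:
  assumes inv: "invariant \<nu>" and U: "open U" and x: "x \<in> U" "x \<in> supp \<nu>"
  shows "(\<integral>\<^sup>+ys. return_time (\<lambda>n. X n x ys) U \<partial>S) < \<infinity>"
proof -
  interpret N: prob_space \<nu> using inv by (simp add: invariant_def)
  have s: "sets \<nu> = sets borel" using inv by (simp add: invariant_def)
  obtain e where e: "0 < e" "ball x e \<subseteq> U" using U x by (auto simp: open_contains_ball)
  \<comment> \<open>Half the radius: when the walk from \<open>z\<close> is in the smaller ball, the
    walk from \<open>x\<close>, less than \<open>e / 2\<close> away from it, is in the ball of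
    radius \<open>e\<close>.\<close>
  let ?V = "ball x (e / 2)"
  let ?R = "\<lambda>z. \<integral>\<^sup>+ys. return_time (\<lambda>n. X n z ys) ?V \<partial>S"
  \<comment> \<open>Infinite mean return times on the whole ball would make the integral in
    \<open>kac\<close> infinite, because the ball has positive mass.\<close>
  have "\<exists>z\<in>?V. ?R z < \<infinity>"
  proof (rule ccontr)
    assume "\<not> ?thesis"
    then have "indicator ?V z * ?R z = \<infinity> * indicator ?V z" for z
      by (auto simp: indicator_def less_top[symmetric])
    then have "(\<integral>\<^sup>+z. \<infinity> * indicator ?V z \<partial>\<nu>) \<le> 1" using kac[OF inv open_ball, of x "e / 2"] by simp
    moreover have "(\<integral>\<^sup>+z. \<infinity> * indicator ?V z \<partial>\<nu>) = \<infinity> * emeasure \<nu> ?V"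
      by (rule nn_integral_cmult_indicator) (simp add: s)
    moreover have "0 < emeasure \<nu> ?V" using x(2) e by (simp add: supp_def)
    ultimately have "(\<infinity>::ennreal) \<le> 1" by (simp add: ennreal_top_mult zero_less_iff_neq_zero)
    then show False using ennreal_one_less_top by (simp add: top_unique)
  qed
  then obtain z where z: "z \<in> ?V" "?R z < \<infinity>" by blast
  have "return_time (\<lambda>n. X n x ys) U \<le> return_time (\<lambda>n. X n z ys) ?V" for ys
    unfolding return_time_def
  proof (rule INF_superset_mono)
    show "{n. 1 \<le> n \<and> X n z ys \<in> ?V} \<subseteq> {n. 1 \<le> n \<and> X n x ys \<in> U}"
    proof safe
      fix n assume "X n z ys \<in> ?V"
      then have "dist x (X n z ys) < e / 2" by simp
      moreover have "dist (X n z ys) (X n x ys) < e / 2"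
        using X_dist[of n z ys x] z(1) by (simp add: dist_commute)
      ultimately have "dist x (X n x ys) < e" using dist_triangle[of x "X n x ys" "X n z ys"] by linarith
      then show "X n x ys \<in> U" using e(2) by auto
    qed
  qed simp
  then have "(\<integral>\<^sup>+ys. return_time (\<lambda>n. X n x ys) U \<partial>S) \<le> ?R z" by (intro nn_integral_mono)
  then show ?thesis using z(2) by (rule le_less_trans)
qed

section \<open>Transfer to the given increments\<close>

lemma invariant_iff:
  assumes iid: "iid_with_law M Y \<mu>"
  shows "invariant_prob_on M Y K \<nu> \<longleftrightarrow> invariant \<nu>"
proof -
  interpret M: prob_space M using iid by (simp add: iid_with_law_def)
  have Y: "Y 1 \<in> borel_measurable M" "distr M borel (Y 1) = \<mu>"
    using iid by (auto simp: iid_with_law_def M.indep_vars_def2)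
  have "emeasure M {\<omega> \<in> space M. refl_walk (\<lambda>n. Y n \<omega>) x 1 \<in> A} = emeasure \<mu> {y. \<bar>x - y\<bar> \<in> A}"
    if A: "A \<in> sets borel" for A x
  proof -
    have "(\<lambda>y. \<bar>x - y\<bar>) \<in> borel_measurable borel" by (rule abs_vec_compose) simp_all
    from measurable_sets[OF this A] have m: "{y. \<bar>x - y\<bar> \<in> A} \<in> sets borel" by (simp add: vimage_def)
    have "{\<omega> \<in> space M. refl_walk (\<lambda>n. Y n \<omega>) x 1 \<in> A} = Y 1 -` {y. \<bar>x - y\<bar> \<in> A} \<inter> space M"
      by auto
    then show ?thesis unfolding Y(2)[symmetric] by (simp only: emeasure_distr[OF Y(1) m])
  qed
  then show ?thesis unfolding invariant_prob_on_def invariant_def by simp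
qed

lemma absorbed_by_supp:
  assumes iid: "iid_with_law M Y \<mu>" and inv: "invariant \<nu>" and x: "x \<in> K"
  shows "absorbed_by M Y x (supp \<nu>)"
proof -
  have "AE \<omega> in distr M S (\<lambda>\<omega>. to_stream (\<lambda>n. Y (Suc n) \<omega>)). (\<lambda>n. infdist (X n x \<omega>) (supp \<nu>)) \<longlonglongrightarrow> 0"
    unfolding iid_stream(2)[OF iid] by (rule invariant_absorbs[OF inv x])
  from AE_distrD[OF iid_stream(1)[OF iid] this] show ?thesis
    by (simp add: absorbed_by_def refl_walk_eq_flow)
qed

lemma positive_recurrent_on_supp:
  assumes iid: "iid_with_law M Y \<mu>" and inv: "invariant \<nu>"
  shows "positive_recurrent_on M Y (supp \<nu>)"
  unfolding positive_recurrent_on_def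
proof (intro allI impI ballI)
  fix U x assume U: "open U" and x: "x \<in> U \<inter> supp \<nu>"
  let ?F = "\<lambda>\<omega>. return_time (\<lambda>n. X n x \<omega>) U"
  have F: "?F \<in> borel_measurable S"
  proof -
    have [measurable]: "(\<lambda>\<omega>. X j x \<omega>) \<in> borel_measurable S" for j by measurable
    have [measurable]: "U \<in> sets borel" using U by simp
    show ?thesis unfolding return_time_eq_suminf by measurable
  qed
  have "(\<integral>\<^sup>+\<omega>. return_time (refl_walk (\<lambda>n. Y n \<omega>) x) U \<partial>M) =
      (\<integral>\<^sup>+\<omega>. ?F \<omega> \<partial>distr M S (\<lambda>\<omega>. to_stream (\<lambda>n. Y (Suc n) \<omega>)))"
    by (subst nn_integral_distr[OF iid_stream(1)[OF iid]])
       (simp_all add: F refl_walk_eq_flow[abs_def])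
  also have "\<dots> = (\<integral>\<^sup>+\<omega>. ?F \<omega> \<partial>S)" by (simp only: iid_stream(2)[OF iid])
  also have "\<dots> < \<infinity>" using invariant_recurrent[OF inv U] x by simp
  finally show "(\<integral>\<^sup>+\<omega>. return_time (refl_walk (\<lambda>n. Y n \<omega>) x) U \<partial>M) < \<infinity>" .
qed

end

text \<open>Positive recurrence is to be applied at the starting point 0; a positive point of the
  support keeps \<open>upper_end\<close> from falling below 0.\<close>

lemma zero_in_ess_set:
  assumes "emeasure (marginal \<mu> i) {0<..} > 0"
  shows "0 \<in> ess_set \<mu> D i"
proof -
  obtain t where t: "t \<in> supp (marginal \<mu> i)" "0 < t"
    using supp_meets_open[of "marginal \<mu> i" "{0<..}"] assms by (auto simp: marginal_def)
  have "ereal t \<le> (SUP y \<in> supp (marginal \<mu> i). ereal y)" using t by (intro SUP_upper)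
  then have "0 \<le> upper_end (marginal \<mu> i)"
    using t(2) unfolding upper_end_def by (auto intro: order_trans[of 0 "ereal t"])
  then show ?thesis by (auto simp: ess_set_def coord_space_def zero_ereal_def)
qed

text \<open>The open set \<open>{..<a}\<close> contains 0, which belongs to \<open>ess_set\<close>,
  so recurrence bounds the mean return time from 0; the equality of laws moves the bound to the
  stream space.\<close>

lemma hit_time_finite:
  fixes Y :: "nat \<Rightarrow> 'w \<Rightarrow> real ^ 'n"
  assumes iid: "iid_with_law M Y \<mu>" and \<mu>: "noise \<mu>"
    and pos: "emeasure (marginal \<mu> i) {0<..} > 0"
    and rec: "positive_recurrent_on M (\<lambda>n \<omega>. Y n \<omega> $ i) (ess_set \<mu> D i)"
    and a: "0 < a"
  shows "(\<integral>\<^sup>+\<omega>. return_time (\<lambda>n. flow (\<lambda>x y. \<bar>x - y $ i\<bar>) n 0 \<omega>) {..<a} \<partial>stream_space \<mu>) < \<infinity>"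
proof -
  interpret noise \<mu> by fact
  interpret coord_noise \<mu> "\<lambda>y. y $ i"
    by unfold_locales (intro borel_measurable_continuous_onI continuous_intros)
  let ?F = "\<lambda>\<omega>. return_time (\<lambda>n. rw n 0 \<omega>) {..<a}"
  have F: "?F \<in> borel_measurable S"
  proof -
    have [measurable]: "(\<lambda>\<omega>. rw j 0 \<omega>) \<in> borel_measurable S" for j by measurable
    show ?thesis unfolding return_time_eq_suminf by measurable
  qed
  have "(\<integral>\<^sup>+\<omega>. ?F \<omega> \<partial>S) = (\<integral>\<^sup>+\<omega>. ?F \<omega> \<partial>distr M S (\<lambda>\<omega>. to_stream (\<lambda>n. Y (Suc n) \<omega>)))"
    by (simp only: iid_stream(2)[OF iid])
  also have "\<dots> = (\<integral>\<^sup>+\<omega>. return_time (refl_walk (\<lambda>n. Y n \<omega> $ i) 0) {..<a} \<partial>M)"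
    by (subst nn_integral_distr[OF iid_stream(1)[OF iid]])
       (simp_all add: F refl_walk_coord_eq_flow[abs_def])
  also have "\<dots> < \<infinity>"
    using rec[unfolded positive_recurrent_on_def, rule_format, of "{..<a}" 0] zero_in_ess_set[OF pos] a by auto
  finally show ?thesis .
qed

theorem theorem4p3:
  fixes \<mu> :: "(real ^ 'n) measure"
    and D :: "'n set"
    and M :: "'w measure"
    and Y :: "nat \<Rightarrow> 'w \<Rightarrow> real ^ 'n"
  assumes "CARD('n) \<ge> 2"
    and "prob_space \<mu>" and "sets \<mu> = sets borel"
    and "AE y in \<mu>. \<forall>i\<in>D. y $ i \<in> \<int>"
    and "iid_with_law M Y \<mu>"
    and "\<And>i. emeasure (marginal \<mu> i) {0<..} > 0"
    and "\<And>i. i \<in> D \<Longrightarrow> supp (marginal \<mu> i) \<subseteq> \<int>"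
    and "\<And>i. i \<in> D \<Longrightarrow> Gcd {k::int. of_int k \<in> supp (marginal \<mu> i)} = 1"
    and "\<And>i. i \<notin> D \<Longrightarrow> non_lattice (marginal \<mu> i)"
    and "\<And>i. positive_recurrent_on M (\<lambda>n \<omega>. Y n \<omega> $ i) (ess_set \<mu> D i)"
  shows "\<forall>K \<in> state_classes \<mu> D.
           (\<exists>!\<nu>. invariant_prob_on M Y K \<nu>) \<and>
           (\<forall>\<nu>. invariant_prob_on M Y K \<nu> \<longrightarrow>
              (\<forall>x\<in>K. absorbed_by M Y x (supp \<nu>)) \<and> positive_recurrent_on M Y (supp \<nu>))"
proof
  fix K assume "K \<in> state_classes \<mu> D"
  then obtain C where C: "C \<in> rcosets\<^bsub>parity_group D\<^esub> (parity_subgroup \<mu> D)"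
    and K: "K = {x \<in> state_space D. parity D x \<in> C}"
    by (auto simp: state_classes_def)
  have noise: "noise \<mu>" using assms(2,3) by (simp add: noise_def noise_axioms_def)
  interpret noise \<mu> by (rule noise)
  interpret W: refl_class \<mu> D C
    by unfold_locales (use assms C hit_time_finite[OF assms(5) noise assms(6) assms(10)] in auto)
  have WK: "K = W.K" by (simp add: K W.K_def)
  show "(\<exists>!\<nu>. invariant_prob_on M Y K \<nu>) \<and>
      (\<forall>\<nu>. invariant_prob_on M Y K \<nu> \<longrightarrow>
        (\<forall>x\<in>K. absorbed_by M Y x (supp \<nu>)) \<and> positive_recurrent_on M Y (supp \<nu>))"
    unfolding WK W.invariant_iff[OF assms(5)]
  proof (intro conjI allI impI ballI)
    show "\<exists>!\<nu>. W.invariant \<nu>" using W.exists_invariant W.invariant_unique by blast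
    show "absorbed_by M Y x (supp \<nu>)" if "W.invariant \<nu>" "x \<in> W.K" for \<nu> x
      by (rule W.absorbed_by_supp[OF assms(5) that])
    show "positive_recurrent_on M Y (supp \<nu>)" if "W.invariant \<nu>" for \<nu>
      by (rule W.positive_recurrent_on_supp[OF assms(5) that])
  qed
qed

end
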